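(* Let $d\geq 3$, $\Omega=\{1,\ldots,d\}$, and let $F<F'<\mathrm{Sym}(\Omega)$ be permutation groups such that $F'$ preserves the orbits of $F$. If $F'$ acts 2-transitively on $\Omega$, then the group $G(F,F')$ is boundedly acyclic, i.e. $H^n_{\mathrm{cb}}(G(F,F');\mathbb{R})=0$ for every $n\geq 1$.
   Context: Let $T=\mathcal{T}_d$ be the $d$-regular tree, with vertex set $V(T)$ and set of (unoriented) edges $E(T)$. Fix a coloring $c\colon E(T)\to\Omega$ such that for every vertex $v$ the restriction $c_v$ of $c$ to the set $E(v)$ of edges containing $v$ is a bijection $E(v)\to\Omega$. For $g\in\mathrm{Aut}(T)$ and $v\in V(T)$ let $g_v\colon E(v)\to E(gv)$ be the induced bijection and define the local permutation $\sigma(g,v)=c_{gv}\circ g_v\circ c_v^{-1}\in\mathrm{Sym}(\Omega)$. For $F\le \mathrm{Sym}(\Omega)$ let $U(F)=\{g\in\mathrm{Aut}(T):\sigma(g,v)\in F \text{ for all } v\}$ and $G(F)=\{g\in \mathrm{Aut}(T): \sigma(g,v)\in F \text{ for all but finitely many } v\}$. For $F\le F'$ with $F'$ preserving the orbits of $F$ (each element of $F'$ maps each $F$-orbit to itself), set $G(F,F')=G(F)\cap U(F')$. It is endowed with the unique group topology for which the inclusion $U(F)\hookrightarrow G(F,F')$ is continuous and open, where $U(F)$ carries the topology of pointwise convergence induced from $\mathrm{Aut}(T)$; this makes $G(F,F')$ a totally disconnected locally compact group. For a locally compact group $G$, $H^n_{\mathrm{cb}}(G;\mathbb{R})$ denotes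 continuous bounded cohomology with trivial real coefficients: the cohomology of the complex of $G$-invariant continuous bounded functions $G^{n+1}\to\mathbb{R}$ (with $G$ acting diagonally by left translation) with the homogeneous coboundary $\delta f(g_0,\ldots,g_n)=\sum_i(-1)^i f(g_0,\ldots,\widehat{g_i},\ldots,g_n)$. A group is boundedly acyclic if this vanishes in all positive degrees. *)

theory Defs
  imports "HOL-Analysis.Analysis" "HOL-Combinatorics.Permutations"
begin

text \<open>A d-regular tree, given by its adjacency relation on the vertex type 'v
(all elements of 'v are vertices). Acyclicity is expressed as: every edge is a
bridge (removing it disconnects its endpoints).\<close>

definition regular_tree :: "nat \<Rightarrow> ('v \<Rightarrow> 'v \<Rightarrow> bool) \<Rightarrow> bool" where
  "regular_tree d adj \<longleftrightarrow>
     (\<forall>u v. adj u v \<longrightarrow> adj v u) \<and>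
     (\<forall>v. \<not> adj v v) \<and>
     (\<forall>u v. adj\<^sup>*\<^sup>* u v) \<and>
     (\<forall>u v. adj u v \<longrightarrow>
        \<not> (\<lambda>x y. adj x y \<and> \<not> (x = u \<and> y = v) \<and> \<not> (x = v \<and> y = u))\<^sup>*\<^sup>* u v) \<and>
     (\<forall>v. finite {w. adj v w} \<and> card {w. adj v w} = d)"

definition legal_coloring :: "nat \<Rightarrow> ('v \<Rightarrow> 'v \<Rightarrow> bool) \<Rightarrow> ('v \<Rightarrow> 'v \<Rightarrow> nat) \<Rightarrow> bool" where
  "legal_coloring d adj c \<longleftrightarrow>
     (\<forall>u v. adj u v \<longrightarrow> c u v = c v u) \<and>
     (\<forall>v. bij_betw (c v) {w. adj v w} {1..d})"

definition tree_aut :: "('v \<Rightarrow> 'v \<Rightarrow> bool) \<Rightarrow> ('v \<Rightarrow> 'v) set" where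
  "tree_aut adj = {g. bij g \<and> (\<forall>u v. adj u v \<longleftrightarrow> adj (g u) (g v))}"

definition nbr :: "('v \<Rightarrow> 'v \<Rightarrow> bool) \<Rightarrow> ('v \<Rightarrow> 'v \<Rightarrow> nat) \<Rightarrow> 'v \<Rightarrow> nat \<Rightarrow> 'v" where
  "nbr adj c v i = (THE w. adj v w \<and> c v w = i)"

definition loc_perm :: "nat \<Rightarrow> ('v \<Rightarrow> 'v \<Rightarrow> bool) \<Rightarrow> ('v \<Rightarrow> 'v \<Rightarrow> nat) \<Rightarrow> ('v \<Rightarrow> 'v) \<Rightarrow> 'v \<Rightarrow> nat \<Rightarrow> nat" where
  "loc_perm d adj c g v = (\<lambda>i. if i \<in> {1..d} then c (g v) (g (nbr adj c v i)) else i)"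

definition perm_group :: "nat \<Rightarrow> (nat \<Rightarrow> nat) set \<Rightarrow> bool" where
  "perm_group d F \<longleftrightarrow>
     F \<subseteq> {p. p permutes {1..d}} \<and> id \<in> F \<and>
     (\<forall>p\<in>F. \<forall>q\<in>F. p \<circ> q \<in> F) \<and> (\<forall>p\<in>F. inv p \<in> F)"

definition preserves_orbits :: "nat \<Rightarrow> (nat \<Rightarrow> nat) set \<Rightarrow> (nat \<Rightarrow> nat) set \<Rightarrow> bool" where
  "preserves_orbits d F F' \<longleftrightarrow> (\<forall>p\<in>F'. \<forall>i\<in>{1..d}. p i \<in> {q i | q. q \<in> F})"

definition two_transitive :: "nat \<Rightarrow> (nat \<Rightarrow> nat) set \<Rightarrow> bool" where
  "two_transitive d F \<longleftrightarrow>
     (\<forall>i\<in>{1..d}. \<forall>j\<in>{1..d}. \<forall>k\<in>{1..d}. \<forall>l\<in>{1..d}.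
        i \<noteq> j \<longrightarrow> k \<noteq> l \<longrightarrow> (\<exists>p\<in>F. p i = k \<and> p j = l))"

definition U_grp :: "nat \<Rightarrow> ('v \<Rightarrow> 'v \<Rightarrow> bool) \<Rightarrow> ('v \<Rightarrow> 'v \<Rightarrow> nat) \<Rightarrow> (nat \<Rightarrow> nat) set \<Rightarrow> ('v \<Rightarrow> 'v) set" where
  "U_grp d adj c F = {g \<in> tree_aut adj. \<forall>v. loc_perm d adj c g v \<in> F}"

definition G_grp :: "nat \<Rightarrow> ('v \<Rightarrow> 'v \<Rightarrow> bool) \<Rightarrow> ('v \<Rightarrow> 'v \<Rightarrow> nat) \<Rightarrow> (nat \<Rightarrow> nat) set \<Rightarrow> ('v \<Rightarrow> 'v) set" where
  "G_grp d adj c F = {g \<in> tree_aut adj. finite {v. loc_perm d adj c g v \<notin> F}}"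

definition GFF :: "nat \<Rightarrow> ('v \<Rightarrow> 'v \<Rightarrow> bool) \<Rightarrow> ('v \<Rightarrow> 'v \<Rightarrow> nat) \<Rightarrow> (nat \<Rightarrow> nat) set \<Rightarrow> (nat \<Rightarrow> nat) set \<Rightarrow> ('v \<Rightarrow> 'v) set" where
  "GFF d adj c F F' = G_grp d adj c F \<inter> U_grp d adj c F'"

text \<open>Pointwise stabiliser in U(F) of a finite vertex set S; these form a base of
identity neighbourhoods of U(F) for the topology of pointwise convergence.\<close>
definition U_stab :: "nat \<Rightarrow> ('v \<Rightarrow> 'v \<Rightarrow> bool) \<Rightarrow> ('v \<Rightarrow> 'v \<Rightarrow> nat) \<Rightarrow> (nat \<Rightarrow> nat) set \<Rightarrow> 'v set \<Rightarrow> ('v \<Rightarrow> 'v) set" where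
  "U_stab d adj c F S = {g \<in> U_grp d adj c F. \<forall>v\<in>S. g v = v}"

text \<open>The group topology on G(F,F') in which U(F) is an open subgroup carrying the
topology of pointwise convergence: left cosets of the U_stab S form a base.\<close>
definition GFF_top :: "nat \<Rightarrow> ('v \<Rightarrow> 'v \<Rightarrow> bool) \<Rightarrow> ('v \<Rightarrow> 'v \<Rightarrow> nat) \<Rightarrow> (nat \<Rightarrow> nat) set \<Rightarrow> (nat \<Rightarrow> nat) set \<Rightarrow> ('v \<Rightarrow> 'v) topology" where
  "GFF_top d adj c F F' = topology (\<lambda>A. A \<subseteq> GFF d adj c F F' \<and>
      (\<forall>g\<in>A. \<exists>S. finite S \<and> (\<lambda>h. g \<circ> h) ` U_stab d adj c F S \<subseteq> A))"

text \<open>Tuples (g_0,...,g_n) are functions on {..n}; G^{n+1} = PiE {..n} (\<lambda>_. G).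
The group law is composition (g*h = g o h).\<close>

definition cb_cochain :: "('a \<Rightarrow> 'a \<Rightarrow> 'a) \<Rightarrow> 'a set \<Rightarrow> 'a topology \<Rightarrow> nat \<Rightarrow> ((nat \<Rightarrow> 'a) \<Rightarrow> real) \<Rightarrow> bool" where
  "cb_cochain gmul G T n f \<longleftrightarrow>
     (\<forall>g\<in>G. \<forall>x\<in>PiE {..n} (\<lambda>_. G). f (\<lambda>i\<in>{..n}. gmul g (x i)) = f x) \<and>
     continuous_map (product_topology (\<lambda>_. T) {..n}) euclideanreal f \<and>
     (\<exists>B. \<forall>x\<in>PiE {..n} (\<lambda>_. G). \<bar>f x\<bar> \<le> B)"

definition del_idx :: "nat \<Rightarrow> (nat \<Rightarrow> 'a) \<Rightarrow> nat \<Rightarrow> 'a" where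
  "del_idx i x = (\<lambda>j. if j < i then x j else x (Suc j))"

definition cobound :: "nat \<Rightarrow> ((nat \<Rightarrow> 'a) \<Rightarrow> real) \<Rightarrow> (nat \<Rightarrow> 'a) \<Rightarrow> real" where
  "cobound n f x = (\<Sum>i\<in>{..Suc n}. (-1) ^ i * f (restrict (del_idx i x) {..n}))"

definition Hcb_vanishes :: "('a \<Rightarrow> 'a \<Rightarrow> 'a) \<Rightarrow> 'a set \<Rightarrow> 'a topology \<Rightarrow> nat \<Rightarrow> bool" where
  "Hcb_vanishes gmul G T n \<longleftrightarrow>
     (\<forall>f. cb_cochain gmul G T n f \<and> (\<forall>x\<in>PiE {..Suc n} (\<lambda>_. G). cobound n f x = 0) \<longrightarrow>
        (\<exists>b. cb_cochain gmul G T (n - 1) b \<and>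
             (\<forall>x\<in>PiE {..n} (\<lambda>_. G). cobound (n - 1) b x = f x)))"

definition boundedly_acyclic :: "('a \<Rightarrow> 'a \<Rightarrow> 'a) \<Rightarrow> 'a set \<Rightarrow> 'a topology \<Rightarrow> bool" where
  "boundedly_acyclic gmul G T \<longleftrightarrow> (\<forall>n\<ge>1. Hcb_vanishes gmul G T n)"

end

theory Submission
  imports Defs "HOL-Library.Sublist"
begin

text \<open>
  Tuples are lists, and cochains are compared by explicit homotopies. Averaging a cocycle over the
  compact group \<open>K\<close>, the stabiliser of a vertex in \<open>U(F)\<close>, makes it right \<open>K\<close>-invariant.
  The stabiliser \<open>G\<^sub>v\<close> of the vertex in \<open>G = G(F,F')\<close> is an increasing union of groups containing
  \<open>K\<close> with finite index, so averaging over finite transversals and passing to an ultralimit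
  makes the cocycle right \<open>G\<^sub>v\<close>-invariant, that is, a function on tuples of vertices of the tree.
  Such a function is cohomologous to one that depends only on its values on aligned tuples (tuples
  contained in a geodesic segment): aligned tuples admit a bounded equivariant cone operator from
  any vertex \<open>p\<close>, obtained by subdividing the segment at the projection of \<open>p\<close>. Since \<open>F'\<close> is
  2-transitive and preserves the orbits of \<open>F\<close>, the group \<open>G\<close> is transitive on oriented segments
  of given length. A cocycle on aligned tuples is therefore a cocycle on \<open>\<int>\<close> that is invariant under
  the infinite dihedral group, and averaging along \<open>\<int>\<close> trivialises it.
\<close>

section \<open>The augmented complex of functions on lists\<close>

text \<open>Averaging over \<open>K\<close> first disposes of the topology: \<open>K\<close> is
  open, so right \<open>K\<close>-invariant cochains are continuous, and only the first of the three
  primitives needs a continuity estimate. Finite averages and ultralimits do the work of Haar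
  measure, for \<open>K\<close> as well as for the stabiliser, which need not be compact. On the
  tree the obstacle is that the orbits of \<open>G\<close> on arbitrary tuples are hard to control,
  whereas aligned tuples are classified by their mutual distances. Coning at \<open>p\<close>
  destroys alignment, because \<open>p\<close> and a segment span a tripod; cutting the segment at
  the foot of the tripod leaves two pieces, each aligned together with \<open>p\<close>. Iterating
  these cones gives a cochain map homotopic to the identity that reads aligned tuples only, and
  independence of the cone from the chosen segment gives its equivariance. An element of
  \<open>G\<close> leaves \<open>F\<close> at finitely many vertices only, so a whole line need not
  be movable at will; the argument moves finite pieces of lines, which is all that a cochain
  sees.\<close>

fun cbd :: "('a list \<Rightarrow> real) \<Rightarrow> 'a list \<Rightarrow> real" where
  "cbd f [] = 0"
| "cbd f (x # xs) = f xs - cbd (\<lambda>ys. f (x # ys)) xs"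

lemma cbd_cong:
  assumes "\<And>ys. set ys \<subseteq> set xs \<Longrightarrow> Suc (length ys) = length xs \<Longrightarrow> f ys = g ys"
  shows "cbd f xs = cbd g xs"
  using assms
proof (induction xs arbitrary: f g)
  case (Cons x xs)
  have "cbd (\<lambda>ys. f (x # ys)) xs = cbd (\<lambda>ys. g (x # ys)) xs"
    by (rule Cons.IH, rule Cons.prems) auto
  moreover have "f xs = g xs" by (rule Cons.prems) auto
  ultimately show ?case by simp
qed simp

lemma cbd_add: "cbd (\<lambda>ys. f ys + g ys) xs = cbd f xs + cbd g xs"
  by (induction xs arbitrary: f g) auto

lemma cbd_diff: "cbd (\<lambda>ys. f ys - g ys) xs = cbd f xs - cbd g xs"
  by (induction xs arbitrary: f g) auto

lemma cbd_divide: "cbd (\<lambda>ys. f ys / a) xs = cbd f xs / a"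
  by (induction xs arbitrary: f) (auto simp: diff_divide_distrib)

lemma cbd_sum: "cbd (\<lambda>ys. \<Sum>i\<in>I. f i ys) xs = (\<Sum>i\<in>I. cbd (f i) xs)"
  by (induction xs arbitrary: f) (auto simp: sum_subtractf)

lemma cbd_map: "cbd f (map g xs) = cbd (\<lambda>ys. f (map g ys)) xs"
  by (induction xs arbitrary: f) auto

lemma cbd_cbd: "cbd (cbd f) xs = 0"
  by (induction xs arbitrary: f) (auto simp: cbd_diff)

lemma cbd_tendsto:
  assumes "\<And>ys. set ys \<subseteq> set xs \<Longrightarrow> Suc (length ys) = length xs \<Longrightarrow> ((\<lambda>j. f j ys) \<longlongrightarrow> g ys) U"
  shows "((\<lambda>j. cbd (f j) xs) \<longlongrightarrow> cbd g xs) U"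
  using assms
proof (induction xs arbitrary: f g)
  case (Cons x xs)
  have "((\<lambda>j. cbd (\<lambda>ys. f j (x # ys)) xs) \<longlongrightarrow> cbd (\<lambda>ys. g (x # ys)) xs) U"
    by (rule Cons.IH, rule Cons.prems) auto
  moreover have "((\<lambda>j. f j xs) \<longlongrightarrow> g xs) U" by (rule Cons.prems) auto
  ultimately show ?case by (auto intro: tendsto_diff)
qed simp

text \<open>The recursion suits inductions on lists; this is its link with the alternating sum in
  \<open>cobound\<close>.\<close>

lemma cbd_conv_sum:
  "cbd f xs = (\<Sum>i<length xs. (-1) ^ i * f (take i xs @ drop (Suc i) xs))"
proof (induction xs arbitrary: f)
  case (Cons x xs)
  show ?case
    by (simp add: Cons.IH sum.lessThan_Suc_shift sum_negf del: sum.lessThan_Suc)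
qed simp

section \<open>Prism homotopies and iterated cones\<close>

text \<open>The prism operator: unfolded, it is the alternating sum over \<open>i\<close> of
  \<open>A\<close>, applied to \<open>f\<close> with \<open>x0, ..., xi\<close> fixed in front, at
  the list \<open>[xi, ..., xn]\<close>. The entry \<open>xi\<close> occurs in both places.\<close>

fun hom :: "(('a list \<Rightarrow> real) \<Rightarrow> 'a list \<Rightarrow> real) \<Rightarrow> ('a list \<Rightarrow> real) \<Rightarrow> 'a list \<Rightarrow> real" where
  "hom A f [] = 0"
| "hom A f (x # xs) = A (\<lambda>ys. f (x # ys)) (x # xs) - hom A (\<lambda>ys. f (x # ys)) xs"

lemma hom_diff:
  assumes "\<And>f g xs. A (\<lambda>ys. f ys - g ys) xs = A f xs - A g xs"
  shows "hom A (\<lambda>ys. f ys - g ys) xs = hom A f xs - hom A g xs"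
  by (induction xs arbitrary: f g) (auto simp: assms)

text \<open>The terms \<open>hom A f xs\<close> cancel, and \<open>comm\<close> at
  \<open>x # xs\<close> leaves \<open>- A ?g xs\<close>, which the induction hypothesis for
  \<open>?g\<close> turns into \<open>- f (x # xs)\<close>.\<close>

lemma hom_homotopy:
  assumes diff: "\<And>f g xs. A (\<lambda>ys. f ys - g ys) xs = A f xs - A g xs"
    and nil: "\<And>f. A f [] = f []"
    and comm: "\<And>f xs. A (cbd f) xs = cbd (A f) xs"
  shows "cbd (hom A f) xs + hom A (cbd f) xs = A f xs - f xs"
proof (induction xs arbitrary: f)
  case (Cons x xs)
  let ?g = "\<lambda>ys. f (x # ys)"
  have "cbd (hom A f) (x # xs) = hom A f xs - cbd (\<lambda>ys. A ?g (x # ys)) xs + cbd (hom A ?g) xs"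
    by (simp add: cbd_diff)
  moreover have "hom A (cbd f) (x # xs) =
      A f (x # xs) - A (cbd ?g) (x # xs) - hom A f xs + hom A (cbd ?g) xs"
    by (simp add: diff hom_diff[OF diff])
  moreover have "A (cbd ?g) (x # xs) = A ?g xs - cbd (\<lambda>ys. A ?g (x # ys)) xs"
    by (simp add: comm)
  ultimately show ?case using Cons.IH[of ?g] by simp
qed (simp add: nil)

lemma hom_cong:
  assumes A: "\<And>f g xs. set xs \<subseteq> S \<Longrightarrow>
      (\<And>ys. set ys \<subseteq> S \<Longrightarrow> length ys = length xs \<Longrightarrow> f ys = g ys) \<Longrightarrow> A f xs = A g xs"
    and "set xs \<subseteq> S"
    and "\<And>ys. set ys \<subseteq> S \<Longrightarrow> length ys = Suc (length xs) \<Longrightarrow> f ys = g ys"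
  shows "hom A f xs = hom A g xs"
  using assms(2,3)
proof (induction xs arbitrary: f g)
  case (Cons x xs)
  have "A (\<lambda>ys. f (x # ys)) (x # xs) = A (\<lambda>ys. g (x # ys)) (x # xs)"
    by (rule A) (use Cons.prems in auto)
  moreover have "hom A (\<lambda>ys. f (x # ys)) xs = hom A (\<lambda>ys. g (x # ys)) xs"
    by (rule Cons.IH) (use Cons.prems in auto)
  ultimately show ?case by simp
qed simp

lemma hom_bound:
  assumes A: "\<And>f xs. set xs \<subseteq> S \<Longrightarrow>
      (\<And>ys. set ys \<subseteq> S \<Longrightarrow> length ys = length xs \<Longrightarrow> \<bar>f ys\<bar> \<le> B) \<Longrightarrow> \<bar>A f xs\<bar> \<le> C"
    and "set xs \<subseteq> S"
    and "\<And>ys. set ys \<subseteq> S \<Longrightarrow> length ys = Suc (length xs) \<Longrightarrow> \<bar>f ys\<bar> \<le> B"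
  shows "\<bar>hom A f xs\<bar> \<le> real (length xs) * C"
  using assms(2-)
proof (induction xs arbitrary: f)
  case (Cons x xs)
  have "\<bar>A (\<lambda>ys. f (x # ys)) (x # xs)\<bar> \<le> C"
    by (rule A) (use Cons.prems in auto)
  moreover have "\<bar>hom A (\<lambda>ys. f (x # ys)) xs\<bar> \<le> real (length xs) * C"
    by (rule Cons.IH) (use Cons.prems in auto)
  ultimately show ?case by (simp add: algebra_simps)
qed simp

text \<open>Dual of the chain map that sends \<open>x # xs\<close> to the cone with apex
  \<open>x\<close> over the image of \<open>xs\<close>; \<open>h x f\<close> stands for
  \<open>f\<close> evaluated on cones with apex \<open>x\<close>.\<close>

fun pull :: "('a \<Rightarrow> ('a list \<Rightarrow> real) \<Rightarrow> 'a list \<Rightarrow> real) \<Rightarrow> ('a list \<Rightarrow> real) \<Rightarrow> 'a list \<Rightarrow> real" where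
  "pull h f [] = f []"
| "pull h f (x # xs) = pull h (h x f) xs"

lemma pull_diff:
  assumes "\<And>x f g. h x (\<lambda>ys. f ys - g ys) = (\<lambda>ys. h x f ys - h x g ys)"
  shows "pull h (\<lambda>ys. f ys - g ys) xs = pull h f xs - pull h g xs"
  by (induction xs arbitrary: f g) (auto simp: assms)

lemma pull_cong:
  assumes h: "\<And>x f g ys. good ys \<Longrightarrow>
      (\<And>zs. good zs \<Longrightarrow> length zs = Suc (length ys) \<Longrightarrow> f zs = g zs) \<Longrightarrow> h x f ys = h x g ys"
    and "good []"
    and "\<And>ys. good ys \<Longrightarrow> length ys = length xs \<Longrightarrow> f ys = g ys"
  shows "pull h f xs = pull h g xs"
  using assms(3)
proof (induction xs arbitrary: f g)
  case (Cons x xs)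
  show ?case unfolding pull.simps
    by (rule Cons.IH, rule h, assumption, rule Cons.prems) auto
qed (use assms(2) in simp)

text \<open>Coning with the first entry turns \<open>cbd f\<close> into
  \<open>f - cbd (h x f)\<close>, which are the two terms in the recursion of \<open>cbd\<close>.
  The cone identity is required on good lists alone, since iterated cones start at \<open>[]\<close>
  and read good lists only.\<close>

lemma pull_cbd:
  assumes diff: "\<And>x f g. h x (\<lambda>ys. f ys - g ys) = (\<lambda>ys. h x f ys - h x g ys)"
    and h: "\<And>x f g ys. good ys \<Longrightarrow>
      (\<And>zs. good zs \<Longrightarrow> length zs = Suc (length ys) \<Longrightarrow> f zs = g zs) \<Longrightarrow> h x f ys = h x g ys"
    and nil: "good []"
    and cone: "\<And>x f ys. good ys \<Longrightarrow> h x (cbd f) ys = f ys - cbd (h x f) ys"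
  shows "pull h (cbd f) xs = cbd (pull h f) xs"
proof (induction xs arbitrary: f)
  case (Cons x xs)
  have "pull h (cbd f) (x # xs) = pull h (\<lambda>ys. f ys - cbd (h x f) ys) xs"
    unfolding pull.simps by (rule pull_cong[where good = good, OF h nil]) (auto simp: cone)
  also have "\<dots> = pull h f xs - cbd (pull h (h x f)) xs"
    by (simp add: pull_diff[OF diff] Cons.IH)
  finally show ?case by simp
qed simp

section \<open>Ultrafilter limits\<close>

text \<open>Zorn for the reversed order: a minimal proper filter decides every \<open>P\<close>,
  because restricting it to \<open>P\<close> gives either \<open>bot\<close> or, by minimality, the
  filter itself.\<close>

lemma ex_ultrafilter:
  "\<exists>U :: nat filter. U \<noteq> bot \<and> U \<le> sequentially \<and>
     (\<forall>P. eventually P U \<or> eventually (\<lambda>x. \<not> P x) U)"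
proof -
  let ?A = "{U :: nat filter. U \<noteq> bot \<and> U \<le> sequentially}"
  have "\<exists>m\<in>?A. \<forall>a\<in>?A. a \<le> m \<longrightarrow> a = m"
  proof (rule predicate_Zorn)
    show "partial_order_on ?A (relation_of (\<lambda>a b. b \<le> a) ?A)"
      by (rule partial_order_on_relation_ofI) auto
  next
    fix C assume C: "C \<in> Chains (relation_of (\<lambda>a b. b \<le> a) ?A)"
    have CA: "C \<subseteq> ?A" using C by (auto simp: Chains_def relation_of_def)
    have tot: "x \<le> y \<or> y \<le> x" if "x \<in> C" "y \<in> C" for x y
      using C that by (auto simp: Chains_def relation_of_def)
    show "\<exists>u\<in>?A. \<forall>a\<in>C. u \<le> a"
    proof (cases "C = {}")
      case True then show ?thesis by (auto intro!: exI[of _ sequentially])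
    next
      case False
      have "eventually P (Inf C) \<longleftrightarrow> (\<exists>b\<in>C. eventually P b)" for P
        by (rule eventually_Inf_base[OF False]) (use tot in \<open>force\<close>)
      then have "Inf C \<noteq> bot"
        using CA by (auto simp: trivial_limit_def)
      moreover have "Inf C \<le> sequentially"
        using False CA by (metis (no_types, lifting) Inf_lower2 equals0I mem_Collect_eq subsetD)
      ultimately show ?thesis by (auto intro!: bexI[of _ "Inf C"] Inf_lower)
    qed
  qed
  then obtain U where U: "U \<noteq> bot" "U \<le> sequentially"
    and min: "\<And>V. V \<noteq> bot \<Longrightarrow> V \<le> sequentially \<Longrightarrow> V \<le> U \<Longrightarrow> V = U" by auto
  have "eventually P U \<or> eventually (\<lambda>x. \<not> P x) U" for P
  proof (cases "inf U (principal {x. P x}) = bot")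
    case True
    then show ?thesis
      by (auto simp: trivial_limit_def eventually_inf_principal)
  next
    case False
    then have "inf U (principal {x. P x}) = U"
      using U by (intro min) (auto intro: le_infI1)
    then have "U \<le> principal {x. P x}" by (metis inf_le2)
    then show ?thesis by (auto simp: le_principal)
  qed
  with U show ?thesis by blast
qed

definition ufilter :: "nat filter" where
  "ufilter = (SOME U. U \<noteq> bot \<and> U \<le> sequentially \<and>
     (\<forall>P. eventually P U \<or> eventually (\<lambda>x. \<not> P x) U))"

lemma ufilter_bot [simp]: "ufilter \<noteq> bot"
  and ufilter_le: "ufilter \<le> sequentially"
  and ufilter_ultra: "eventually P ufilter \<or> eventually (\<lambda>x. \<not> P x) ufilter"
  using someI_ex[OF ex_ultrafilter] unfolding ufilter_def by blast+

lemma eventually_ufilter: "eventually P sequentially \<Longrightarrow> eventually P ufilter"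
  using ufilter_le by (rule filter_leD)

lemma ufilter_finite_range:
  assumes "finite A" "\<And>j. f j \<in> A"
  shows "\<exists>a\<in>A. eventually (\<lambda>j. f j = a) ufilter"
proof (rule ccontr)
  assume "\<not> ?thesis"
  then have "\<forall>a\<in>A. eventually (\<lambda>j. f j \<noteq> a) ufilter" using ufilter_ultra by blast
  then have "eventually (\<lambda>j. \<forall>a\<in>A. f j \<noteq> a) ufilter"
    using assms(1) by (simp add: eventually_ball_finite)
  then have "eventually (\<lambda>j. False) ufilter"
    by (rule eventually_mono) (use assms(2) in blast)
  then show False by simp
qed

definition ulim :: "(nat \<Rightarrow> real) \<Rightarrow> real" where
  "ulim f = Lim ufilter f"

lemma ulim_tendsto:
  assumes "\<And>j. \<bar>f j\<bar> \<le> B"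
  shows "(f \<longlongrightarrow> ulim f) ufilter"
proof -
  have "\<exists>x\<in>{-B..B}. inf (nhds x) (filtermap f ufilter) \<noteq> bot"
    using compact_Icc[of "-B" B] assms unfolding compact_filter
    by (elim allE[of _ "filtermap f ufilter"]) (auto simp: filtermap_bot_iff eventually_filtermap abs_le_iff minus_le_iff)
  then obtain x where x: "inf (nhds x) (filtermap f ufilter) \<noteq> bot" by blast
  have "(f \<longlongrightarrow> x) ufilter"
  proof (rule topological_tendstoI)
    fix S assume S: "open S" "x \<in> S"
    show "eventually (\<lambda>j. f j \<in> S) ufilter"
    proof (rule ccontr)
      assume "\<not> ?thesis"
      then have "eventually (\<lambda>y. y \<notin> S) (filtermap f ufilter)"
        using ufilter_ultra[of "\<lambda>j. f j \<in> S"] by (simp add: eventually_filtermap)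
      moreover have "eventually (\<lambda>y. y \<in> S) (nhds x)" using S by (simp add: eventually_nhds_in_open)
      ultimately have "eventually (\<lambda>y. False) (inf (nhds x) (filtermap f ufilter))"
        by (auto simp: eventually_inf)
      then show False using x by (simp add: trivial_limit_def)
    qed
  qed
  then show ?thesis unfolding ulim_def by (simp add: tendsto_Lim)
qed

lemma ulim_eqI: "(f \<longlongrightarrow> x) ufilter \<Longrightarrow> ulim f = x"
  unfolding ulim_def by (simp add: tendsto_Lim)

lemma ulim_eq_diff:
  assumes "\<And>j. \<bar>f j\<bar> \<le> B" "((\<lambda>j. f j - g j) \<longlongrightarrow> 0) ufilter"
  shows "ulim g = ulim f"
proof (rule ulim_eqI)
  have "((\<lambda>j. f j - (f j - g j)) \<longlongrightarrow> ulim f - 0) ufilter"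
    by (rule tendsto_diff[OF ulim_tendsto[OF assms(1)] assms(2)])
  then show "(g \<longlongrightarrow> ulim f) ufilter" by simp
qed

lemma ulim_abs_le:
  assumes "\<And>j. \<bar>f j\<bar> \<le> B"
  shows "\<bar>ulim f\<bar> \<le> B"
  using ulim_tendsto[of f B] assms
  by (intro tendsto_upperbound[of "\<lambda>j. \<bar>f j\<bar>" _ ufilter]) (auto intro: tendsto_rabs)

section \<open>Vertices as reduced words\<close>

locale legal_tree =
  fixes d :: nat and adj :: "'v \<Rightarrow> 'v \<Rightarrow> bool" and c :: "'v \<Rightarrow> 'v \<Rightarrow> nat"
  assumes tree: "regular_tree d adj" and coloring: "legal_coloring d adj c"
begin

abbreviation nb :: "'v \<Rightarrow> nat \<Rightarrow> 'v" where "nb \<equiv> nbr adj c"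
abbreviation walk :: "'v \<Rightarrow> nat list \<Rightarrow> 'v" where "walk \<equiv> foldl nb"

lemma adj_sym: "adj u v \<Longrightarrow> adj v u"
  and adj_connected: "adj\<^sup>*\<^sup>* u v"
  and adj_bridge: "adj u v \<Longrightarrow>
        \<not> (\<lambda>x y. adj x y \<and> \<not> (x = u \<and> y = v) \<and> \<not> (x = v \<and> y = u))\<^sup>*\<^sup>* u v"
  using tree unfolding regular_tree_def by blast+

lemma color_sym: "adj u v \<Longrightarrow> c u v = c v u"
  and color_bij: "bij_betw (c v) {w. adj v w} {1..d}"
  using coloring unfolding legal_coloring_def by blast+

lemma nb_ex1: "i \<in> {1..d} \<Longrightarrow> \<exists>!w. adj v w \<and> c v w = i"
  using color_bij[of v] unfolding bij_betw_def inj_on_def by (auto simp: set_eq_iff image_iff) metis+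

lemma nb_adj: "i \<in> {1..d} \<Longrightarrow> adj v (nb v i)"
  and nb_color: "i \<in> {1..d} \<Longrightarrow> c v (nb v i) = i"
  using theI'[OF nb_ex1] unfolding nbr_def by blast+

lemma color_range: "adj v w \<Longrightarrow> c v w \<in> {1..d}"
  using color_bij[of v] unfolding bij_betw_def by blast

lemma nb_of_color: "adj v w \<Longrightarrow> nb v (c v w) = w"
  using nb_ex1[OF color_range] unfolding nbr_def by blast

lemma nb_nb: "i \<in> {1..d} \<Longrightarrow> nb (nb v i) i = v"
  using nb_of_color[of "nb v i" v] nb_adj nb_color color_sym adj_sym by metis

lemma nb_inj: "i \<in> {1..d} \<Longrightarrow> j \<in> {1..d} \<Longrightarrow> nb v i = nb v j \<longleftrightarrow> i = j"
  using nb_color by metis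

lemma adj_iff_nb: "adj u v \<longleftrightarrow> (\<exists>i\<in>{1..d}. v = nb u i)"
  using nb_adj nb_of_color color_range by metis

text \<open>Using a color twice in a row means going back along the same edge, so these are the
  color sequences of walks without backtracking.\<close>

definition red :: "nat list \<Rightarrow> bool" where
  "red w \<longleftrightarrow> set w \<subseteq> {1..d} \<and> distinct_adj w"

lemma red_Nil [simp]: "red []"
  by (simp add: red_def)

lemma red_Cons: "red (i # w) \<longleftrightarrow> i \<in> {1..d} \<and> red w \<and> (w = [] \<or> i \<noteq> hd w)"
  by (cases w) (auto simp: red_def)

lemma red_append: "red (u @ w) \<longleftrightarrow> red u \<and> red w \<and> (u = [] \<or> w = [] \<or> last u \<noteq> hd w)"
  by (auto simp: red_def distinct_adj_append_iff)

lemma red_rev [simp]: "red (rev w) \<longleftrightarrow> red w"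
  by (auto simp: red_def)

lemma red_prefix: "prefix u w \<Longrightarrow> red w \<Longrightarrow> red u"
  by (auto simp: prefix_def red_append)

lemma walk_rev: "set w \<subseteq> {1..d} \<Longrightarrow> walk (walk v w) (rev w) = v"
  by (induction w arbitrary: v) (auto simp: nb_nb)

text \<open>The first edge, from \<open>p\<close> to \<open>q\<close>, is a bridge. In a shortest
  nonempty closed reduced walk the remaining steps avoid it, yet they lead from \<open>q\<close>
  back to \<open>p\<close>.\<close>

lemma closed_red_walk: "red w \<Longrightarrow> walk p w = p \<Longrightarrow> w = []"
proof (induction "length w" arbitrary: w p rule: less_induct)
  case less
  show ?case
  proof (cases w)
    case (Cons i w')
    define q where "q = nb p i"
    let ?R = "\<lambda>x y. adj x y \<and> \<not> (x = q \<and> y = p) \<and> \<not> (x = p \<and> y = q)"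
    have i: "i \<in> {1..d}" and w': "red w'" using less.prems Cons by (auto simp: red_Cons)
    have "?R\<^sup>*\<^sup>* q (walk q (take k w'))" if "k \<le> length w'" for k
      using that
    proof (induction k)
      case (Suc k)
      let ?x = "walk q (take k w')"
      have k: "k < length w'" using Suc by simp
      have tk: "take (Suc k) w' = take k w' @ [w' ! k]" using k by (rule take_Suc_conv_app_nth)
      have wk: "w' ! k \<in> {1..d}" using w' k unfolding red_def by (meson nth_mem subsetD)
      \<comment> \<open>A return to \<open>p\<close> before the end would be a shorter closed
        reduced walk.\<close>
      have xp: "?x \<noteq> p"
      proof
        assume "?x = p"
        then have "walk p (take (Suc k) w) = p" by (simp add: Cons q_def)
        moreover have "red (take (Suc k) w)" using less.prems take_is_prefix red_prefix by blast
        ultimately have "take (Suc k) w = []"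
          by (intro less.hyps[of "take (Suc k) w" p]) (use k Cons in auto)
        then show False using Cons by simp
      qed
      \<comment> \<open>Crossing the bridge backwards requires being at \<open>q\<close>. By
        minimality this happens only at the start of \<open>w'\<close>, where the color
        \<open>i\<close> is ruled out by reducedness.\<close>
      have "\<not> (?x = q \<and> nb ?x (w' ! k) = p)"
      proof
        assume a: "?x = q \<and> nb ?x (w' ! k) = p"
        have "red (take k w')" using w' take_is_prefix red_prefix by blast
        then have "take k w' = []"
          by (intro less.hyps[of "take k w'" q]) (use a k Cons in auto)
        then have "k = 0" using k by auto
        moreover have "nb q i = p" unfolding q_def by (rule nb_nb[OF i])
        ultimately have "nb q (w' ! 0) = nb q i" using a by simp
        then have "w' ! 0 = i" using nb_inj[OF _ i] wk \<open>k = 0\<close> by blast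
        then show False using less.prems(1) Cons \<open>k = 0\<close> k by (auto simp: red_Cons hd_conv_nth)
      qed
      then have "?R ?x (nb ?x (w' ! k))" using nb_adj[OF wk] xp by blast
      then show ?case using Suc k by (auto simp: tk intro: rtranclp.rtrancl_into_rtrancl)
    qed simp
    from this[of "length w'"] have "?R\<^sup>*\<^sup>* q p" using less.prems Cons by (simp add: q_def)
    moreover have "adj q p" using nb_adj[OF i] adj_sym unfolding q_def by blast
    ultimately show ?thesis using adj_bridge[of q p] by blast
  qed simp
qed

text \<open>Compare last letters: equal ones are stripped, and different ones make the first word
  followed by the reversed second word a closed reduced walk.\<close>

lemma red_walk_inj:
  assumes "red u" "red w" "walk p u = walk p w"
  shows "u = w"
  using assms
proof (induction u arbitrary: w rule: rev_induct)
  case Nil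
  then show ?case using closed_red_walk[of w p] by simp
next
  case (snoc i u)
  show ?case
  proof (cases w rule: rev_cases)
    case Nil
    then show ?thesis using closed_red_walk[of "u @ [i]" p] snoc.prems by simp
  next
    case (snoc w' j)
    note w = this
    have ij: "i \<in> {1..d}" "j \<in> {1..d}" using snoc.prems w by (auto simp: red_def)
    show ?thesis
    proof (cases "i = j")
      case True
      have "walk p u = walk p w'"
        using snoc.prems(3) w True nb_nb[OF ij(1)] by (metis foldl_Cons foldl_Nil foldl_append)
      then have "u = w'" using snoc.IH[of w'] snoc.prems w by (auto simp: red_append)
      then show ?thesis using w True by simp
    next
      case False
      let ?z = "(u @ [i]) @ rev w"
      have "red (rev w)" "hd (rev w) = j" using snoc.prems(2) w by (simp_all only: red_rev) simp
      then have "red ?z" using snoc.prems(1) w False unfolding red_append[of "u @ [i]"] by simp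
      moreover have "walk p ?z = p"
        using snoc.prems walk_rev[of w p] by (simp add: red_def)
      ultimately have "?z = []" by (rule closed_red_walk)
      then show ?thesis by simp
    qed
  qed
qed

lemma ex_red_walk: "\<exists>w. red w \<and> walk p w = v"
  using adj_connected[of p v]
proof (induction rule: rtranclp_induct)
  case base
  show ?case by (intro exI[of _ "[]"]) simp
next
  case (step u v)
  then obtain w i where w: "red w" "walk p w = u" and i: "i \<in> {1..d}" "v = nb u i"
    using adj_iff_nb by blast
  show ?case
  proof (cases "w = [] \<or> last w \<noteq> i")
    case True
    then show ?thesis using w i by (intro exI[of _ "w @ [i]"]) (auto simp: red_append red_Cons)
  next
    case False
    then obtain w' where "w = w' @ [i]" by (metis append_butlast_last_id)
    then show ?thesis using w i nb_nb by (intro exI[of _ w']) (auto simp: red_append)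
  qed
qed

text \<open>Color sequence of the geodesic from \<open>p\<close> to \<open>v\<close>. In these
  coordinates the geometry of the tree rooted at \<open>p\<close> becomes the prefix order.\<close>

definition word :: "'v \<Rightarrow> 'v \<Rightarrow> nat list" where
  "word p v = (THE w. red w \<and> walk p w = v)"

lemma red_word [simp]: "red (word p v)" and walk_word [simp]: "walk p (word p v) = v"
proof -
  have "\<exists>!w. red w \<and> walk p w = v" using ex_red_walk[of p v] red_walk_inj by blast
  from theI'[OF this] show "red (word p v)" "walk p (word p v) = v"
    unfolding word_def by blast+
qed

lemma word_walk [simp]: "red w \<Longrightarrow> word p (walk p w) = w"
  using red_walk_inj red_word walk_word by blast

lemma word_self [simp]: "word p p = []"
  using word_walk[of "[]" p] by simp

lemma word_inj: "word p u = word p v \<Longrightarrow> u = v"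
  by (metis walk_word)

definition dst :: "'v \<Rightarrow> 'v \<Rightarrow> nat" where
  "dst p v = length (word p v)"

lemma dst_self [simp]: "dst p p = 0"
  by (simp add: dst_def)

lemma dst_commute: "dst a b = dst b a"
proof -
  have "walk b (rev (word a b)) = a"
    using walk_rev[of "word a b" a] red_word[of a b] by (simp add: red_def)
  then have "word b a = rev (word a b)" by (metis word_walk red_rev red_word)
  then show ?thesis by (simp add: dst_def)
qed

lemma finite_ball: "finite {v. dst p v \<le> n}"
proof -
  have "{v. dst p v \<le> n} \<subseteq> walk p ` {w. set w \<subseteq> {1..d} \<and> length w \<le> n}"
  proof
    fix v assume "v \<in> {v. dst p v \<le> n}"
    then show "v \<in> walk p ` {w. set w \<subseteq> {1..d} \<and> length w \<le> n}"
      using red_word[of p v] by (intro image_eqI[of _ _ "word p v"]) (auto simp: dst_def red_def)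
  qed
  then show ?thesis using finite_lists_length_le[of "{1..d}" n] finite_surj by blast
qed

lemma finite_subset_ball: "finite S \<Longrightarrow> \<exists>n. S \<subseteq> {v. dst p v \<le> n}"
  by (intro exI[of _ "Max (dst p ` S)"]) auto

lemma dst_nb: "i \<in> {1..d} \<Longrightarrow> dst p (nb v i) \<le> Suc (dst p v)"
proof -
  assume i: "i \<in> {1..d}"
  show ?thesis
  proof (cases "word p v = [] \<or> last (word p v) \<noteq> i")
    case True
    then have "red (word p v @ [i])" using i by (auto simp: red_append red_Cons)
    then have "word p (walk p (word p v @ [i])) = word p v @ [i]" by (rule word_walk)
    then show ?thesis by (simp add: dst_def)
  next
    case False
    then obtain u where u: "word p v = u @ [i]" by (metis append_butlast_last_id)
    then have "red u" using red_word[of p v] by (simp add: red_append)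
    moreover have "walk p u = nb v i"
      using u walk_word[of p v] nb_nb[OF i] by (metis foldl_Cons foldl_Nil foldl_append)
    ultimately have "word p (nb v i) = u" by (metis word_walk)
    then show ?thesis using u by (simp add: dst_def)
  qed
qed

subsection \<open>The order rooted at a vertex\<close>

text \<open>Geometrically: \<open>z\<close> lies on the geodesic from \<open>p\<close> to
  \<open>y\<close>.\<close>

definition le :: "'v \<Rightarrow> 'v \<Rightarrow> 'v \<Rightarrow> bool" where
  "le p z y \<longleftrightarrow> prefix (word p z) (word p y)"

text \<open>The branch point of two geodesics issuing from \<open>p\<close>. It is the median of the
  three vertices and thus the projection of \<open>p\<close> to the segment between \<open>y\<close>
  and \<open>z\<close>.\<close>

definition meet :: "'v \<Rightarrow> 'v \<Rightarrow> 'v \<Rightarrow> 'v" where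
  "meet p y z = walk p (longest_common_prefix (word p y) (word p z))"

lemma word_meet: "word p (meet p y z) = longest_common_prefix (word p y) (word p z)"
  unfolding meet_def
  by (rule word_walk, rule red_prefix[OF longest_common_prefix_prefix1 red_word])

lemma le_refl [simp]: "le p z z"
  and le_root [simp]: "le p p z"
  and le_trans: "le p x y \<Longrightarrow> le p y z \<Longrightarrow> le p x z"
  and le_antisym: "le p x y \<Longrightarrow> le p y x \<Longrightarrow> x = y"
  and le_linear_below: "le p x z \<Longrightarrow> le p y z \<Longrightarrow> le p x y \<or> le p y x"
  using prefix_order.trans prefix_order.antisym prefix_same_cases word_inj
  unfolding le_def by auto blast+

lemma meet_le1 [simp]: "le p (meet p y z) y"
  and meet_le2 [simp]: "le p (meet p y z) z"
  and meet_greatest: "le p x y \<Longrightarrow> le p x z \<Longrightarrow> le p x (meet p y z)"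
  unfolding le_def word_meet
  by (auto simp: longest_common_prefix_prefix1 longest_common_prefix_prefix2
      longest_common_prefix_max_prefix)

lemma meet_eqI:
  "le p x y \<Longrightarrow> le p x z \<Longrightarrow> (\<And>t. le p t y \<Longrightarrow> le p t z \<Longrightarrow> le p t x) \<Longrightarrow> meet p y z = x"
  by (blast intro: le_antisym meet_greatest meet_le1 meet_le2)

definition seg :: "'v \<Rightarrow> 'v \<Rightarrow> 'v set" where
  "seg a b = {z. le a z b}"

lemma lcp_split:
  "\<exists>s t. u = longest_common_prefix u w @ s \<and> w = longest_common_prefix u w @ t \<and>
     (s = [] \<or> t = [] \<or> hd s \<noteq> hd t)"
  by (induction u w rule: longest_common_prefix.induct) auto

text \<open>Seen from any \<open>p\<close>, the segment comes down from \<open>a\<close> to the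
  branch point and climbs to \<open>b\<close>. With \<open>k\<close> the common prefix,
  \<open>word a b\<close> is \<open>rev s @ t\<close>; its prefixes stop inside \<open>rev s\<close>
  or run on into \<open>t\<close>.\<close>

lemma seg_iff: "z \<in> seg a b \<longleftrightarrow> le p (meet p a b) z \<and> (le p z a \<or> le p z b)"
proof -
  define k where "k = longest_common_prefix (word p a) (word p b)"
  obtain s t where s: "word p a = k @ s" and t: "word p b = k @ t"
    and st: "s = [] \<or> t = [] \<or> hd s \<noteq> hd t"
    using lcp_split[of "word p a" "word p b"] unfolding k_def by blast
  have red: "red (k @ s)" "red (k @ t)" using red_word s t by metis+
  then have sub: "set s \<subseteq> {1..d}" by (auto simp: red_def)
  have upto_root: "walk a (rev r) = walk p (k @ s')" if "s = s' @ r" for s' r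
  proof -
    have "a = walk (walk p (k @ s')) r" using walk_word[of p a] s that by simp
    then show ?thesis using walk_rev[of r] sub that by simp
  qed
  have "red (rev s @ t)"
    using red st by (auto simp: red_append last_rev)
  moreover have "walk a (rev s @ t) = b"
    using upto_root[of "[]" s] walk_word[of p b] t by simp
  ultimately have ab: "word a b = rev s @ t" by (metis word_walk)
  have "(prefix (word a z) (rev s @ t)) \<longleftrightarrow>
        prefix k (word p z) \<and> (prefix (word p z) (k @ s) \<or> prefix (word p z) (k @ t))"
    (is "?L \<longleftrightarrow> ?R")
  proof
    assume ?L
    then consider "prefix (word a z) (rev s)" | t1 where "word a z = rev s @ t1" "prefix t1 t"
      unfolding prefix_append by blast
    then show ?R
    proof cases
      case 1
      then obtain r where "rev s = word a z @ r" by (auto simp: prefix_def)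
      then have r: "s = rev r @ rev (word a z)" by (metis rev_append rev_rev_ident)
      from upto_root[OF this] have "walk p (k @ rev r) = z" by simp
      moreover have "red (k @ rev r)"
        using red(1) r by (metis append.assoc red_append)
      ultimately have "word p z = k @ rev r" by (metis word_walk)
      then show ?thesis using r by simp
    next
      case 2
      have "walk p (k @ t1) = z"
        using upto_root[of "[]" s] 2 walk_word[of a z] by simp
      moreover have "red (k @ t1)"
        using red(2) 2 by (metis red_prefix same_prefix_prefix)
      ultimately have "word p z = k @ t1" by (metis word_walk)
      then show ?thesis using 2 by simp
    qed
  next
    assume R: ?R
    then obtain x where x: "word p z = k @ x" by (auto simp: prefix_def)
    have redx: "red (k @ x)" using x red_word by metis
    have zx: "z = walk p (k @ x)" using x walk_word by metis
    from R x consider "prefix x s" | "prefix x t" by auto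
    then show ?L
    proof cases
      case 1
      then obtain r where r: "s = x @ r" by (auto simp: prefix_def)
      then have "walk a (rev r) = z" using upto_root zx by simp
      moreover have "red (rev r)" using red r by (auto simp: red_append)
      ultimately have "word a z = rev r" by (metis word_walk)
      then show ?thesis using r by simp
    next
      case 2
      have "walk a (rev s @ x) = z" using upto_root[of "[]" s] zx by simp
      moreover have "red (rev s @ x)"
        using \<open>red (rev s @ t)\<close> 2 by (metis red_prefix same_prefix_prefix)
      ultimately have "word a z = rev s @ x" by (metis word_walk)
      then show ?thesis using 2 by simp
    qed
  qed
  then show ?thesis
    by (simp only: seg_def mem_Collect_eq le_def word_meet ab k_def[symmetric]) (simp only: s t)
qed

subsection \<open>Automorphisms and local permutations\<close>

abbreviation loc :: "('v \<Rightarrow> 'v) \<Rightarrow> 'v \<Rightarrow> nat \<Rightarrow> nat" where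
  "loc \<equiv> loc_perm d adj c"

lemma aut_bij: "g \<in> tree_aut adj \<Longrightarrow> bij g"
  and aut_adj: "g \<in> tree_aut adj \<Longrightarrow> adj (g u) (g v) \<longleftrightarrow> adj u v"
  by (auto simp: tree_aut_def)

lemma aut_id: "id \<in> tree_aut adj"
  by (simp add: tree_aut_def)

lemma aut_comp: "g \<in> tree_aut adj \<Longrightarrow> h \<in> tree_aut adj \<Longrightarrow> g \<circ> h \<in> tree_aut adj"
  by (auto simp: tree_aut_def bij_comp)

lemma aut_inv: "g \<in> tree_aut adj \<Longrightarrow> inv g \<in> tree_aut adj"
  by (auto simp: tree_aut_def bij_imp_bij_inv) (metis bij_inv_eq_iff)+

lemma aut_nb: "g \<in> tree_aut adj \<Longrightarrow> i \<in> {1..d} \<Longrightarrow> g (nb v i) = nb (g v) (loc g v i)"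
  unfolding loc_perm_def using nb_of_color[of "g v" "g (nb v i)"] nb_adj aut_adj by auto

lemma loc_range: "g \<in> tree_aut adj \<Longrightarrow> i \<in> {1..d} \<Longrightarrow> loc g v i \<in> {1..d}"
  unfolding loc_perm_def using color_range[of "g v" "g (nb v i)"] nb_adj aut_adj by auto

lemma loc_outside: "i \<notin> {1..d} \<Longrightarrow> loc g v i = i"
  by (auto simp: loc_perm_def)

lemma loc_eqI:
  assumes "\<And>i. i \<in> {1..d} \<Longrightarrow> g (nb v i) = nb (g v) (s i)" "s permutes {1..d}"
  shows "loc g v = s"
proof
  fix i show "loc g v i = s i"
    using assms nb_color permutes_in_image[OF assms(2), of i] permutes_not_in[OF assms(2), of i]
    by (cases "i \<in> {1..d}") (auto simp: loc_perm_def)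
qed

lemma loc_permutes: "g \<in> tree_aut adj \<Longrightarrow> loc g v permutes {1..d}"
proof -
  assume g: "g \<in> tree_aut adj"
  have "inj_on (loc g v) {1..d}"
  proof (rule inj_onI)
    fix i j assume ij: "i \<in> {1..d}" "j \<in> {1..d}" "loc g v i = loc g v j"
    then have "g (nb v i) = g (nb v j)" using aut_nb[OF g] by simp
    then have "nb v i = nb v j" using aut_bij[OF g] by (meson bij_is_inj injD)
    then show "i = j" using ij nb_inj by blast
  qed
  moreover have "loc g v ` {1..d} \<subseteq> {1..d}" using loc_range[OF g] by blast
  ultimately have "bij_betw (loc g v) {1..d} {1..d}"
    by (simp add: bij_betw_def endo_inj_surj)
  then show ?thesis by (rule bij_imp_permutes) (rule loc_outside)
qed

lemma loc_comp:
  assumes "g \<in> tree_aut adj" "h \<in> tree_aut adj"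
  shows "loc (g \<circ> h) v = loc g (h v) \<circ> loc h v"
proof (rule loc_eqI)
  fix i assume i: "i \<in> {1..d}"
  then show "(g \<circ> h) (nb v i) = nb ((g \<circ> h) v) ((loc g (h v) \<circ> loc h v) i)"
    using aut_nb[OF assms(2) i] aut_nb[OF assms(1) loc_range[OF assms(2) i]] by simp
qed (intro permutes_compose loc_permutes assms)

lemma loc_id: "loc id v = id"
  by (rule loc_eqI) (auto simp: permutes_id)

lemma loc_inv:
  assumes "g \<in> tree_aut adj"
  shows "loc (inv g) v = inv (loc g (inv g v))"
proof -
  have "loc g (inv g v) \<circ> loc (inv g) v = loc (g \<circ> inv g) v"
    using loc_comp[OF assms aut_inv[OF assms]] by simp
  also have "g \<circ> inv g = id" using aut_bij[OF assms] bij_is_surj surj_iff by blast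
  finally have "loc g (inv g v) \<circ> loc (inv g) v = id" by (simp only: loc_id)
  then show ?thesis
    using permutes_inj[OF loc_permutes[OF assms]] by (metis inv_o_cancel o_assoc o_id id_o)
qed

lemma loc_cong:
  assumes "g v = h v" "\<And>i. i \<in> {1..d} \<Longrightarrow> g (nb v i) = h (nb v i)"
  shows "loc g v = loc h v"
  using assms by (auto simp: loc_perm_def)

fun image_word :: "('v \<Rightarrow> 'v) \<Rightarrow> 'v \<Rightarrow> nat list \<Rightarrow> nat list" where
  "image_word g p [] = []"
| "image_word g p (i # w) = loc g p i # image_word g (nb p i) w"

lemma length_image_word [simp]: "length (image_word g p w) = length w"
  by (induction w arbitrary: p) auto

lemma image_word_append:
  "image_word g p (u @ w) = image_word g p u @ image_word g (walk p u) w"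
  by (induction u arbitrary: p) auto

lemma aut_walk:
  "g \<in> tree_aut adj \<Longrightarrow> set w \<subseteq> {1..d} \<Longrightarrow> g (walk p w) = walk (g p) (image_word g p w)"
  by (induction w arbitrary: p) (auto simp: aut_nb)

lemma red_image_word:
  assumes g: "g \<in> tree_aut adj" and "red w"
  shows "red (image_word g p w)"
  using assms(2)
proof (induction w arbitrary: p)
  case (Cons i w)
  have i: "i \<in> {1..d}" and w: "red w" using Cons.prems by (auto simp: red_Cons)
  have "loc g p i \<noteq> loc g (nb p i) j" if j: "w = j # w'" for j w'
  proof -
    have j': "j \<in> {1..d}" "i \<noteq> j" using j Cons.prems by (auto simp: red_Cons)
    \<comment> \<open>Both ends of the edge of color \<open>i\<close> see the same color on its
      image. Injectivity of \<open>loc g (nb p i)\<close> then carries \<open>i \<noteq> j\<close>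
      over to the image word.\<close>
    have "nb (nb (g p) (loc g p i)) (loc g (nb p i) i) = g p"
      using aut_nb[OF g i] aut_nb[OF g i, of "nb p i"] nb_nb[OF i] by simp
    moreover have "nb (nb (g p) (loc g p i)) (loc g p i) = g p"
      using nb_nb loc_range[OF g i] by blast
    ultimately have "loc g (nb p i) i = loc g p i"
      using nb_inj loc_range[OF g i] by metis
    then show ?thesis
      using j' i permutes_inj[OF loc_permutes[OF g]] by (metis injD)
  qed
  then show ?case using Cons.IH[OF w] loc_range[OF g i] by (cases w) (auto simp: red_Cons)
qed simp

lemma word_aut:
  assumes g: "g \<in> tree_aut adj"
  shows "word (g p) (g v) = image_word g p (word p v)"
proof -
  have "g v = walk (g p) (image_word g p (word p v))"
    using aut_walk[OF g, of "word p v" p] red_word[of p v] by (simp add: red_def)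
  then show ?thesis using red_image_word[OF g red_word] word_walk by metis
qed

lemma dst_aut: "g \<in> tree_aut adj \<Longrightarrow> dst (g p) (g v) = dst p v"
  by (simp add: dst_def word_aut)

lemma le_aut:
  assumes g: "g \<in> tree_aut adj"
  shows "le (g p) (g z) (g y) \<longleftrightarrow> le p z y"
proof -
  have imp: "le (h p) (h z) (h y)" if "le p z y" "h \<in> tree_aut adj" for h p z y
    using that by (auto simp: le_def word_aut prefix_def image_word_append)
  have inv: "inv g (g x) = x" for x using aut_bij[OF g] by (simp add: bij_is_inj)
  show ?thesis using imp[OF _ g] imp[OF _ aut_inv[OF g], of "g p" "g z" "g y"] inv by auto
qed

lemma meet_aut:
  assumes g: "g \<in> tree_aut adj"
  shows "meet (g p) (g y) (g z) = g (meet p y z)"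
proof (rule meet_eqI)
  fix t assume t: "le (g p) t (g y)" "le (g p) t (g z)"
  obtain t' where "t = g t'" using aut_bij[OF g] by (metis bij_pointE)
  then show "le (g p) t (g (meet p y z))" using t by (simp add: le_aut[OF g] meet_greatest)
qed (simp_all add: le_aut[OF g])

lemma seg_aut: "g \<in> tree_aut adj \<Longrightarrow> g z \<in> seg (g a) (g b) \<longleftrightarrow> z \<in> seg a b"
  by (simp add: seg_def le_aut)

end

section \<open>The group $G(F,F')$ and its action on segments\<close>

locale ff_tree = legal_tree d adj c
  for d :: nat and adj :: "'v \<Rightarrow> 'v \<Rightarrow> bool" and c :: "'v \<Rightarrow> 'v \<Rightarrow> nat" +
  fixes F F' :: "(nat \<Rightarrow> nat) set"
  assumes d3: "d \<ge> 3"
    and F: "perm_group d F" and F': "perm_group d F'"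
    and FF': "F \<subseteq> F'"
    and orbits: "preserves_orbits d F F'"
    and two_trans: "two_transitive d F'"
begin

abbreviation "G \<equiv> GFF d adj c F F'"

lemma perm_groupD:
  assumes "perm_group d E"
  shows "p \<in> E \<Longrightarrow> p permutes {1..d}" "id \<in> E"
    "p \<in> E \<Longrightarrow> q \<in> E \<Longrightarrow> p \<circ> q \<in> E" "p \<in> E \<Longrightarrow> inv p \<in> E"
  using assms unfolding perm_group_def by blast+

lemma G_iff: "g \<in> G \<longleftrightarrow> g \<in> tree_aut adj \<and> finite {v. loc g v \<notin> F} \<and> (\<forall>v. loc g v \<in> F')"
  by (auto simp: GFF_def G_grp_def U_grp_def)

lemma G_aut: "g \<in> G \<Longrightarrow> g \<in> tree_aut adj"
  and G_bij: "g \<in> G \<Longrightarrow> bij g"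
  by (auto simp: G_iff aut_bij)

lemma G_comp:
  assumes "g \<in> G" "h \<in> G"
  shows "g \<circ> h \<in> G"
proof -
  have l: "loc (g \<circ> h) v = loc g (h v) \<circ> loc h v" for v
    by (rule loc_comp) (use assms G_aut in auto)
  have "{v. loc (g \<circ> h) v \<notin> F} \<subseteq> {v. loc h v \<notin> F} \<union> h -` {v. loc g v \<notin> F}"
    using perm_groupD(3)[OF F] by (auto simp only: l)
  moreover have "finite ({v. loc h v \<notin> F} \<union> h -` {v. loc g v \<notin> F})"
    using assms finite_vimageI[OF _ bij_is_inj[OF G_bij[OF assms(2)]], of "{v. loc g v \<notin> F}"] by (simp add: G_iff vimage_def)
  ultimately have "finite {v. loc (g \<circ> h) v \<notin> F}" by (rule finite_subset)
  moreover have "loc (g \<circ> h) v \<in> F'" for v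
    using assms perm_groupD(3)[OF F'] by (simp only: l G_iff)
  ultimately show ?thesis using assms aut_comp unfolding G_iff by blast
qed

lemma G_inv:
  assumes "g \<in> G"
  shows "inv g \<in> G"
proof -
  have l: "loc (inv g) v = inv (loc g (inv g v))" for v
    by (rule loc_inv) (use assms G_aut in auto)
  have "{v. loc (inv g) v \<notin> F} \<subseteq> g ` {v. loc g v \<notin> F}"
  proof
    fix v assume "v \<in> {v. loc (inv g) v \<notin> F}"
    then have "loc g (inv g v) \<notin> F" using perm_groupD(4)[OF F] l by auto
    moreover have "v = g (inv g v)" using G_bij[OF assms] by (simp add: bij_is_surj surj_f_inv_f)
    ultimately show "v \<in> g ` {v. loc g v \<notin> F}" by blast
  qed
  moreover have "finite (g ` {v. loc g v \<notin> F})" using assms by (simp add: G_iff)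
  ultimately have "finite {v. loc (inv g) v \<notin> F}" by (rule finite_subset)
  moreover have "loc (inv g) v \<in> F'" for v
    using assms perm_groupD(4)[OF F'] by (simp only: l G_iff)
  ultimately show ?thesis using assms aut_inv unfolding G_iff by blast
qed

lemma F'_trans:
  assumes "i \<in> {1..d}" "k \<in> {1..d}"
  shows "\<exists>p\<in>F'. p i = k"
proof -
  \<comment> \<open>An auxiliary second point at source and target, to which 2-transitivity can be
    applied.\<close>
  have "\<exists>j\<in>{1..d}. j \<noteq> m" for m
    using d3 by (cases "m = 1") (auto intro: bexI[of _ 1] bexI[of _ 2])
  then obtain j l where "j \<in> {1..d}" "j \<noteq> i" "l \<in> {1..d}" "l \<noteq> k" by metis
  then show ?thesis using two_trans assms unfolding two_transitive_def by metis
qed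

section \<open>Elements of \<open>G\<close> with prescribed effect on a finite path\<close>

lemma red_take: "red w \<Longrightarrow> red (take k w)"
  using red_prefix take_is_prefix by blast

text \<open>The inequality is strict because no edge of the path leaves its last vertex, so nothing
  forces the local permutation there out of \<open>F\<close>.\<close>

definition on_path :: "nat list \<Rightarrow> nat list \<Rightarrow> bool" where
  "on_path w u \<longleftrightarrow> length u < length w \<and> rev u = take (length u) w"

definition choice_spec :: "nat list \<Rightarrow> nat list \<Rightarrow> nat list \<Rightarrow> (nat \<Rightarrow> nat) \<Rightarrow> bool" where
  "choice_spec w w' u q \<longleftrightarrow> q \<in> F' \<and>
     (if on_path w u then q (w ! length u) = w' ! length u else q \<in> F)"

text \<open>The local permutations of an automorphism carrying the path \<open>w\<close> to the path \<open>w'\<close>;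
  vertices are given by their reversed words, so that the tail of a word is the neighbour
  closer to the root.\<close>

primrec local_choice :: "nat list \<Rightarrow> nat list \<Rightarrow> nat list \<Rightarrow> nat \<Rightarrow> nat" where
  "local_choice w w' [] = (SOME q. choice_spec w w' [] q)"
| "local_choice w w' (i # u) =
     (SOME q. choice_spec w w' (i # u) q \<and> q i = local_choice w w' u i)"

text \<open>The value on the edge to the parent is already fixed, and along the path the next edge
  is prescribed too. Two prescribed values need the 2-transitivity of \<open>F'\<close>; a single
  one can be met inside \<open>F\<close>, as \<open>F'\<close> preserves its orbits. The second
  conjunct is the compatibility across edges that allows gluing.\<close>

lemma local_choice_spec:
  assumes w: "red w" "red w'" "length w = length w'"
  shows "red (rev u) \<Longrightarrow> choice_spec w w' u (local_choice w w' u) \<and>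
    (\<forall>i v. u = i # v \<longrightarrow> local_choice w w' u i = local_choice w w' v i)"
proof (induction u)
  case Nil
  have "\<exists>q. choice_spec w w' [] q"
  proof (cases "w = []")
    case True
    then show ?thesis using perm_groupD(2)[OF F] FF' by (auto simp: choice_spec_def on_path_def)
  next
    case False
    then have "w ! 0 \<in> {1..d}" "w' ! 0 \<in> {1..d}"
      using w unfolding red_def by (metis length_greater_0_conv nth_mem subsetD)+
    then show ?thesis using F'_trans False
      by (fastforce simp: choice_spec_def on_path_def)
  qed
  from someI_ex[OF this] show ?case by simp
next
  case (Cons i u)
  then have IH: "choice_spec w w' u (local_choice w w' u)" and i: "i \<in> {1..d}"
    by (auto simp: red_append red_def)
  let ?p = "local_choice w w' u"
  have "\<exists>q. choice_spec w w' (i # u) q \<and> q i = ?p i"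
  proof (cases "on_path w (i # u)")
    case True
    let ?k = "length u"
    have k: "Suc ?k < length w" and t: "rev u @ [i] = take (Suc ?k) w"
      using True by (auto simp: on_path_def)
    have "rev u = take ?k w" "w ! ?k = i"
      using t k by (auto simp: take_Suc_conv_app_nth)
    then have p: "?p i = w' ! ?k" using IH k by (auto simp: choice_spec_def on_path_def)
    have "w ! Suc ?k \<in> {1..d}" "w' ! Suc ?k \<in> {1..d}" "w' ! ?k \<in> {1..d}"
      using w k unfolding red_def by (metis Suc_lessD nth_mem subsetD)+
    moreover have "i \<noteq> w ! Suc ?k" "w' ! ?k \<noteq> w' ! Suc ?k"
      using w k \<open>w ! ?k = i\<close> by (auto simp: red_def distinct_adj_conv_nth)
    ultimately obtain q where "q \<in> F'" "q i = w' ! ?k" "q (w ! Suc ?k) = w' ! Suc ?k"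
      using two_trans i unfolding two_transitive_def by meson
    then show ?thesis using True p by (auto simp: choice_spec_def)
  next
    case False
    have "?p \<in> F'" using IH by (simp add: choice_spec_def)
    then obtain q where "q \<in> F" "q i = ?p i"
      using orbits i unfolding preserves_orbits_def by fastforce
    then show ?thesis using False FF' by (auto simp: choice_spec_def)
  qed
  from someI_ex[OF this] show ?case by simp
qed

lemma local_choice_permutes:
  "red w \<Longrightarrow> red w' \<Longrightarrow> length w = length w' \<Longrightarrow> red (rev u) \<Longrightarrow> local_choice w w' u permutes {1..d}"
  using local_choice_spec[of w w' u] perm_groupD(1)[OF F'] by (auto simp: choice_spec_def)

primrec choice_word :: "nat list \<Rightarrow> nat list \<Rightarrow> nat list \<Rightarrow> nat list" where
  "choice_word w w' [] = []"
| "choice_word w w' (i # u) = local_choice w w' u i # choice_word w w' u"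

lemma length_choice_word [simp]: "length (choice_word w w' u) = length u"
  by (induction u) auto

text \<open>The local choices are glued to an automorphism sending \<open>p\<close> to
  \<open>p'\<close>. It lies in \<open>G\<close> because its local permutations can leave
  \<open>F\<close> only at vertices of the path.\<close>

lemma ex_aut_on_path:
  assumes w: "red w" "red w'" "length w = length w'"
  shows "\<exists>g\<in>G. \<forall>k\<le>length w. g (walk p (take k w)) = walk p' (take k w')"
proof -
  let ?m = "choice_word w w'"
  define s where "s v = local_choice w w' (rev (word p v))" for v
  define g where "g v = walk p' (rev (?m (rev (word p v))))" for v
  note spec = local_choice_spec[OF w] and perm = local_choice_permutes[OF w]
  have in_range: "local_choice w w' u i \<in> {1..d}" if "red (rev u)" "i \<in> {1..d}" for u i
    using permutes_in_image[OF perm[OF that(1)]] that(2) by simp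
  \<comment> \<open>By compatibility the colors of two consecutive edges are mapped by one and the
    same permutation, so they stay different.\<close>
  have red_m: "red (rev (?m u))" if "red (rev u)" for u
    using that
  proof (induction u)
    case (Cons i u)
    then have u: "red (rev u)" and i: "i \<in> {1..d}" by (auto simp: red_append red_def)
    have "last (rev (?m u)) \<noteq> local_choice w w' u i" if ne: "u \<noteq> []"
    proof -
      obtain j v where uj: "u = j # v" using ne by (cases u) auto
      then have "j \<noteq> i" using Cons.prems by (auto simp: red_append red_Cons)
      moreover have "local_choice w w' v j = local_choice w w' u j" using spec[OF u] uj by simp
      ultimately show ?thesis using uj permutes_inj[OF perm[OF u]]
        by (auto simp del: local_choice.simps dest: injD)
    qed
    then show ?case using Cons.IH[OF u] in_range[OF u i]
      by (cases "u = []") (auto simp: red_append red_Cons simp del: local_choice.simps)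
  qed simp
  have word_g: "word p' (g v) = rev (?m (rev (word p v)))" for v
    unfolding g_def by (rule word_walk, rule red_m) simp
  \<comment> \<open>Either the edge leads away from \<open>p\<close>, or it leads back to the
    parent; the second case is where compatibility across the edge enters.\<close>
  have g_nb: "g (nb v i) = nb (g v) (s v i)" if i: "i \<in> {1..d}" for v i
  proof (cases "word p v = [] \<or> last (word p v) \<noteq> i")
    case True
    then have "red (word p v @ [i])" using i by (auto simp: red_append red_Cons)
    from word_walk[OF this, of p] have "word p (nb v i) = word p v @ [i]" by simp
    then show ?thesis by (simp add: g_def s_def)
  next
    case False
    then obtain u where u: "word p v = u @ [i]" by (metis append_butlast_last_id)
    have redu: "red (rev (rev u))" "red (u @ [i])"
      using red_word[of p v] u by (auto simp: red_append)
    have "walk p u = nb v i"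
      using u walk_word[of p v] nb_nb[OF i] by (metis foldl_Cons foldl_Nil foldl_append)
    then have gu: "g (nb v i) = walk p' (rev (?m (rev u)))"
      using redu unfolding g_def by (metis rev_rev_ident word_walk)
    have "s v i = local_choice w w' (rev u) i"
      using spec[of "rev (u @ [i])"] redu u unfolding s_def by (auto simp del: local_choice.simps)
    then have "g v = nb (g (nb v i)) (s v i)" unfolding gu by (simp add: g_def u)
    then show ?thesis
      using nb_nb in_range[OF redu(1) i] \<open>s v i = _\<close> by metis
  qed
  have s_perm: "s v permutes {1..d}" for v unfolding s_def by (rule perm) simp
  have gp: "g p = p'" by (simp add: g_def)
  have m_inj: "u = v" if "?m u = ?m v" "red (rev u)" "red (rev v)" for u v
    using that
  proof (induction u arbitrary: v)
    case Nil
    then show ?case by (metis length_choice_word length_0_conv)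
  next
    case (Cons i u)
    then obtain j v' where v: "v = j # v'" by (cases v) auto
    have red: "red (rev u)" "red (rev v')"
      using Cons.prems(2,3) v by (auto simp: red_append)
    have "u = v'" using Cons.IH[OF _ red] Cons.prems(1) v by simp
    moreover from this have "i = j"
      using Cons.prems(1) v permutes_inj[OF perm[OF red(1)]] by (simp add: inj_eq)
    ultimately show ?case using v by simp
  qed
  have "inj g"
  proof (rule injI)
    fix u v assume "g u = g v"
    then have "?m (rev (word p u)) = ?m (rev (word p v))" using word_g by (metis rev_rev_ident)
    then have "rev (word p u) = rev (word p v)" by (rule m_inj) simp_all
    then show "u = v" using word_inj by simp
  qed
  \<comment> \<open>The range contains \<open>p'\<close> and is closed under passing to
    neighbours.\<close>
  moreover have "v \<in> range g" for v
    using adj_connected[of p' v]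
  proof (induction rule: rtranclp_induct)
    case base
    show ?case using gp by blast
  next
    case (step y z)
    then obtain x j where "y = g x" and j: "j \<in> {1..d}" "z = nb y j" using adj_iff_nb by blast
    moreover obtain i where "i \<in> {1..d}" "s x i = j"
      using permutes_image[OF s_perm[of x]] j by (metis imageE)
    ultimately have "z = g (nb x i)" using g_nb[of i x] by simp
    then show ?case by blast
  qed
  ultimately have "bij g" unfolding bij_def by blast
  moreover have "adj (g u) (g v) \<longleftrightarrow> adj u v" for u v
  proof
    assume "adj u v"
    then obtain i where i: "i \<in> {1..d}" "v = nb u i" using adj_iff_nb by blast
    moreover have "s u i \<in> {1..d}" using i permutes_in_image[OF s_perm] by simp
    ultimately show "adj (g u) (g v)" using g_nb[of i u] nb_adj by simp
  next
    assume "adj (g u) (g v)"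
    then obtain j where j: "j \<in> {1..d}" "g v = nb (g u) j" using adj_iff_nb by blast
    moreover obtain i where i: "i \<in> {1..d}" "s u i = j"
      using permutes_image[OF s_perm[of u]] j by (metis imageE)
    ultimately have "g v = g (nb u i)" using g_nb by simp
    then show "adj u v" using \<open>inj g\<close> i nb_adj by (metis injD)
  qed
  ultimately have aut: "g \<in> tree_aut adj" by (auto simp: tree_aut_def)
  have loc_g: "loc g v = s v" for v by (rule loc_eqI) (use g_nb s_perm in auto)
  have "{v. s v \<notin> F} \<subseteq> (\<lambda>k. walk p (take k w)) ` {..length w}"
  proof
    fix v assume "v \<in> {v. s v \<notin> F}"
    then have "on_path w (rev (word p v))"
      using spec[of "rev (word p v)"] by (auto simp: s_def choice_spec_def split: if_splits)
    then show "v \<in> (\<lambda>k. walk p (take k w)) ` {..length w}"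
      by (intro image_eqI[of _ _ "length (word p v)"]) (auto simp: on_path_def dest: sym)
  qed
  then have "finite {v. s v \<notin> F}" by (rule finite_surj[rotated]) simp
  moreover have "s v \<in> F'" for v
    using spec[of "rev (word p v)"] by (auto simp: s_def choice_spec_def)
  ultimately have "g \<in> G" using aut by (simp add: G_iff loc_g)
  moreover have "?m (rev (take k w)) = rev (take k w')" if "k \<le> length w" for k
    using that
  proof (induction k)
    case (Suc k)
    have "on_path w (rev (take k w))" using Suc.prems by (simp add: on_path_def)
    moreover have "red (rev (rev (take k w)))" using w(1) by (simp add: red_take)
    ultimately have "local_choice w w' (rev (take k w)) (w ! k) = w' ! k"
      using spec[of "rev (take k w)"] Suc.prems by (auto simp: choice_spec_def)
    then show ?case using Suc w(3) by (simp add: take_Suc_conv_app_nth)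
  qed simp
  then have "g (walk p (take k w)) = walk p' (take k w')" if "k \<le> length w" for k
    using that w(1) by (simp add: g_def red_take)
  ultimately show ?thesis by blast
qed

end

section \<open>Deforming tuples of vertices to aligned tuples\<close>

context legal_tree
begin

definition aligned :: "'v list \<Rightarrow> bool" where
  "aligned xs \<longleftrightarrow> (\<exists>a b. set xs \<subseteq> seg a b)"

lemma aligned_Nil [simp]: "aligned []"
  by (simp add: aligned_def)

lemma meet_absorb: "le p z y \<Longrightarrow> meet p y z = z"
  by (rule meet_eqI) auto

lemma meet_absorb2: "le p y z \<Longrightarrow> meet p y z = y"
  by (rule meet_eqI) auto

text \<open>Together with \<open>meet_absorb\<close> this shows that \<open>meet p a\<close> folds
  \<open>seg a b\<close> onto its half on the side of \<open>a\<close>, collapsing the other half to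
  the foot.\<close>

lemma meet_other_side: "le p (meet p a b) z \<Longrightarrow> le p z b \<Longrightarrow> meet p a z = meet p a b"
  by (rule meet_eqI) (auto intro: meet_greatest le_trans)

lemma meet_commute: "meet p a b = meet p b a"
  by (rule meet_eqI) (auto intro: meet_greatest)

text \<open>Subdivision of a tuple of points of \<open>seg a b\<close> at the projection \<open>meet p a b\<close> of \<open>p\<close>:
  the resulting tuples remain aligned when \<open>p\<close> is added.\<close>

definition subdiv :: "'v \<Rightarrow> 'v \<Rightarrow> 'v \<Rightarrow> ('v list \<Rightarrow> real) \<Rightarrow> 'v list \<Rightarrow> real" where
  "subdiv p a b f xs = f (map (meet p a) xs) + f (map (meet p b) xs) - f (map (meet p (meet p a b)) xs)"

lemma subdiv_diff: "subdiv p a b (\<lambda>ys. f ys - g ys) xs = subdiv p a b f xs - subdiv p a b g xs"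
  by (simp add: subdiv_def)

lemma subdiv_Nil: "subdiv p a b f [] = f []"
  by (simp add: subdiv_def)

text \<open>Each term is a pullback along a map of vertices. The third one removes the constant
  tuple at the foot, which the halves count twice; the coefficients add up to 1, whence
  \<open>subdiv_Nil\<close>.\<close>

lemma subdiv_cbd: "subdiv p a b (cbd f) xs = cbd (subdiv p a b f) xs"
proof -
  have "cbd (subdiv p a b f) xs =
    cbd (\<lambda>ys. (f (map (meet p a) ys) + f (map (meet p b) ys)) - f (map (meet p (meet p a b)) ys)) xs"
    by (rule cbd_cong) (simp add: subdiv_def)
  then show ?thesis by (simp only: cbd_diff cbd_add cbd_map subdiv_def)
qed

text \<open>Here \<open>meet p b\<close> collapses the tuple to the foot, so its term cancels
  against the third one.\<close>

lemma subdiv_one_side: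
  assumes "set xs \<subseteq> seg a b" "\<forall>z\<in>set xs. le p z a"
  shows "subdiv p a b f xs = f xs" "subdiv p b a f xs = f xs"
proof -
  have q: "le p (meet p a b) z" if "z \<in> set xs" for z
    using assms(1) that seg_iff by blast
  have "map (meet p a) xs = xs"
    using assms(2) by (intro map_idI) (simp add: meet_absorb)
  moreover have "map (meet p b) xs = map (meet p (meet p a b)) xs"
  proof (rule map_cong[OF refl])
    fix z assume z: "z \<in> set xs"
    then show "meet p b z = meet p (meet p a b) z"
      using q assms(2) meet_other_side[of p b a z] meet_absorb2[OF q[OF z]]
      by (simp add: meet_commute[of p b a])
  qed
  ultimately show "subdiv p a b f xs = f xs" "subdiv p b a f xs = f xs"
    by (simp_all only: subdiv_def meet_commute[of p b a])
qed

lemma seg_commute: "seg a b = seg b a"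
  by (auto simp: seg_iff[of _ _ _ a] meet_commute)

lemma subdiv_commute: "subdiv p a b f xs = subdiv p b a f xs"
  by (simp add: subdiv_def meet_commute)

text \<open>Two incomparable entries \<open>z\<close> and \<open>w\<close> determine the foot as
  \<open>meet p z w\<close>, and they decide for every other entry on which side it lies;
  \<open>subdiv\<close> depends on nothing else.\<close>

lemma subdiv_two_sides:
  assumes x: "set xs \<subseteq> seg a b" "set xs \<subseteq> seg a' b'"
    and z: "z \<in> set xs" "le p z a" "\<not> le p z b" "le p z a'"
    and w: "w \<in> set xs" "le p w b" "\<not> le p w a" "le p w b'"
  shows "subdiv p a b f xs = subdiv p a' b' f xs"
proof -
  have A: "le p (meet p a b) t \<and> (le p t a \<or> le p t b)" if "t \<in> set xs" for t
    using x(1) that seg_iff by blast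
  have B: "le p (meet p a' b') t \<and> (le p t a' \<or> le p t b')" if "t \<in> set xs" for t
    using x(2) that seg_iff by blast
  have incomp: "\<not> le p z w" "\<not> le p w z" using z w le_trans by blast+
  then have z': "\<not> le p z b'" and w': "\<not> le p w a'" using z w le_linear_below by blast+
  have q: "meet p a b = meet p z w"
    by (rule meet_eqI[symmetric]) (use A z w in \<open>auto intro: meet_greatest le_trans\<close>)
  have q': "meet p a' b' = meet p z w"
    by (rule meet_eqI[symmetric]) (use B z w in \<open>auto intro: meet_greatest le_trans\<close>)
  have qq: "meet p a b = meet p a' b'" using q q' by simp
  have aa: "le p t a \<longleftrightarrow> le p t a'" if t: "t \<in> set xs" for t
    using A[OF t] B[OF t] z w z' w' le_trans le_linear_below by meson
  have bb: "le p t b \<longleftrightarrow> le p t b'" if t: "t \<in> set xs" for t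
    using A[OF t] B[OF t] z w z' w' le_trans le_linear_below by meson
  have "meet p a t = meet p a' t" if t: "t \<in> set xs" for t
  proof (cases "le p t a")
    case True then show ?thesis using aa[OF t] by (simp add: meet_absorb)
  next
    case False
    then have "le p t b" "le p t b'" using A[OF t] bb[OF t] by blast+
    then show ?thesis using A[OF t] B[OF t] meet_other_side qq by metis
  qed
  moreover have "meet p b t = meet p b' t" if t: "t \<in> set xs" for t
  proof (cases "le p t b")
    case True then show ?thesis using bb[OF t] by (simp add: meet_absorb)
  next
    case False
    then have "le p t a" "le p t a'" using A[OF t] aa[OF t] by blast+
    then show ?thesis
      using A[OF t] B[OF t] meet_other_side[of p b a t] meet_other_side[of p b' a' t] qq
      by (simp add: meet_commute[of p b] meet_commute[of p b'])
  qed
  ultimately have "map (meet p a) xs = map (meet p a') xs" "map (meet p b) xs = map (meet p b') xs"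
    by simp_all
  then show ?thesis unfolding subdiv_def qq by metis
qed

text \<open>This is what makes the cone well defined and equivariant. Either all entries lie on one
  side, where subdivision does nothing, or there are two incomparable entries; the second segment
  may then have its ends in either order.\<close>

lemma subdiv_indep:
  assumes x: "set xs \<subseteq> seg a b" "set xs \<subseteq> seg a' b'"
  shows "subdiv p a b f xs = subdiv p a' b' f xs"
proof -
  have A: "le p t a \<or> le p t b" if "t \<in> set xs" for t using x(1) that seg_iff by blast
  have B: "le p t a' \<or> le p t b'" if "t \<in> set xs" for t using x(2) that seg_iff by blast
  have one: "subdiv p u v f xs = f xs"
    if "set xs \<subseteq> seg u v" "(\<forall>z\<in>set xs. le p z u) \<or> (\<forall>z\<in>set xs. le p z v)" for u v
    using that subdiv_one_side[of xs u v p f] subdiv_one_side[of xs v u p f] seg_commute[of u v] by auto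
  \<comment> \<open>Entries below a common \<open>y\<close> form a chain, and a chain covered by two
    down-sets is contained in one of them.\<close>
  have transfer: "(\<forall>z\<in>set xs. le p z u) \<or> (\<forall>z\<in>set xs. le p z v)"
    if "\<forall>t\<in>set xs. le p t u \<or> le p t v" "\<forall>z\<in>set xs. le p z y" for u v y
    using that le_linear_below le_trans by meson
  show ?thesis
  proof (cases "(\<forall>z\<in>set xs. le p z a) \<or> (\<forall>z\<in>set xs. le p z b)")
    case True
    then have "(\<forall>z\<in>set xs. le p z a') \<or> (\<forall>z\<in>set xs. le p z b')"
      using transfer[of a' b'] B by blast
    then show ?thesis using one[OF x(1) True] one[OF x(2)] by simp
  next
    case False
    then obtain z w where zw: "z \<in> set xs" "\<not> le p z b" "w \<in> set xs" "\<not> le p w a" by blast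
    then have zw': "le p z a" "le p w b" using A by blast+
    then have "\<not> le p z w" "\<not> le p w z" using zw le_trans by blast+
    then consider "le p z a'" "le p w b'" | "le p z b'" "le p w a'"
      using B zw le_linear_below by meson
    then show ?thesis
    proof cases
      case 1
      then show ?thesis using subdiv_two_sides[OF x zw(1) zw'(1) zw(2) _ zw(3) zw'(2) zw(4)] by blast
    next
      case 2
      have "set xs \<subseteq> seg b' a'" using x(2) seg_commute by blast
      then show ?thesis
        using subdiv_two_sides[OF x(1) _ zw(1) zw'(1) zw(2) _ zw(3) zw'(2) zw(4)] 2 subdiv_commute
        by metis
    qed
  qed
qed

lemma hom_subdiv_indep:
  assumes "set xs \<subseteq> seg a b" "set xs \<subseteq> seg a' b'"
  shows "hom (subdiv p a b) f xs = hom (subdiv p a' b') f xs"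
  using assms
proof (induction xs arbitrary: f)
  case (Cons x xs)
  then show ?case using subdiv_indep[OF Cons.prems] by simp
qed simp

text \<open>The join of the subdivided tuple with \<open>p\<close>, preceded by the prism between
  the tuple and its subdivision. The pieces lie in segments issuing from \<open>p\<close>, so the
  join is aligned.\<close>

definition seg_cone :: "'v \<Rightarrow> 'v \<Rightarrow> 'v \<Rightarrow> ('v list \<Rightarrow> real) \<Rightarrow> 'v list \<Rightarrow> real" where
  "seg_cone p a b f xs = subdiv p a b (\<lambda>ys. f (p # ys)) xs - hom (subdiv p a b) f xs"

text \<open>The choice of the segment is harmless by \<open>cone_eq\<close>. On tuples that are not
  aligned the value carries no meaning but obeys the same bound.\<close>

definition cone :: "'v \<Rightarrow> ('v list \<Rightarrow> real) \<Rightarrow> 'v list \<Rightarrow> real" where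
  "cone p f xs = (case SOME (a, b). set xs \<subseteq> seg a b of (a, b) \<Rightarrow> seg_cone p a b f xs)"

lemma cone_eq:
  assumes "set xs \<subseteq> seg a b"
  shows "cone p f xs = seg_cone p a b f xs"
proof -
  obtain a' b' where ab: "(SOME (a, b). set xs \<subseteq> seg a b) = (a', b')" by fastforce
  have "set xs \<subseteq> seg a' b'"
    using someI[of "\<lambda>(a, b). set xs \<subseteq> seg a b" "(a, b)"] assms unfolding ab by simp
  then show ?thesis
    using assms by (simp add: cone_def ab seg_cone_def subdiv_indep[of xs a' b' a b]
        hom_subdiv_indep[of xs a' b' a b])
qed

lemma seg_cone_cbd: "seg_cone p a b (cbd f) xs = f xs - cbd (seg_cone p a b f) xs"
proof -
  have "subdiv p a b (\<lambda>ys. cbd f (p # ys)) xs =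
      subdiv p a b f xs - cbd (subdiv p a b (\<lambda>ys. f (p # ys))) xs"
    by (simp add: subdiv_diff subdiv_cbd)
  moreover have "cbd (hom (subdiv p a b) f) xs + hom (subdiv p a b) (cbd f) xs =
      subdiv p a b f xs - f xs"
    by (rule hom_homotopy) (rule subdiv_diff subdiv_Nil subdiv_cbd)+
  moreover have "cbd (seg_cone p a b f) xs =
      cbd (subdiv p a b (\<lambda>ys. f (p # ys))) xs - cbd (hom (subdiv p a b) f) xs"
    unfolding seg_cone_def by (rule cbd_diff)
  ultimately show ?thesis by (simp add: seg_cone_def)
qed

lemma cone_cbd:
  assumes "aligned xs"
  shows "cone p (cbd f) xs = f xs - cbd (cone p f) xs"
proof -
  obtain a b where ab: "set xs \<subseteq> seg a b" using assms by (auto simp: aligned_def)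
  have "cbd (cone p f) xs = cbd (seg_cone p a b f) xs"
    by (rule cbd_cong, rule cone_eq) (use ab in blast)
  then show ?thesis using cone_eq[OF ab] seg_cone_cbd by simp
qed

lemma cone_diff: "cone p (\<lambda>ys. f ys - g ys) = (\<lambda>ys. cone p f ys - cone p g ys)"
proof
  fix ys
  obtain a b where ab: "(SOME (a, b). set ys \<subseteq> seg a b) = (a, b)" by fastforce
  show "cone p (\<lambda>ys. f ys - g ys) ys = cone p f ys - cone p g ys"
    unfolding cone_def ab prod.case seg_cone_def
    by (simp add: subdiv_diff hom_diff[of "subdiv p a b", OF subdiv_diff])
qed

lemma meet_in_seg: "z \<in> seg a b \<Longrightarrow> meet p a z \<in> seg a b"
  "z \<in> seg a b \<Longrightarrow> meet p b z \<in> seg a b" "meet p a b \<in> seg a b"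
  by (auto simp: seg_iff[of _ a b p] intro: meet_greatest)

lemma subdiv_cong:
  assumes "set xs \<subseteq> seg a b"
    and "\<And>ys. set ys \<subseteq> seg a b \<Longrightarrow> length ys = length xs \<Longrightarrow> f ys = g ys"
  shows "subdiv p a b f xs = subdiv p a b g xs"
proof -
  have "meet p (meet p a b) z = meet p a b" if "z \<in> set xs" for z
    using assms(1) that by (intro meet_absorb2) (use seg_iff in blast)
  then show ?thesis unfolding subdiv_def
    using assms meet_in_seg by (intro arg_cong2[where f = "(-)"] arg_cong2[where f = "(+)"] assms(2)) auto
qed

text \<open>The prism part stays inside \<open>seg a b\<close> and the join part inside segments
  from \<open>p\<close>, so the cone reads \<open>f\<close> on aligned tuples only.\<close>

lemma cone_cong:
  assumes "aligned xs"
    and fg: "\<And>ys. aligned ys \<Longrightarrow> length ys = Suc (length xs) \<Longrightarrow> f ys = g ys"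
  shows "cone p f xs = cone p g xs"
proof -
  obtain a b where ab: "set xs \<subseteq> seg a b" using assms by (auto simp: aligned_def)
  have al: "aligned (p # map (meet p y) xs)" for y
    unfolding aligned_def by (intro exI[of _ p] exI[of _ y]) (auto simp: seg_def)
  have "hom (subdiv p a b) f xs = hom (subdiv p a b) g xs"
    by (rule hom_cong[where S = "seg a b"])
      (use subdiv_cong ab fg aligned_def in blast)+
  moreover have "subdiv p a b (\<lambda>ys. f (p # ys)) xs = subdiv p a b (\<lambda>ys. g (p # ys)) xs"
    by (simp add: subdiv_def fg al)
  ultimately show ?thesis by (simp add: cone_eq[OF ab] seg_cone_def)
qed

lemma subdiv_bound:
  assumes "\<And>ys. length ys = length xs \<Longrightarrow> \<bar>f ys\<bar> \<le> B"
  shows "\<bar>subdiv p a b f xs\<bar> \<le> 3 * B"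
  using assms[of "map (meet p a) xs"] assms[of "map (meet p b) xs"]
    assms[of "map (meet p (meet p a b)) xs"]
  by (simp add: subdiv_def)

text \<open>Three terms for the join and three for each of the \<open>length xs\<close> prisms,
  regardless of the distance between \<open>p\<close> and the tuple.\<close>

lemma cone_bound:
  assumes "\<And>ys. length ys = Suc (length xs) \<Longrightarrow> \<bar>f ys\<bar> \<le> B"
  shows "\<bar>cone p f xs\<bar> \<le> (3 + 3 * real (length xs)) * B"
proof -
  obtain a b where ab: "(SOME (a, b). set xs \<subseteq> seg a b) = (a, b)" by fastforce
  have "\<bar>subdiv p a b (\<lambda>ys. f (p # ys)) xs\<bar> \<le> 3 * B"
    by (rule subdiv_bound) (simp add: assms)
  moreover have "\<bar>hom (subdiv p a b) f xs\<bar> \<le> real (length xs) * (3 * B)"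
    by (rule hom_bound[where S = UNIV and B = B]) (auto intro: subdiv_bound assms)
  ultimately show ?thesis by (simp add: cone_def ab seg_cone_def algebra_simps)
qed

lemma subdiv_aut:
  assumes "g \<in> tree_aut adj"
  shows "subdiv (g p) (g a) (g b) f (map g xs) = subdiv p a b (\<lambda>ys. f (map g ys)) xs"
  by (simp add: subdiv_def meet_aut[OF assms] comp_def)

lemma hom_subdiv_aut:
  assumes "g \<in> tree_aut adj"
  shows "hom (subdiv (g p) (g a) (g b)) f (map g xs) = hom (subdiv p a b) (\<lambda>ys. f (map g ys)) xs"
proof (induction xs arbitrary: f)
  case (Cons x xs)
  then show ?case using subdiv_aut[OF assms, of p a b _ "x # xs"] by simp
qed simp

lemma cone_aut:
  assumes g: "g \<in> tree_aut adj" and "aligned xs"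
  shows "cone (g p) f (map g xs) = cone p (\<lambda>ys. f (map g ys)) xs"
proof -
  obtain a b where ab: "set xs \<subseteq> seg a b" using assms by (auto simp: aligned_def)
  then have "set (map g xs) \<subseteq> seg (g a) (g b)" using seg_aut[OF g] by auto
  then show ?thesis using cone_eq[OF ab] cone_eq[of "map g xs" "g a" "g b"]
    by (simp add: seg_cone_def subdiv_aut[OF g] hom_subdiv_aut[OF g])
qed

abbreviation "align \<equiv> pull cone"

lemma align_diff: "align (\<lambda>ys. f ys - g ys) xs = align f xs - align g xs"
  by (rule pull_diff) (rule cone_diff)

text \<open>The purpose of \<open>align\<close>: its value on any tuple whatsoever depends only on
  the aligned values of \<open>f\<close>.\<close>

lemma align_cong:
  "(\<And>ys. aligned ys \<Longrightarrow> length ys = length xs \<Longrightarrow> f ys = g ys) \<Longrightarrow> align f xs = align g xs"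
  by (rule pull_cong[where good = aligned]) (auto intro: cone_cong)

lemma align_cbd: "align (cbd f) xs = cbd (align f) xs"
  by (rule pull_cbd[where good = aligned]) (auto intro: cone_cong cone_diff cone_cbd)

lemma align_homotopy: "cbd (hom align f) xs + hom align (cbd f) xs = align f xs - f xs"
  by (rule hom_homotopy) (auto simp: align_diff align_cbd)

lemma align_aut:
  assumes g: "g \<in> tree_aut adj"
  shows "align f (map g xs) = align (\<lambda>ys. f (map g ys)) xs"
proof (induction xs arbitrary: f)
  case (Cons x xs)
  have "align f (map g (x # xs)) = align (\<lambda>ys. cone (g x) f (map g ys)) xs"
    by (simp add: Cons.IH)
  also have "\<dots> = align (cone x (\<lambda>ys. f (map g ys))) xs"
    by (rule align_cong) (rule cone_aut[OF g])
  finally show ?case by simp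
qed simp

lemma hom_align_aut:
  assumes g: "g \<in> tree_aut adj"
  shows "hom align f (map g xs) = hom align (\<lambda>ys. f (map g ys)) xs"
proof (induction xs arbitrary: f)
  case (Cons x xs)
  then show ?case using align_aut[OF g, of _ "x # xs"] by simp
qed simp

lemma align_bound:
  "\<exists>C\<ge>0. \<forall>(f :: 'v list \<Rightarrow> real) B xs. length xs = n \<longrightarrow> (\<forall>ys. length ys = n \<longrightarrow> \<bar>f ys\<bar> \<le> B) \<longrightarrow> \<bar>align f xs\<bar> \<le> C * B"
proof (induction n)
  case 0
  show ?case by (intro exI[of _ 1]) auto
next
  case (Suc n)
  then obtain C where C: "C \<ge> 0" "\<And>(f :: 'v list \<Rightarrow> real) B xs. length xs = n \<Longrightarrow>
      (\<And>ys. length ys = n \<Longrightarrow> \<bar>f ys\<bar> \<le> B) \<Longrightarrow> \<bar>align f xs\<bar> \<le> C * B" by metis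
  show ?case
  proof (intro exI[of _ "C * (3 + 3 * real n)"] conjI allI impI)
    fix f :: "'v list \<Rightarrow> real" and B and xs :: "'v list"
    assume xs: "length xs = Suc n" and B: "\<forall>ys. length ys = Suc n \<longrightarrow> \<bar>f ys\<bar> \<le> B"
    obtain y ys where y: "xs = y # ys" using xs by (cases xs) auto
    have "\<bar>align (cone y f) ys\<bar> \<le> C * ((3 + 3 * real n) * B)"
    proof (rule C(2))
      fix zs :: "'v list" assume "length zs = n"
      then show "\<bar>cone y f zs\<bar> \<le> (3 + 3 * real n) * B" using cone_bound[of zs f B y] B by simp
    qed (use xs y in simp)
    then show "\<bar>align f xs\<bar> \<le> C * (3 + 3 * real n) * B" by (simp add: y mult.assoc)
  qed (use C(1) in simp)
qed

lemma hom_align_bound: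
  "\<exists>C\<ge>0. \<forall>(f :: 'v list \<Rightarrow> real) B xs. length xs = n \<longrightarrow> (\<forall>ys. \<bar>f ys\<bar> \<le> B) \<longrightarrow> \<bar>hom align f xs\<bar> \<le> C * B"
proof (induction n)
  case 0
  show ?case by (intro exI[of _ 0]) auto
next
  case (Suc n)
  then obtain C where C: "C \<ge> 0" "\<And>(f :: 'v list \<Rightarrow> real) B xs. length xs = n \<Longrightarrow>
      (\<And>ys. \<bar>f ys\<bar> \<le> B) \<Longrightarrow> \<bar>hom align f xs\<bar> \<le> C * B" by metis
  obtain D where D: "D \<ge> 0" "\<And>(f :: 'v list \<Rightarrow> real) B xs. length xs = Suc n \<Longrightarrow>
      (\<And>ys. length ys = Suc n \<Longrightarrow> \<bar>f ys\<bar> \<le> B) \<Longrightarrow> \<bar>align f xs\<bar> \<le> D * B"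
    using align_bound[of "Suc n"] by metis
  show ?case
  proof (intro exI[of _ "D + C"] conjI allI impI)
    fix f :: "'v list \<Rightarrow> real" and B and xs :: "'v list"
    assume xs: "length xs = Suc n" and B: "\<forall>ys. \<bar>f ys\<bar> \<le> B"
    obtain y ys where y: "xs = y # ys" using xs by (cases xs) auto
    have "\<bar>align (\<lambda>zs. f (y # zs)) (y # ys)\<bar> \<le> D * B"
      by (rule D(2)) (use xs y B in auto)
    moreover have "\<bar>hom align (\<lambda>zs. f (y # zs)) ys\<bar> \<le> C * B"
      by (rule C(2)) (use xs y B in auto)
    ultimately show "\<bar>hom align f xs\<bar> \<le> (D + C) * B" by (simp add: y algebra_simps del: pull.simps)
  qed (use C(1) D(1) in simp)
qed

end

section \<open>Cochains on aligned tuples and the infinite dihedral group\<close>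

text \<open>An entry different from the first one fixes the orientation \<open>e\<close>, and the
  distances to these two entries determine all others. A constant tuple is matched by a
  translation.\<close>

lemma rigid_int_lists:
  fixes u v :: "int list"
  assumes len: "length u = length v"
    and dist: "\<And>i j. i < length u \<Longrightarrow> j < length u \<Longrightarrow> \<bar>u ! i - u ! j\<bar> = \<bar>v ! i - v ! j\<bar>"
  shows "\<exists>s e. \<bar>e\<bar> = 1 \<and> v = map (\<lambda>t. s + e * t) u"
proof (cases "\<exists>j<length u. u ! j \<noteq> u ! 0")
  case True
  then obtain j where j: "j < length u" "u ! j \<noteq> u ! 0" by blast
  then have 0: "0 < length u" by auto
  define e where "e = (if v ! j - v ! 0 = u ! j - u ! 0 then 1 else -1 :: int)"
  have "v ! i = (v ! 0 - e * u ! 0) + e * u ! i" if i: "i < length u" for i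
    using dist[OF i 0] dist[OF i j(1)] dist[OF j(1) 0] j(2) unfolding e_def by (auto split: if_splits)
  then have "v = map (\<lambda>t. (v ! 0 - e * u ! 0) + e * t) u"
    using len by (intro nth_equalityI) auto
  moreover have "\<bar>e\<bar> = 1" by (simp add: e_def)
  ultimately show ?thesis by blast
next
  case False
  have "v = map (\<lambda>t. (v ! 0 - u ! 0) + 1 * t) u"
  proof (rule nth_equalityI)
    fix i assume i: "i < length v"
    then have "i < length u" "0 < length u" using len by auto
    moreover from this have "u ! i = u ! 0" using False by blast
    ultimately show "v ! i = map (\<lambda>t. (v ! 0 - u ! 0) + 1 * t) u ! i"
      using dist[of i 0] by simp
  qed (simp add: len)
  then show ?thesis by (intro exI[of _ "v ! 0 - u ! 0"] exI[of _ 1]) simp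
qed

definition int_avg :: "nat \<Rightarrow> (int \<Rightarrow> real) \<Rightarrow> real" where
  "int_avg N \<phi> = (\<Sum>t\<in>{- int N..int N}. \<phi> t) / (2 * real N + 1)"

lemma int_avg_const: "int_avg N (\<lambda>t. a) = a"
proof -
  have "2 * real N + 1 \<noteq> 0" using of_nat_0_le_iff[of N] by linarith
  moreover have "real (nat (1 + 2 * int N)) = 2 * real N + 1" by simp
  ultimately show ?thesis by (simp add: int_avg_def)
qed

lemma int_avg_bound:
  assumes "\<And>t. \<bar>\<phi> t\<bar> \<le> B"
  shows "\<bar>int_avg N \<phi>\<bar> \<le> B"
proof -
  have "\<bar>\<Sum>t\<in>{- int N..int N}. \<phi> t\<bar> \<le> (\<Sum>t\<in>{- int N..int N}. B)"
    by (rule order_trans[OF sum_abs]) (rule sum_mono[OF assms])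
  then have "\<bar>\<Sum>t\<in>{- int N..int N}. \<phi> t\<bar> \<le> (2 * real N + 1) * B"
    by (simp add: algebra_simps)
  then show ?thesis by (simp add: int_avg_def divide_le_eq mult.commute)
qed

text \<open>Intervals are Folner sets: reflection at 0 preserves \<open>?I\<close>, and translation
  by \<open>s\<close> changes it by at most \<open>\<bar>s\<bar>\<close> points at either
  end.\<close>

lemma int_avg_isometry:
  assumes B: "\<And>t. \<bar>\<phi> t\<bar> \<le> B" and e: "\<bar>e\<bar> = (1::int)"
  shows "\<bar>int_avg N (\<lambda>t. \<phi> (s + e * t)) - int_avg N \<phi>\<bar> \<le> 2 * \<bar>real_of_int s\<bar> * B / (2 * real N + 1)"
proof -
  have "e = 1 \<or> e = -1" using e by arith
  let ?I = "{- int N..int N}" and ?J = "{s - int N..s + int N}"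
  have bij: "bij_betw (\<lambda>t. s + e * t) ?I ?J"
    using \<open>e = 1 \<or> e = -1\<close>
    by (intro bij_betw_byWitness[where f' = "\<lambda>t. e * (t - s)"]) (auto simp: algebra_simps)
  have "(\<Sum>t\<in>?I. \<phi> (s + e * t)) = sum \<phi> ?J"
    by (rule sum.reindex_bij_betw[OF bij])
  moreover have "sum \<phi> ?J = sum \<phi> (?J - ?I) + sum \<phi> (?J \<inter> ?I)"
    by (subst sum.union_disjoint[symmetric]) (auto intro: arg_cong[where f = "sum \<phi>"])
  moreover have "sum \<phi> ?I = sum \<phi> (?I - ?J) + sum \<phi> (?J \<inter> ?I)"
    by (subst sum.union_disjoint[symmetric]) (auto intro: arg_cong[where f = "sum \<phi>"])
  ultimately have eq: "(\<Sum>t\<in>?I. \<phi> (s + e * t)) - sum \<phi> ?I = sum \<phi> (?J - ?I) - sum \<phi> (?I - ?J)"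
    by simp
  have B0: "B \<ge> 0" using B[of 0] by linarith
  have small: "\<bar>sum \<phi> A\<bar> \<le> \<bar>real_of_int s\<bar> * B" if "A \<subseteq> C" "finite C" "card C \<le> nat \<bar>s\<bar>" for A C
  proof -
    have "\<bar>sum \<phi> A\<bar> \<le> (\<Sum>t\<in>A. B)"
      by (rule order_trans[OF sum_abs]) (rule sum_mono[OF B])
    also have "\<dots> = real (card A) * B" by simp
    also have "card A \<le> nat \<bar>s\<bar>" using card_mono[OF that(2,1)] that(3) by simp
    then have "real (card A) \<le> \<bar>real_of_int s\<bar>" by linarith
    then have "real (card A) * B \<le> \<bar>real_of_int s\<bar> * B" using B0 by (rule mult_right_mono)
    finally show ?thesis .
  qed
  have "\<bar>sum \<phi> (?J - ?I)\<bar> \<le> \<bar>real_of_int s\<bar> * B"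
  proof (cases "s \<ge> 0")
    case True
    show ?thesis by (rule small[of _ "{int N + 1..int N + s}"]) (use True in auto)
  next
    case False
    show ?thesis by (rule small[of _ "{s - int N..- int N - 1}"]) (use False in auto)
  qed
  moreover have "\<bar>sum \<phi> (?I - ?J)\<bar> \<le> \<bar>real_of_int s\<bar> * B"
  proof (cases "s \<ge> 0")
    case True
    show ?thesis by (rule small[of _ "{- int N..s - int N - 1}"]) (use True in auto)
  next
    case False
    show ?thesis by (rule small[of _ "{s + int N + 1..int N}"]) (use False in auto)
  qed
  ultimately have "\<bar>(\<Sum>t\<in>?I. \<phi> (s + e * t)) - sum \<phi> ?I\<bar> \<le> 2 * \<bar>real_of_int s\<bar> * B"
    unfolding eq by linarith
  then have "\<bar>((\<Sum>t\<in>?I. \<phi> (s + e * t)) - sum \<phi> ?I) / (2 * real N + 1)\<bar> \<le> 2 * \<bar>real_of_int s\<bar> * B / (2 * real N + 1)"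
    using divide_right_mono[of _ _ "2 * real N + 1"] by (simp add: abs_divide)
  then show ?thesis by (simp add: int_avg_def diff_divide_distrib)
qed

section \<open>A bi-infinite geodesic and the action of \<open>G\<close> on its finite
  pieces\<close>

context ff_tree
begin

definition edge_color :: "int \<Rightarrow> nat" where
  "edge_color k = (if even k then 1 else 2)"

text \<open>The edge between the positions \<open>k\<close> and \<open>k + 1\<close> has color
  \<open>edge_color k\<close>. Walking down from \<open>- i\<close> therefore crosses the edge
  numbered \<open>- 1 - i\<close>.\<close>

definition line :: "int \<Rightarrow> 'v" where
  "line t = (if t \<ge> 0 then walk undefined (map (\<lambda>i. edge_color (int i)) [0..<nat t])
     else walk undefined (map (\<lambda>i. edge_color (- 1 - int i)) [0..<nat (- t)]))"

lemma edge_color_range: "edge_color k \<in> {1..d}"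
  using d3 by (auto simp: edge_color_def)

lemma line_succ: "nb (line k) (edge_color k) = line (k + 1)"
proof (cases "k \<ge> 0")
  case True
  then have "nat (k + 1) = Suc (nat k)" by linarith
  then show ?thesis using True by (simp add: line_def)
next
  case False
  then have *: "nat (- k) = Suc (nat (- k - 1))" by linarith
  have "line (k + 1) = walk undefined (map (\<lambda>i. edge_color (- 1 - int i)) [0..<nat (- k - 1)])"
  proof (cases "k = -1")
    case True then show ?thesis by (simp add: line_def)
  next
    case F: False
    then show ?thesis using False by (simp add: line_def)
  qed
  moreover have "- 1 - int (nat (- k - 1)) = k" using False by simp
  ultimately have "line k = nb (line (k + 1)) (edge_color k)"
    using False * by (simp add: line_def)
  then show ?thesis using nb_nb[OF edge_color_range] by simp
qed

lemma line_pred: "nb (line k) (edge_color (k - 1)) = line (k - 1)"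
  using line_succ[of "k - 1"] nb_nb[OF edge_color_range] by (metis diff_add_cancel)

definition line_word :: "int \<Rightarrow> int \<Rightarrow> nat \<Rightarrow> nat list" where
  "line_word e s n = map (\<lambda>i. edge_color (if e = 1 then s + int i else s - 1 - int i)) [0..<n]"

lemma line_word_properties:
  assumes "\<bar>e\<bar> = 1"
  shows "red (line_word e s n)" "length (line_word e s n) = n"
    "k \<le> n \<Longrightarrow> walk (line s) (take k (line_word e s n)) = line (s + e * int k)"
proof -
  show len: "length (line_word e s n) = n" by (simp add: line_word_def)
  have "distinct_adj (line_word e s n)"
    unfolding distinct_adj_conv_nth by (auto simp: line_word_def edge_color_def)
  then show "red (line_word e s n)"
    using edge_color_range by (auto simp: red_def line_word_def)
  have e: "e = 1 \<or> e = -1" using assms by arith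
  show "k \<le> n \<Longrightarrow> walk (line s) (take k (line_word e s n)) = line (s + e * int k)"
  proof (induction k)
    case (Suc k)
    have "line_word e s n ! k = edge_color (if e = 1 then s + int k else s - 1 - int k)"
      using Suc.prems by (simp add: line_word_def)
    then show ?case
      using Suc e line_succ[of "s + int k"] line_pred[of "s - int k"]
      by (auto simp: take_Suc_conv_app_nth len algebra_simps)
  qed simp
qed

lemma dst_line: "dst (line s) (line t) = nat \<bar>s - t\<bar>"
proof -
  have up: "dst (line s) (line t) = nat (t - s)" if "s \<le> t" for s t
  proof -
    let ?n = "nat (t - s)"
    have "walk (line s) (line_word 1 s ?n) = line t"
      using line_word_properties(3)[of 1 ?n ?n s] line_word_properties(2)[of 1 s ?n] that by simp
    then have "word (line s) (line t) = line_word 1 s ?n"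
      by (metis abs_one line_word_properties(1) word_walk)
    then show ?thesis by (simp add: dst_def line_word_def)
  qed
  show ?thesis
  proof (cases "s \<le> t")
    case True then show ?thesis using up by simp
  next
    case False
    then show ?thesis using up[of t s] dst_commute[of "line s" "line t"] by simp
  qed
qed

lemma ex_aut_line:
  assumes "red w"
  shows "\<exists>g\<in>G. \<forall>k\<le>length w. g (line (s + int k)) = walk p (take k w)"
  using ex_aut_on_path[of "line_word 1 s (length w)" w "line s" p] assms
    line_word_properties[where e = 1 and s = s and n = "length w"] by auto

text \<open>Finiteness of \<open>A\<close> confines the problem to a path of length
  \<open>2 * N\<close>. Its image has to start at \<open>s - e * int N\<close>, the image of
  \<open>- int N\<close>.\<close>

lemma ex_isometry_line:
  assumes "\<bar>e\<bar> = 1" "finite A"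
  shows "\<exists>g\<in>G. \<forall>t\<in>A. g (line t) = line (s + e * t)"
proof -
  obtain N where N: "\<forall>t\<in>A. \<bar>t\<bar> \<le> int N"
  proof (rule that)
    show "\<forall>t\<in>A. \<bar>t\<bar> \<le> int (nat (\<Sum>t\<in>A. \<bar>t\<bar>))"
      using assms(2) by (auto simp: sum_nonneg intro: member_le_sum)
  qed
  let ?w = "line_word e (s - e * int N) (2 * N)"
  obtain g where g: "g \<in> G" and gk:
    "\<And>k. k \<le> 2 * N \<Longrightarrow> g (line (- int N + int k)) = walk (line (s - e * int N)) (take k ?w)"
    using ex_aut_line[of ?w "- int N" "line (s - e * int N)"]
      line_word_properties[OF assms(1), where s = "s - e * int N" and n = "2 * N"] by auto
  have "g (line t) = line (s + e * t)" if t: "t \<in> A" for t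
  proof -
    have "\<bar>t\<bar> \<le> int N" using N t by blast
    then have k: "nat (t + int N) \<le> 2 * N" "int (nat (t + int N)) = t + int N" by linarith+
    have "g (line t) = line (s - e * int N + e * (t + int N))"
      using gk[OF k(1)] line_word_properties(3)[OF assms(1) k(1), of "s - e * int N"] k(2) by simp
    then show ?thesis by (simp add: algebra_simps)
  qed
  then show ?thesis using g by blast
qed

lemma aligned_on_line:
  assumes "aligned xs"
  shows "\<exists>g\<in>G. \<exists>u. xs = map (\<lambda>t. g (line t)) u"
proof -
  obtain a b where ab: "set xs \<subseteq> seg a b" using assms by (auto simp: aligned_def)
  obtain g where g: "g \<in> G" "\<And>k. k \<le> length (word a b) \<Longrightarrow> g (line (int k)) = walk a (take k (word a b))"
    using ex_aut_line[of "word a b" 0 a] by auto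
  have "g (line (int (dst a z))) = z" if "z \<in> set xs" for z
  proof -
    have "prefix (word a z) (word a b)" using that ab by (auto simp: seg_def le_def)
    then have "dst a z \<le> length (word a b)" "take (dst a z) (word a b) = word a z"
      unfolding dst_def by (auto simp: prefix_def)
    then show ?thesis using g(2) by simp
  qed
  then have "xs = map (\<lambda>t. g (line t)) (map (\<lambda>z. int (dst a z)) xs)"
    by (simp add: map_idI)
  then show ?thesis using g(1) by blast
qed

text \<open>Automorphisms preserve distances, so the coordinates of an aligned tuple are unique up
  to an isometry of the integers; this is how the infinite dihedral group enters.\<close>

lemma line_coordinates_unique:
  assumes "g \<in> G" "h \<in> G" and eq: "map (\<lambda>t. g (line t)) u = map (\<lambda>t. h (line t)) v"
  shows "\<exists>s e. \<bar>e\<bar> = 1 \<and> v = map (\<lambda>t. s + e * t) u"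
proof (rule rigid_int_lists)
  show len: "length u = length v" using eq map_eq_imp_length_eq by blast
  fix i j assume ij: "i < length u" "j < length u"
  have "g (line (u ! i)) = h (line (v ! i))" "g (line (u ! j)) = h (line (v ! j))"
    using arg_cong[OF eq, of "\<lambda>l. l ! i"] arg_cong[OF eq, of "\<lambda>l. l ! j"] ij len by auto
  then have "dst (line (u ! i)) (line (u ! j)) = dst (line (v ! i)) (line (v ! j))"
    using dst_aut[OF G_aut[OF assms(1)]] dst_aut[OF G_aut[OF assms(2)]] by metis
  then show "\<bar>u ! i - u ! j\<bar> = \<bar>v ! i - v ! j\<bar>" by (simp add: dst_line)
qed

text \<open>An invariant mean over the apex \<open>t\<close> of the contraction that inserts
  \<open>t\<close> as first entry.\<close>

definition line_avg :: "('v list \<Rightarrow> real) \<Rightarrow> int list \<Rightarrow> real" where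
  "line_avg f u = ulim (\<lambda>N. int_avg N (\<lambda>t. f (map line (t # u))))"

text \<open>By \<open>line_avg_isometry\<close> the value does not depend on which coordinates are
  chosen.\<close>

definition aligned_prim :: "('v list \<Rightarrow> real) \<Rightarrow> 'v list \<Rightarrow> real" where
  "aligned_prim f xs = line_avg f (SOME u. \<exists>g\<in>G. xs = map (\<lambda>t. g (line t)) u)"

context
  fixes f :: "'v list \<Rightarrow> real" and B :: real
  assumes bound: "\<And>xs. \<bar>f xs\<bar> \<le> B"
    and invariant: "\<And>g xs. g \<in> G \<Longrightarrow> f (map g xs) = f xs"
begin

lemma line_isometry_invariant:
  assumes "\<bar>e\<bar> = 1"
  shows "f (map line (map (\<lambda>t. s + e * t) u)) = f (map line u)"
proof -
  obtain g where "g \<in> G" "\<forall>t\<in>set u. g (line t) = line (s + e * t)"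
    using ex_isometry_line[OF assms, of "set u" s] by auto
  then have "map line (map (\<lambda>t. s + e * t) u) = map g (map line u)" by simp
  then show ?thesis using invariant[OF \<open>g \<in> G\<close>] by metis
qed

lemma line_avg_tendsto:
  "((\<lambda>N. int_avg N (\<lambda>t. f (map line (t # u)))) \<longlongrightarrow> line_avg f u) ufilter"
  unfolding line_avg_def by (rule ulim_tendsto[of _ B]) (rule int_avg_bound, rule bound)

lemma line_avg_isometry:
  assumes e: "\<bar>e\<bar> = 1"
  shows "line_avg f (map (\<lambda>t. s + e * t) u) = line_avg f u"
proof -
  let ?v = "map (\<lambda>t. s + e * t) u"
  have e': "e = 1 \<or> e = -1" using e by arith
  have "f (map line (t # ?v)) = f (map line ((- e * s + e * t) # u))" for t
  proof -
    \<comment> \<open>Since \<open>e * e = 1\<close>, the apex \<open>t\<close> is the image of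
      \<open>- e * s + e * t\<close>. The isometry moves from \<open>u\<close> to the variable of
      the average, where it is negligible in the limit.\<close>
    have "t # ?v = map (\<lambda>t. s + e * t) ((- e * s + e * t) # u)"
      using e' by auto
    then show ?thesis using line_isometry_invariant[OF e] by metis
  qed
  then have eq: "int_avg N (\<lambda>t. f (map line (t # ?v))) =
      int_avg N (\<lambda>t. f (map line ((- e * s + e * t) # u)))" for N by simp
  let ?D = "\<lambda>N. int_avg N (\<lambda>t. f (map line (t # ?v))) - int_avg N (\<lambda>t. f (map line (t # u)))"
  have D: "\<bar>?D N\<bar> \<le> 2 * \<bar>real_of_int (- e * s)\<bar> * B / (2 * real N + 1)" for N
    unfolding eq by (rule int_avg_isometry[where \<phi> = "\<lambda>t. f (map line (t # u))", OF bound e])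
  have "(\<lambda>N. 2 * \<bar>real_of_int (- e * s)\<bar> * B / (2 * real N + 1)) \<longlonglongrightarrow> 0"
    by (intro tendsto_divide_0[OF tendsto_const] filterlim_at_top_imp_at_infinity
        filterlim_at_top_mono[OF filterlim_real_sequentially]) auto
  then have "?D \<longlonglongrightarrow> 0" by (rule Lim_null_comparison[rotated]) (intro always_eventually allI, simp only: real_norm_def D)
  then have "(?D \<longlongrightarrow> 0) ufilter" by (rule filterlim_mono) (simp_all add: ufilter_le)
  then have "line_avg f u = line_avg f ?v" unfolding line_avg_def
    by (intro ulim_eq_diff[where B = B] int_avg_bound bound)
  then show ?thesis by simp
qed

lemma aligned_prim_eq:
  assumes "g \<in> G"
  shows "aligned_prim f (map (\<lambda>t. g (line t)) u) = line_avg f u"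
proof -
  let ?P = "\<lambda>v. \<exists>h\<in>G. map (\<lambda>t. g (line t)) u = map (\<lambda>t. h (line t)) v"
  have "?P (SOME v. ?P v)" by (rule someI[of ?P u]) (use assms in blast)
  then obtain s e where "\<bar>e\<bar> = 1" "(SOME v. ?P v) = map (\<lambda>t. s + e * t) u"
    using line_coordinates_unique[OF assms] by blast
  then show ?thesis unfolding aligned_prim_def using line_avg_isometry by simp
qed

lemma aligned_prim_aut:
  assumes "aligned xs" "h \<in> G"
  shows "aligned_prim f (map h xs) = aligned_prim f xs"
proof -
  obtain g u where g: "g \<in> G" "xs = map (\<lambda>t. g (line t)) u"
    using aligned_on_line[OF assms(1)] by blast
  have "map h xs = map (\<lambda>t. (h \<circ> g) (line t)) u" by (simp add: g(2))
  then show ?thesis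
    using aligned_prim_eq[OF G_comp[OF assms(2) g(1)], of u] aligned_prim_eq[OF g(1), of u] g(2)
    by metis
qed

lemma aligned_prim_bound: "\<bar>aligned_prim f xs\<bar> \<le> B"
  unfolding aligned_prim_def line_avg_def by (intro ulim_abs_le int_avg_bound bound)

text \<open>For every apex \<open>t\<close> the cocycle identity on \<open>t # u\<close> says that
  inserting \<open>t\<close> gives a primitive on the line. Averaging over \<open>t\<close> keeps
  this and makes the primitive invariant.\<close>

lemma aligned_prim_cbd:
  assumes "aligned xs" and cocycle: "\<And>ys. length ys = Suc (length xs) \<Longrightarrow> cbd f ys = 0"
  shows "cbd (aligned_prim f) xs = f xs"
proof -
  obtain g u where g: "g \<in> G" "xs = map (\<lambda>t. g (line t)) u"
    using aligned_on_line[OF assms(1)] by blast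
  let ?F = "\<lambda>u. f (map line u)"
  have "cbd (aligned_prim f) xs = cbd (line_avg f) u"
    unfolding g(2) cbd_map aligned_prim_eq[OF g(1)] by simp
  moreover have "cbd (\<lambda>v. int_avg N (\<lambda>t. ?F (t # v))) u = ?F u" for N
  proof -
    have "cbd (\<lambda>v. int_avg N (\<lambda>t. ?F (t # v))) u = int_avg N (\<lambda>t. cbd (\<lambda>v. ?F (t # v)) u)"
      unfolding int_avg_def by (simp only: cbd_divide cbd_sum)
    moreover have "cbd (\<lambda>v. ?F (t # v)) u = ?F u" for t
      using cocycle[of "map line (t # u)"] g(2) by (simp add: cbd_map)
    ultimately show ?thesis by (simp only: int_avg_const)
  qed
  moreover have "((\<lambda>N. cbd (\<lambda>v. int_avg N (\<lambda>t. ?F (t # v))) u) \<longlongrightarrow> cbd (line_avg f) u) ufilter"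
    by (rule cbd_tendsto) (rule line_avg_tendsto)
  ultimately have "((\<lambda>N. ?F u) \<longlongrightarrow> cbd (aligned_prim f) xs) ufilter" by simp
  then have "cbd (aligned_prim f) xs = ?F u"
    by (rule tendsto_unique[OF ufilter_bot _ tendsto_const])
  also have "\<dots> = f xs" using invariant[OF g(1), of "map line u"] g(2) by (simp add: o_def)
  finally show ?thesis .
qed

text \<open>\<open>aligned_prim f\<close> is a primitive on aligned tuples, \<open>align\<close>
  turns it into a primitive of \<open>align f\<close> on all tuples, and \<open>hom align f\<close>
  accounts for the difference between \<open>align f\<close> and \<open>f\<close>.\<close>

lemma tree_cocycle_trivial:
  assumes cocycle: "\<And>ys. length ys = Suc (Suc n) \<Longrightarrow> cbd f ys = 0"
  shows "\<exists>b C. (\<forall>xs. length xs = Suc n \<longrightarrow> cbd b xs = f xs) \<and>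
    (\<forall>g\<in>G. \<forall>xs. b (map g xs) = b xs) \<and> (\<forall>xs. length xs = n \<longrightarrow> \<bar>b xs\<bar> \<le> C)"
proof -
  let ?b = "\<lambda>xs. align (aligned_prim f) xs - hom align f xs"
  have "cbd ?b xs = f xs" if n: "length xs = Suc n" for xs
  proof -
    have "cbd (align (aligned_prim f)) xs = align (cbd (aligned_prim f)) xs"
      by (rule align_cbd[symmetric])
    also have "\<dots> = align f xs"
      by (rule align_cong, rule aligned_prim_cbd) (use cocycle n in auto)
    moreover have "hom align (cbd f) xs = 0"
    proof -
      \<comment> \<open>The zero cochain is written as a difference so that linearity sends it to
        zero.\<close>
      have "hom align (cbd f) xs = hom align (\<lambda>ys. cbd f ys - cbd f ys) xs"
        by (rule hom_cong[where S = UNIV]) (auto intro: align_cong simp: cocycle n)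
      also have "\<dots> = 0" using hom_diff[of align "cbd f" "cbd f" xs] align_diff by simp
      finally show ?thesis .
    qed
    ultimately show ?thesis using align_homotopy[of f xs] by (simp add: cbd_diff)
  qed
  moreover have "?b (map g xs) = ?b xs" if g: "g \<in> G" for g xs
  proof -
    have "align (aligned_prim f) (map g xs) = align (aligned_prim f) xs"
      unfolding align_aut[OF G_aut[OF g]] by (rule align_cong) (rule aligned_prim_aut[OF _ g])
    then show ?thesis using hom_align_aut[OF G_aut[OF g], of f xs] invariant[OF g] by simp
  qed
  moreover have "\<exists>C. \<forall>xs. length xs = n \<longrightarrow> \<bar>?b xs\<bar> \<le> C"
  proof -
    obtain C where "\<And>xs. length xs = n \<Longrightarrow> \<bar>align (aligned_prim f) xs\<bar> \<le> C * B"
      using align_bound[of n] aligned_prim_bound by metis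
    moreover obtain D where "\<And>xs. length xs = n \<Longrightarrow> \<bar>hom align f xs\<bar> \<le> D * B"
      using hom_align_bound[of n] bound by metis
    ultimately have "\<bar>?b xs\<bar> \<le> C * B + D * B" if "length xs = n" for xs
      using that by (smt (verit))
    then show ?thesis by blast
  qed
  ultimately show ?thesis by blast
qed

end

end

section \<open>Averaging over transversals\<close>

lemma abs_average_le:
  assumes "finite R" "R \<noteq> {}" "\<And>r. r \<in> R \<Longrightarrow> \<bar>\<phi> r\<bar> \<le> B"
  shows "\<bar>(\<Sum>r\<in>R. \<phi> r) / real (card R)\<bar> \<le> B"
proof -
  have "\<bar>\<Sum>r\<in>R. \<phi> r\<bar> \<le> (\<Sum>r\<in>R. B)" by (rule order_trans[OF sum_abs]) (rule sum_mono[OF assms(3)])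
  then have "\<bar>\<Sum>r\<in>R. \<phi> r\<bar> \<le> real (card R) * B" by simp
  moreover have "real (card R) > 0" using assms by (simp add: card_gt_0_iff)
  ultimately show ?thesis by (simp add: abs_divide divide_le_eq mult.commute)
qed

text \<open>Up to right factors, these are the tuples on which \<open>hom (averages R) f\<close>
  reads \<open>f\<close>. Being finitely many, they admit a common estimate.\<close>

fun dups :: "'a list \<Rightarrow> 'a list set" where
  "dups [] = {}"
| "dups (x # xs) = insert (x # x # xs) ((#) x ` dups xs)"

lemma finite_dups: "finite (dups xs)"
  by (induction xs) auto

lemma dups_properties: "ds \<in> dups xs \<Longrightarrow> length ds = Suc (length xs) \<and> set ds \<subseteq> set xs"
  by (induction xs arbitrary: ds) fastforce+

locale averaging =
  fixes mul :: "'a \<Rightarrow> 'a \<Rightarrow> 'a" (infixl "\<star>" 70) and one :: 'a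
  assumes assoc: "(a \<star> b) \<star> c = a \<star> (b \<star> c)" and right_one: "a \<star> one = a" and left_one: "one \<star> a = a"
begin

text \<open>A cone whose apex is spread uniformly over the \<open>x \<star> r\<close>. Iterated by
  \<open>pull\<close>, it averages \<open>f\<close> over independent right factors from
  \<open>R\<close> in all entries.\<close>

definition average :: "'a set \<Rightarrow> 'a \<Rightarrow> ('a list \<Rightarrow> real) \<Rightarrow> 'a list \<Rightarrow> real" where
  "average R x f ys = (\<Sum>r\<in>R. f ((x \<star> r) # ys)) / real (card R)"

abbreviation "averages R \<equiv> pull (average R)"

abbreviation act :: "'a list \<Rightarrow> 'a list \<Rightarrow> 'a list" where
  "act \<equiv> map2 (\<star>)"

lemma set_act:
  assumes "set gs \<subseteq> S" "set us \<subseteq> T" "\<And>g u. g \<in> S \<Longrightarrow> u \<in> T \<Longrightarrow> g \<star> u \<in> Z"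
  shows "set (act gs us) \<subseteq> Z"
  using assms(1,2) by (auto intro!: assms(3) dest: set_zip_leftD set_zip_rightD)

lemma act_assoc: "act gs (act us vs) = act (act gs us) vs"
proof (induction gs arbitrary: us vs)
  case (Cons g gs)
  then show ?case by (cases us; cases vs) (auto simp: assoc)
qed simp

lemma average_diff: "average R x (\<lambda>ys. f ys - g ys) = (\<lambda>ys. average R x f ys - average R x g ys)"
  by (rule ext) (simp add: average_def sum_subtractf diff_divide_distrib)

lemma average_cbd:
  assumes "finite R" "R \<noteq> {}"
  shows "average R x (cbd f) ys = f ys - cbd (average R x f) ys"
proof -
  have "cbd (average R x f) ys = (\<Sum>r\<in>R. cbd (\<lambda>ys. f ((x \<star> r) # ys)) ys) / real (card R)"
    unfolding average_def by (simp only: cbd_divide cbd_sum)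
  then show ?thesis using assms by (simp add: average_def sum_subtractf diff_divide_distrib)
qed

lemma averages_diff: "averages R (\<lambda>ys. f ys - g ys) xs = averages R f xs - averages R g xs"
  by (rule pull_diff) (rule average_diff)

lemma averages_cbd:
  assumes "finite R" "R \<noteq> {}"
  shows "averages R (cbd f) xs = cbd (averages R f) xs"
  by (rule pull_cbd[where good = "\<lambda>_. True"]) (simp_all add: average_diff average_cbd[OF assms] del: cbd.simps, simp add: average_def)

lemma averages_homotopy:
  assumes "finite R" "R \<noteq> {}"
  shows "cbd (hom (averages R) f) xs + hom (averages R) (cbd f) xs = averages R f xs - f xs"
  by (rule hom_homotopy) (auto simp: averages_diff averages_cbd[OF assms])

lemma averages_bound:
  assumes R: "finite R" "R \<noteq> {}" "R \<subseteq> S" and S: "\<And>g h. g \<in> S \<Longrightarrow> h \<in> S \<Longrightarrow> g \<star> h \<in> S"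
    and "set gs \<subseteq> S"
    and "\<And>ys. set ys \<subseteq> S \<Longrightarrow> length ys = length gs \<Longrightarrow> \<bar>f ys\<bar> \<le> B"
  shows "\<bar>averages R f gs\<bar> \<le> B"
  using assms(5,6)
proof (induction gs arbitrary: f)
  case (Cons g gs)
  have "\<bar>averages R (average R g f) gs\<bar> \<le> B"
  proof (rule Cons.IH)
    fix ys assume ys: "set ys \<subseteq> S" "length ys = length gs"
    show "\<bar>average R g f ys\<bar> \<le> B" unfolding average_def
      by (rule abs_average_le[OF R(1,2)], rule Cons.prems(2)) (use ys R S Cons.prems(1) in auto)
  qed (use Cons.prems in auto)
  then show ?case by simp
qed simp

lemma averages_cong:
  assumes R: "finite R" "R \<noteq> {}" "R \<subseteq> S" and S: "\<And>g h. g \<in> S \<Longrightarrow> h \<in> S \<Longrightarrow> g \<star> h \<in> S"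
    and "set gs \<subseteq> S"
    and "\<And>ys. set ys \<subseteq> S \<Longrightarrow> length ys = length gs \<Longrightarrow> f ys = g ys"
  shows "averages R f gs = averages R g gs"
proof -
  have "\<bar>averages R (\<lambda>ys. f ys - g ys) gs\<bar> \<le> 0"
    by (rule averages_bound[OF R S assms(5)]) (use assms(6) in auto)
  then show ?thesis by (simp add: averages_diff)
qed

lemma averages_left:
  "averages R f (map (\<lambda>g. h \<star> g) gs) = averages R (\<lambda>ys. f (map (\<lambda>g. h \<star> g) ys)) gs"
proof (induction gs arbitrary: f)
  case (Cons g gs)
  have "average R (h \<star> g) f (map (\<lambda>g. h \<star> g) ys) = average R g (\<lambda>ys. f (map (\<lambda>g. h \<star> g) ys)) ys" for ys
    by (simp add: average_def assoc)
  then show ?case by (simp add: Cons.IH)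
qed simp

lemma hom_averages_left:
  "hom (averages R) f (map (\<lambda>g. h \<star> g) gs) = hom (averages R) (\<lambda>ys. f (map (\<lambda>g. h \<star> g) ys)) gs"
proof (induction gs arbitrary: f)
  case (Cons g gs)
  then show ?case using averages_left[of R _ h "g # gs"] by simp
qed simp

text \<open>A finite substitute for the invariant probability measure on \<open>P / L\<close>: left
  translations permute \<open>R\<close> up to right factors in \<open>L\<close>. Unlike an exact set
  of coset representatives, it survives enlarging \<open>L\<close>.\<close>

definition transversal :: "'a set \<Rightarrow> 'a set \<Rightarrow> 'a set \<Rightarrow> bool" where
  "transversal R P L \<longleftrightarrow> finite R \<and> R \<noteq> {} \<and> R \<subseteq> P \<and>
     (\<forall>u\<in>P. \<exists>\<pi>. bij_betw \<pi> R R \<and> (\<forall>r\<in>R. \<exists>l\<in>L. u \<star> r = \<pi> r \<star> l))"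

lemma transversal_mono: "transversal R P L \<Longrightarrow> L \<subseteq> L' \<Longrightarrow> transversal R P L'"
  unfolding transversal_def by blast

lemma averages_close:
  assumes R: "transversal R P L"
    and "length us = length gs" "set us \<subseteq> P"
    and "\<And>ks ls. length ks = length gs \<Longrightarrow> length ls = length gs \<Longrightarrow> set ks \<subseteq> P \<Longrightarrow> set ls \<subseteq> L \<Longrightarrow>
      \<bar>f (act gs (act ks ls)) - f' (act gs ks)\<bar> \<le> \<epsilon>"
  shows "\<bar>averages R f (act gs us) - averages R f' gs\<bar> \<le> \<epsilon>"
  using assms(2-)
proof (induction gs arbitrary: us f f')
  case Nil
  then show ?case using Nil(3)[of "[]" "[]"] by simp
next
  case (Cons g gs)
  obtain u us' where us: "us = u # us'" using Cons.prems by (cases us) auto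
  then have u: "u \<in> P" using Cons.prems by simp
  then obtain \<pi> where \<pi>: "bij_betw \<pi> R R" "\<And>r. r \<in> R \<Longrightarrow> \<exists>l\<in>L. u \<star> r = \<pi> r \<star> l"
    using R unfolding transversal_def by blast
  have "\<bar>averages R (average R (g \<star> u) f) (act gs us') - averages R (average R g f') gs\<bar> \<le> \<epsilon>"
  proof (rule Cons.IH)
    fix ks ls assume kl: "length ks = length gs" "length ls = length gs" "set ks \<subseteq> P" "set ls \<subseteq> L"
    have "average R g f' (act gs ks) = (\<Sum>r\<in>R. f' ((g \<star> \<pi> r) # act gs ks)) / real (card R)"
      unfolding average_def by (subst sum.reindex_bij_betw[OF \<pi>(1), symmetric]) simp
    then have "average R (g \<star> u) f (act gs (act ks ls)) - average R g f' (act gs ks) =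
      (\<Sum>r\<in>R. f ((g \<star> u \<star> r) # act gs (act ks ls)) - f' ((g \<star> \<pi> r) # act gs ks)) / real (card R)"
      by (simp add: average_def sum_subtractf diff_divide_distrib)
    moreover have "\<bar>\<dots>\<bar> \<le> \<epsilon>"
    proof (rule abs_average_le)
      fix r assume r: "r \<in> R"
      obtain l where l: "l \<in> L" "u \<star> r = \<pi> r \<star> l" using \<pi>(2)[OF r] by blast
      have "\<pi> r \<in> P" using \<pi>(1) r R unfolding bij_betw_def transversal_def by blast
      then show "\<bar>f ((g \<star> u \<star> r) # act gs (act ks ls)) - f' ((g \<star> \<pi> r) # act gs ks)\<bar> \<le> \<epsilon>"
        using Cons.prems(3)[of "\<pi> r # ks" "l # ls"] kl l by (simp add: assoc)
    qed (use R in \<open>auto simp: transversal_def\<close>)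
    ultimately show "\<bar>average R (g \<star> u) f (act gs (act ks ls)) - average R g f' (act gs ks)\<bar> \<le> \<epsilon>"
      by simp
  qed (use Cons.prems us in auto)
  then show ?case by (simp add: us)
qed

text \<open>In each prism term some entries stay unaveraged, so their shifts must already lie in
  \<open>L\<close>; this is encoded by the factors \<open>one\<close> in \<open>ks\<close>. The
  doubled entry explains \<open>dups\<close>, and there are \<open>length gs\<close> terms.\<close>

lemma hom_averages_close:
  assumes R: "transversal R P L" and P: "L \<subseteq> P" "one \<in> P"
    and "length us = length gs" "set us \<subseteq> L"
    and "\<And>ds ks ls. ds \<in> dups gs \<Longrightarrow> length ks = length ds \<Longrightarrow> length ls = length ds \<Longrightarrow>
      set ks \<subseteq> P \<Longrightarrow> set ls \<subseteq> L \<Longrightarrow> \<bar>f (act ds (act ks ls)) - f' (act ds ks)\<bar> \<le> \<epsilon>"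
  shows "\<bar>hom (averages R) f (act gs us) - hom (averages R) f' gs\<bar> \<le> real (length gs) * \<epsilon>"
  using assms(4-)
proof (induction gs arbitrary: us f f')
  case (Cons g gs)
  obtain u us' where us: "us = u # us'" using Cons.prems by (cases us) auto
  then have u: "u \<in> L" "set us' \<subseteq> L" "length us' = length gs" using Cons.prems by auto
  let ?f = "\<lambda>ys. f ((g \<star> u) # ys)" and ?f' = "\<lambda>ys. f' (g # ys)"
  have "\<bar>averages R ?f (act (g # gs) us) - averages R ?f' (g # gs)\<bar> \<le> \<epsilon>"
  proof (rule averages_close[OF R])
    fix ks ls assume "length ks = length (g # gs)" "length ls = length (g # gs)" "set ks \<subseteq> P" "set ls \<subseteq> L"
    then show "\<bar>?f (act (g # gs) (act ks ls)) - ?f' (act (g # gs) ks)\<bar> \<le> \<epsilon>"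
      using Cons.prems(3)[of "g # g # gs" "one # ks" "u # ls"] u P by (simp add: left_one right_one)
  qed (use Cons.prems P in auto)
  moreover have "\<bar>hom (averages R) ?f (act gs us') - hom (averages R) ?f' gs\<bar> \<le> real (length gs) * \<epsilon>"
  proof (rule Cons.IH[OF u(3,2)])
    fix ds ks ls assume "ds \<in> dups gs" "length ks = length ds" "length ls = length ds" "set ks \<subseteq> P" "set ls \<subseteq> L"
    then show "\<bar>?f (act ds (act ks ls)) - ?f' (act ds ks)\<bar> \<le> \<epsilon>"
      using Cons.prems(3)[of "g # ds" "one # ks" "u # ls"] u P by (simp add: left_one right_one)
  qed
  ultimately show ?case by (simp add: us algebra_simps del: pull.simps)
qed simp

end

section \<open>Finite transversals in groups of bijections\<close>

interpretation comp: averaging "(\<circ>)" id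
  by standard (auto simp: comp_assoc)

abbreviation act :: "('a \<Rightarrow> 'a) list \<Rightarrow> ('a \<Rightarrow> 'a) list \<Rightarrow> ('a \<Rightarrow> 'a) list" where
  "act \<equiv> map2 (\<circ>)"

definition bij_subgroup :: "('a \<Rightarrow> 'a) set \<Rightarrow> bool" where
  "bij_subgroup P \<longleftrightarrow> (\<forall>p\<in>P. bij p) \<and> id \<in> P \<and> (\<forall>p\<in>P. \<forall>q\<in>P. p \<circ> q \<in> P) \<and> (\<forall>p\<in>P. inv p \<in> P)"

lemma bij_subgroupD:
  assumes "bij_subgroup P"
  shows "p \<in> P \<Longrightarrow> bij p" "id \<in> P" "p \<in> P \<Longrightarrow> q \<in> P \<Longrightarrow> p \<circ> q \<in> P" "p \<in> P \<Longrightarrow> inv p \<in> P"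
  using assms unfolding bij_subgroup_def by blast+

lemma bij_subgroupI:
  assumes "\<And>p. p \<in> P \<Longrightarrow> bij p" "id \<in> P" "\<And>p q. p \<in> P \<Longrightarrow> q \<in> P \<Longrightarrow> p \<circ> q \<in> P"
    "\<And>p. p \<in> P \<Longrightarrow> inv p \<in> P"
  shows "bij_subgroup P"
  using assms unfolding bij_subgroup_def by blast

lemma bij_inv_comp: "bij p \<Longrightarrow> inv p \<circ> p = id" "bij p \<Longrightarrow> p \<circ> inv p = id"
  by (auto simp: bij_is_inj bij_is_surj simp flip: surj_iff)

text \<open>Elements of different left cosets of \<open>L\<close> have different values of
  \<open>\<phi>\<close>, so the index is finite. The function \<open>rep\<close> is constant on
  cosets, and its range serves as transversal.\<close>

lemma ex_transversal:
  assumes P: "bij_subgroup P" and L: "bij_subgroup L" and sub: "L \<subseteq> P"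
    and fin: "finite (\<phi> ` P)"
    and \<phi>: "\<And>p q. p \<in> P \<Longrightarrow> q \<in> P \<Longrightarrow> \<phi> p = \<phi> q \<Longrightarrow> inv p \<circ> q \<in> L"
  shows "\<exists>R. comp.transversal R P L"
proof -
  note PD = bij_subgroupD[OF P] and LD = bij_subgroupD[OF L]
  define rep where "rep p = (SOME q. q \<in> P \<and> inv p \<circ> q \<in> L)" for p
  have rep: "rep p \<in> P" "inv p \<circ> rep p \<in> L" if "p \<in> P" for p
    using someI[of "\<lambda>q. q \<in> P \<and> inv p \<circ> q \<in> L" p] that LD(2) bij_inv_comp(1)[OF PD(1)[OF that]]
    unfolding rep_def by auto
  have sym: "inv q \<circ> p \<in> L" if "p \<in> P" "q \<in> P" "inv p \<circ> q \<in> L" for p q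
    using LD(4)[OF that(3)] that(1,2)
    by (simp add: o_inv_distrib PD bij_imp_bij_inv inv_inv_eq)
  have trans: "inv p \<circ> r \<in> L" if "p \<in> P" "q \<in> P" "inv p \<circ> q \<in> L" "inv q \<circ> r \<in> L" for p q r
  proof -
    have "(inv p \<circ> q) \<circ> (inv q \<circ> r) = inv p \<circ> (q \<circ> inv q) \<circ> r" by (simp only: comp_assoc)
    also have "\<dots> = inv p \<circ> r" using bij_inv_comp(2)[OF PD(1)[OF that(2)]] by simp
    finally show ?thesis using LD(3)[OF that(3,4)] by simp
  qed
  have rep_eq: "rep p = rep q" if "p \<in> P" "q \<in> P" "inv p \<circ> q \<in> L" for p q
  proof -
    have "(inv p \<circ> r \<in> L) = (inv q \<circ> r \<in> L)" for r
      using that sym trans by blast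
    then show ?thesis by (simp add: rep_def)
  qed
  have rep_rep: "rep (rep p) = rep p" if "p \<in> P" for p
    using rep_eq[OF that rep(1)[OF that] rep(2)[OF that]] by simp
  let ?R = "rep ` P"
  have "rep p = rep (SOME q. q \<in> P \<and> \<phi> q = \<phi> p)" if p: "p \<in> P" for p
  proof (rule rep_eq)
    have "(SOME q. q \<in> P \<and> \<phi> q = \<phi> p) \<in> P \<and> \<phi> (SOME q. q \<in> P \<and> \<phi> q = \<phi> p) = \<phi> p"
      by (rule someI[of _ p]) (use p in simp)
    then show "(SOME q. q \<in> P \<and> \<phi> q = \<phi> p) \<in> P" "inv p \<circ> (SOME q. q \<in> P \<and> \<phi> q = \<phi> p) \<in> L"
      using \<phi> p by auto
  qed (rule p)
  then have "?R \<subseteq> (\<lambda>a. rep (SOME q. q \<in> P \<and> \<phi> q = a)) ` \<phi> ` P" by blast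
  then have finR: "finite ?R" using fin finite_surj by blast
  have "\<exists>\<pi>. bij_betw \<pi> ?R ?R \<and> (\<forall>r\<in>?R. \<exists>l\<in>L. u \<circ> r = \<pi> r \<circ> l)" if u: "u \<in> P" for u
  proof (intro exI conjI)
    let ?\<pi> = "\<lambda>r. rep (u \<circ> r)"
    have RP: "r \<in> P" if "r \<in> ?R" for r using that rep by blast
    have "inj_on ?\<pi> ?R"
    proof (rule inj_onI)
      fix r s assume rs: "r \<in> ?R" "s \<in> ?R" "rep (u \<circ> r) = rep (u \<circ> s)"
      have ur: "u \<circ> r \<in> P" "u \<circ> s \<in> P" using rs RP PD(3) u by blast+
      have "inv (u \<circ> r) \<circ> rep (u \<circ> s) \<in> L" using rep(2)[OF ur(1)] rs(3) by simp
      moreover have "inv (rep (u \<circ> s)) \<circ> (u \<circ> s) \<in> L" using sym rep ur by blast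
      ultimately have "inv (u \<circ> r) \<circ> (u \<circ> s) \<in> L" using trans ur rep(1) by blast
      moreover have "inv (u \<circ> r) \<circ> (u \<circ> s) = inv r \<circ> (inv u \<circ> u) \<circ> s"
        using o_inv_distrib[OF PD(1)[OF u] PD(1)[OF RP[OF rs(1)]]] by (simp only: comp_assoc)
      ultimately have "inv r \<circ> s \<in> L" using bij_inv_comp(1)[OF PD(1)[OF u]] by simp
      then have "rep r = rep s" using rep_eq RP rs by blast
      then show "r = s" using rs rep_rep by auto
    qed
    moreover have "?\<pi> ` ?R \<subseteq> ?R" using RP PD(3) u by blast
    ultimately show "bij_betw ?\<pi> ?R ?R" using finR by (simp add: bij_betw_def endo_inj_surj)
    show "\<forall>r\<in>?R. \<exists>l\<in>L. u \<circ> r = ?\<pi> r \<circ> l"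
    proof
      fix r assume "r \<in> ?R"
      then have ur: "u \<circ> r \<in> P" using RP PD(3) u by blast
      have "u \<circ> r = rep (u \<circ> r) \<circ> (inv (rep (u \<circ> r)) \<circ> (u \<circ> r))"
        using bij_inv_comp(2)[OF PD(1)[OF rep(1)[OF ur]]] by (simp only: comp_assoc[symmetric]) simp
      then show "\<exists>l\<in>L. u \<circ> r = rep (u \<circ> r) \<circ> l" using sym rep ur by blast
    qed
  qed
  moreover have "?R \<noteq> {}" using PD(2) by blast
  moreover have "?R \<subseteq> P" using rep by blast
  ultimately show ?thesis using finR unfolding comp.transversal_def by blast
qed

section \<open>Subgroups fixing a vertex and their finite indices\<close>

context ff_tree
begin

definition root :: 'v where "root = undefined"

definition U_ball :: "nat \<Rightarrow> ('v \<Rightarrow> 'v) set" where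
  "U_ball j = U_stab d adj c F {v. dst root v \<le> j}"

abbreviation "K \<equiv> U_ball 0"

text \<open>Since \<open>K_out m\<close> is compact, the stabiliser of \<open>root\<close> in \<open>G\<close>, which is the union of
  this chain of groups, is amenable.\<close>

definition K_out :: "nat \<Rightarrow> ('v \<Rightarrow> 'v) set" where
  "K_out m = {g \<in> G. g root = root \<and> (\<forall>v. dst root v > m \<longrightarrow> loc g v \<in> F)}"

lemma U_ball_iff: "g \<in> U_ball j \<longleftrightarrow> g \<in> tree_aut adj \<and> (\<forall>v. loc g v \<in> F) \<and> (\<forall>v. dst root v \<le> j \<longrightarrow> g v = v)"
  by (auto simp: U_ball_def U_stab_def U_grp_def)

lemma U_ball_antimono: "i \<le> j \<Longrightarrow> U_ball j \<subseteq> U_ball i"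
  by (auto simp: U_ball_iff)

lemma U_ball_root: "g \<in> U_ball j \<Longrightarrow> g root = root"
  by (simp add: U_ball_iff)

lemma K_iff: "g \<in> K \<longleftrightarrow> g \<in> tree_aut adj \<and> (\<forall>v. loc g v \<in> F) \<and> g root = root"
proof -
  have "dst root v = 0 \<longleftrightarrow> v = root" for v
    using word_inj[of root v root] by (auto simp: dst_def)
  then show ?thesis by (simp add: U_ball_iff)
qed

lemma U_ball_subset_G: "U_ball j \<subseteq> G"
proof
  fix g assume "g \<in> U_ball j"
  then have "g \<in> tree_aut adj" "loc g v \<in> F" for v by (simp_all only: U_ball_iff)
  moreover from this(2) have "{v. loc g v \<notin> F} = {}" by blast
  ultimately show "g \<in> G" using FF' unfolding G_iff by auto
qed

lemma K_subset_K_out: "K \<subseteq> K_out m"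
  using U_ball_subset_G by (auto simp: K_iff K_out_def)

lemma K_out_mono: "m \<le> n \<Longrightarrow> K_out m \<subseteq> K_out n"
  by (auto simp: K_out_def)

lemma subgroup_U_ball: "bij_subgroup (U_ball j)"
proof (rule bij_subgroupI)
  show bij: "bij p" if "p \<in> U_ball j" for p using that aut_bij by (simp add: U_ball_iff)
  show "p \<circ> q \<in> U_ball j" if p: "p \<in> U_ball j" and q: "q \<in> U_ball j" for p q
    unfolding U_ball_iff
  proof (intro conjI allI impI)
    show "p \<circ> q \<in> tree_aut adj" using p q aut_comp by (simp add: U_ball_iff)
    fix v show "loc (p \<circ> q) v \<in> F"
      using p q loc_comp[of p q v] perm_groupD(3)[OF F] by (simp only: U_ball_iff)
  qed (use p q in \<open>simp add: U_ball_iff\<close>)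
  show "inv p \<in> U_ball j" if p: "p \<in> U_ball j" for p
    unfolding U_ball_iff
  proof (intro conjI allI impI)
    show "inv p \<in> tree_aut adj" using p aut_inv by (simp add: U_ball_iff)
    fix v show "loc (inv p) v \<in> F"
      using p loc_inv[of p v] perm_groupD(4)[OF F] by (simp only: U_ball_iff)
  next
    fix v assume "dst root v \<le> j"
    then show "inv p v = v" using p bij[OF p] by (metis U_ball_iff bij_inv_eq_iff)
  qed
  show "id \<in> U_ball j"
    by (simp only: U_ball_iff loc_id aut_id perm_groupD(2)[OF F]) simp
qed

lemma subgroup_K_out: "bij_subgroup (K_out m)"
proof (rule bij_subgroupI)
  show "bij p" if "p \<in> K_out m" for p using that G_bij by (simp add: K_out_def)
  show "p \<circ> q \<in> K_out m" if p: "p \<in> K_out m" and q: "q \<in> K_out m" for p q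
  proof -
    have pG: "p \<in> G" "p root = root" and qG: "q \<in> G" "q root = root" using p q by (auto simp: K_out_def)
    have "loc (p \<circ> q) v \<in> F" if v: "dst root v > m" for v
    proof -
      have "dst root (q v) = dst root v" using dst_aut[OF G_aut[OF qG(1)], of root v] qG by simp
      then have "loc p (q v) \<in> F" "loc q v \<in> F" using p q v by (auto simp: K_out_def)
      then show ?thesis
        using loc_comp[OF G_aut[OF pG(1)] G_aut[OF qG(1)]] perm_groupD(3)[OF F] by (simp only:)
    qed
    then show ?thesis using G_comp[OF pG(1) qG(1)] pG qG by (simp add: K_out_def)
  qed
  show "inv p \<in> K_out m" if p: "p \<in> K_out m" for p
  proof -
    have pG: "p \<in> G" "p root = root" using p by (auto simp: K_out_def)
    have ip: "inv p root = root" using pG G_bij by (metis bij_inv_eq_iff)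
    have "loc (inv p) v \<in> F" if v: "dst root v > m" for v
    proof -
      have "dst root (inv p v) = dst root v" using dst_aut[OF G_aut[OF G_inv[OF pG(1)]], of root v] ip by simp
      then have "loc p (inv p v) \<in> F" using p v by (auto simp: K_out_def)
      then show ?thesis
        using loc_inv[OF G_aut[OF pG(1)]] perm_groupD(4)[OF F] by (simp only:)
    qed
    then show ?thesis using G_inv[OF pG(1)] ip by (simp add: K_out_def)
  qed
  show "id \<in> K_out m" using subgroup_U_ball[of 0] K_subset_K_out bij_subgroupD(2) by blast
qed

lemma finite_restrictions:
  assumes "\<And>p. p \<in> P \<Longrightarrow> p \<in> tree_aut adj \<and> p root = root"
  shows "finite ((\<lambda>p. restrict p {v. dst root v \<le> j}) ` P)"
proof (rule finite_subset)
  show "finite ({v. dst root v \<le> j} \<rightarrow>\<^sub>E {v. dst root v \<le> j})"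
    by (intro finite_PiE finite_ball)
  show "(\<lambda>p. restrict p {v. dst root v \<le> j}) ` P \<subseteq> {v. dst root v \<le> j} \<rightarrow>\<^sub>E {v. dst root v \<le> j}"
  proof (rule image_subsetI)
    fix p assume "p \<in> P"
    then have "dst root (p v) = dst root v" for v using assms dst_aut[of p root v] by metis
    then show "restrict p {v. dst root v \<le> j} \<in> {v. dst root v \<le> j} \<rightarrow>\<^sub>E {v. dst root v \<le> j}" by simp
  qed
qed

lemma ex_transversal_U_ball: "\<exists>R. comp.transversal R K (U_ball j)"
proof (rule ex_transversal[OF subgroup_U_ball subgroup_U_ball U_ball_antimono])
  show "finite ((\<lambda>p. restrict p {v. dst root v \<le> j}) ` K)"
    by (rule finite_restrictions) (simp add: K_iff)
next
  fix p q assume p: "p \<in> K" and q: "q \<in> K"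
    and eq: "restrict p {v. dst root v \<le> j} = restrict q {v. dst root v \<le> j}"
  have "inv p \<circ> q \<in> K" using p q subgroup_U_ball bij_subgroupD by metis
  moreover have "(inv p \<circ> q) v = v" if "dst root v \<le> j" for v
  proof -
    have "q v = p v" using fun_cong[OF eq, of v] that by simp
    then show ?thesis using p bij_subgroupD(1)[OF subgroup_U_ball] by (simp add: bij_is_inj)
  qed
  ultimately show "inv p \<circ> q \<in> U_ball j" by (simp add: U_ball_iff)
qed simp

text \<open>The radius is \<open>Suc m\<close> because the local permutation at distance
  \<open>m\<close> involves neighbours at distance \<open>Suc m\<close>. Where \<open>p\<close> and
  \<open>q\<close> agree this far, \<open>inv p \<circ> q\<close> has trivial local permutations;
  farther out they lie in \<open>F\<close> anyway.\<close>

lemma ex_transversal_K_out: "\<exists>R. comp.transversal R (K_out m) K"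
proof (rule ex_transversal[OF subgroup_K_out subgroup_U_ball K_subset_K_out])
  show "finite ((\<lambda>p. restrict p {v. dst root v \<le> Suc m}) ` K_out m)"
    by (rule finite_restrictions) (simp add: K_out_def G_iff)
next
  fix p q assume p: "p \<in> K_out m" and q: "q \<in> K_out m"
    and eq: "restrict p {v. dst root v \<le> Suc m} = restrict q {v. dst root v \<le> Suc m}"
  have pA: "p \<in> tree_aut adj" "p root = root" and qA: "q \<in> tree_aut adj" "q root = root"
    using p q by (auto simp: K_out_def G_iff)
  have agree: "q v = p v" if "dst root v \<le> Suc m" for v using fun_cong[OF eq, of v] that by simp
  have inv_p: "inv p (p v) = v" for v using aut_bij[OF pA(1)] by (simp add: bij_is_inj)
  have "inv p \<circ> q \<in> K_out m" using p q subgroup_K_out bij_subgroupD by metis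
  moreover have "loc (inv p \<circ> q) v \<in> F" for v
  proof (cases "dst root v \<le> m")
    case True
    have "loc p v = loc q v"
      by (rule loc_cong) (use agree True dst_nb[of _ root v] in \<open>force+\<close>)
    moreover have "loc (inv p \<circ> q) v = inv (loc p (inv p (q v))) \<circ> loc q v"
      using loc_comp[OF aut_inv[OF pA(1)] qA(1)] loc_inv[OF pA(1)] by (simp only:)
    moreover have "inv p (q v) = v" using agree[of v] True inv_p by simp
    ultimately have "loc (inv p \<circ> q) v = inv (loc q v) \<circ> loc q v" by (simp only:)
    also have "\<dots> = id" using permutes_inj[OF loc_permutes[OF qA(1)]] by (rule inv_o_cancel)
    finally show ?thesis using perm_groupD(2)[OF F] by (simp only:)
  next
    case False
    then show ?thesis using \<open>inv p \<circ> q \<in> K_out m\<close> by (simp add: K_out_def)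
  qed
  ultimately show "inv p \<circ> q \<in> K" by (simp add: K_iff K_out_def G_iff)
qed

lemma root_stabilizer_K_out:
  assumes "g \<in> G" "g root = root"
  shows "\<exists>m. g \<in> K_out m"
proof -
  obtain m where "{v. loc g v \<notin> F} \<subseteq> {v. dst root v \<le> m}"
    using finite_subset_ball assms(1) unfolding G_iff by blast
  then show ?thesis using assms by (intro exI[of _ m]) (force simp: K_out_def)
qed

end

section \<open>Ultralimits of averaged cocycles and of their primitives\<close>

context averaging
begin

definition avg_lim :: "(nat \<Rightarrow> 'a set) \<Rightarrow> ('a list \<Rightarrow> real) \<Rightarrow> 'a list \<Rightarrow> real" where
  "avg_lim R f gs = ulim (\<lambda>j. averages (R j) f gs)"

definition prim_lim :: "(nat \<Rightarrow> 'a set) \<Rightarrow> ('a list \<Rightarrow> real) \<Rightarrow> 'a list \<Rightarrow> real" where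
  "prim_lim R f gs = ulim (\<lambda>j. hom (averages (R j)) f gs)"

context
  fixes S :: "'a set" and R :: "nat \<Rightarrow> 'a set" and f :: "'a list \<Rightarrow> real" and n :: nat and B :: real
  assumes S: "\<And>g h. g \<in> S \<Longrightarrow> h \<in> S \<Longrightarrow> g \<star> h \<in> S"
    and R: "\<And>j. finite (R j)" "\<And>j. R j \<noteq> {}" "\<And>j. R j \<subseteq> S"
    and B: "\<And>gs. set gs \<subseteq> S \<Longrightarrow> length gs = Suc n \<Longrightarrow> \<bar>f gs\<bar> \<le> B"
begin

lemma hom_averages_bound:
  assumes "set gs \<subseteq> S" "length gs = n"
  shows "\<bar>hom (averages (R j)) f gs\<bar> \<le> real n * B"
proof -
  have "\<bar>hom (averages (R j)) f gs\<bar> \<le> real (length gs) * B"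
  proof (rule hom_bound[where S = S and B = B])
    show "\<bar>averages (R j) f xs\<bar> \<le> B"
      if "set xs \<subseteq> S" "\<And>ys. set ys \<subseteq> S \<Longrightarrow> length ys = length xs \<Longrightarrow> \<bar>f ys\<bar> \<le> B" for f xs
      by (rule averages_bound[OF R(1-3) S that])
  qed (use assms B in auto)
  then show ?thesis using assms by simp
qed

lemma avg_lim_tendsto:
  assumes "set gs \<subseteq> S" "length gs = Suc n"
  shows "((\<lambda>j. averages (R j) f gs) \<longlongrightarrow> avg_lim R f gs) ufilter" "\<bar>avg_lim R f gs\<bar> \<le> B"
proof -
  have *: "\<bar>averages (R j) f gs\<bar> \<le> B" for j
    by (rule averages_bound[OF R(1-3) S assms(1)]) (use B assms in auto)
  show "((\<lambda>j. averages (R j) f gs) \<longlongrightarrow> avg_lim R f gs) ufilter" "\<bar>avg_lim R f gs\<bar> \<le> B"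
    unfolding avg_lim_def by (rule ulim_tendsto[OF *], rule ulim_abs_le[OF *])
qed

lemma prim_lim_tendsto:
  assumes "set gs \<subseteq> S" "length gs = n"
  shows "((\<lambda>j. hom (averages (R j)) f gs) \<longlongrightarrow> prim_lim R f gs) ufilter"
    "\<bar>prim_lim R f gs\<bar> \<le> real n * B"
  unfolding prim_lim_def
  by (rule ulim_tendsto[OF hom_averages_bound[OF assms]], rule ulim_abs_le[OF hom_averages_bound[OF assms]])

lemma prim_lim_cbd:
  assumes cocycle: "\<And>gs. set gs \<subseteq> S \<Longrightarrow> length gs = Suc (Suc n) \<Longrightarrow> cbd f gs = 0"
    and gs: "set gs \<subseteq> S" "length gs = Suc n"
  shows "cbd (prim_lim R f) gs = avg_lim R f gs - f gs"
proof -
  have "hom (averages (R j)) (cbd f) gs = 0" for j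
  proof -
    have "\<bar>hom (averages (R j)) (cbd f) gs\<bar> \<le> real (length gs) * 0"
    proof (rule hom_bound[where S = S and B = 0])
      show "\<bar>averages (R j) f xs\<bar> \<le> 0"
        if "set xs \<subseteq> S" "\<And>ys. set ys \<subseteq> S \<Longrightarrow> length ys = length xs \<Longrightarrow> \<bar>f ys\<bar> \<le> 0" for f xs
        by (rule averages_bound[OF R(1-3) S that])
    qed (use cocycle gs in auto)
    then show ?thesis by simp
  qed
  then have "cbd (hom (averages (R j)) f) gs = averages (R j) f gs - f gs" for j
    using averages_homotopy[OF R(1)[of j] R(2)[of j], of f gs] by simp
  moreover have "((\<lambda>j. cbd (hom (averages (R j)) f) gs) \<longlongrightarrow> cbd (prim_lim R f) gs) ufilter"
    by (rule cbd_tendsto, rule prim_lim_tendsto(1)) (use gs in auto)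
  moreover have "((\<lambda>j. averages (R j) f gs - f gs) \<longlongrightarrow> avg_lim R f gs - f gs) ufilter"
    by (rule tendsto_diff[OF avg_lim_tendsto(1)[OF gs] tendsto_const])
  ultimately show ?thesis using tendsto_unique[OF ufilter_bot] by simp
qed

context
  fixes h :: 'a
  assumes h: "h \<in> S"
    and left: "\<And>gs. set gs \<subseteq> S \<Longrightarrow> length gs = Suc n \<Longrightarrow> f (map ((\<star>) h) gs) = f gs"
begin

lemma avg_lim_left:
  assumes "set gs \<subseteq> S" "length gs = Suc n"
  shows "avg_lim R f (map ((\<star>) h) gs) = avg_lim R f gs"
proof -
  have "averages (R j) (\<lambda>ys. f (map ((\<star>) h) ys)) gs = averages (R j) f gs" for j
    by (rule averages_cong[OF R(1-3) S assms(1)]) (use left assms in auto)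
  then show ?thesis by (simp add: avg_lim_def averages_left)
qed

lemma prim_lim_left:
  assumes "set gs \<subseteq> S" "length gs = n"
  shows "prim_lim R f (map ((\<star>) h) gs) = prim_lim R f gs"
proof -
  have "hom (averages (R j)) (\<lambda>ys. f (map ((\<star>) h) ys)) gs = hom (averages (R j)) f gs" for j
  proof (rule hom_cong[where S = S])
    show "averages (R j) f xs = averages (R j) g xs"
      if "set xs \<subseteq> S" "\<And>ys. set ys \<subseteq> S \<Longrightarrow> length ys = length xs \<Longrightarrow> f ys = g ys" for f g xs
      by (rule averages_cong[OF R(1-3) S that])
  qed (use left assms in auto)
  then show ?thesis by (simp add: prim_lim_def hom_averages_left)
qed

end

end

end

section \<open>Averaging cocycles on \<open>G\<close>\<close>

context ff_tree
begin

definition bounded_invariant :: "nat \<Rightarrow> (('v \<Rightarrow> 'v) list \<Rightarrow> real) \<Rightarrow> bool" where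
  "bounded_invariant n f \<longleftrightarrow>
     (\<exists>B. \<forall>gs. set gs \<subseteq> G \<longrightarrow> length gs = n \<longrightarrow> \<bar>f gs\<bar> \<le> B) \<and>
     (\<forall>h\<in>G. \<forall>gs. set gs \<subseteq> G \<longrightarrow> length gs = n \<longrightarrow> f (map ((\<circ>) h) gs) = f gs)"

definition cocycle :: "nat \<Rightarrow> (('v \<Rightarrow> 'v) list \<Rightarrow> real) \<Rightarrow> bool" where
  "cocycle n f \<longleftrightarrow> (\<forall>gs. set gs \<subseteq> G \<longrightarrow> length gs = Suc n \<longrightarrow> cbd f gs = 0)"

definition right_invariant :: "('v \<Rightarrow> 'v) set \<Rightarrow> nat \<Rightarrow> (('v \<Rightarrow> 'v) list \<Rightarrow> real) \<Rightarrow> bool" where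
  "right_invariant T n f \<longleftrightarrow> (\<forall>gs us. set gs \<subseteq> G \<longrightarrow> set us \<subseteq> T \<longrightarrow> length gs = n \<longrightarrow> length us = n \<longrightarrow>
     f (act gs us) = f gs)"

text \<open>Continuity for the product topology, tested on the basic neighbourhoods formed by cosets
  of \<open>U_ball j\<close>; as these groups are nested, one \<open>j\<close> serves all
  entries.\<close>

definition cont :: "nat \<Rightarrow> (('v \<Rightarrow> 'v) list \<Rightarrow> real) \<Rightarrow> bool" where
  "cont n f \<longleftrightarrow> (\<forall>gs. set gs \<subseteq> G \<longrightarrow> length gs = n \<longrightarrow> (\<forall>\<epsilon>>0. \<exists>j. \<forall>us. set us \<subseteq> U_ball j \<longrightarrow> length us = n \<longrightarrow>
     \<bar>f (act gs us) - f gs\<bar> < \<epsilon>))"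

lemma averaging_step:
  assumes R: "\<And>j. finite (R j)" "\<And>j. R j \<noteq> {}" "\<And>j. R j \<subseteq> G"
    and f: "bounded_invariant (Suc n) f" "cocycle (Suc n) f"
  shows "bounded_invariant (Suc n) (comp.avg_lim R f)" "bounded_invariant n (comp.prim_lim R f)"
    "set gs \<subseteq> G \<Longrightarrow> length gs = Suc n \<Longrightarrow> cbd (comp.prim_lim R f) gs = comp.avg_lim R f gs - f gs"
    "set gs \<subseteq> G \<Longrightarrow> length gs = Suc n \<Longrightarrow>
      ((\<lambda>j. comp.averages (R j) f gs) \<longlongrightarrow> comp.avg_lim R f gs) ufilter"
    "set gs \<subseteq> G \<Longrightarrow> length gs = n \<Longrightarrow>
      ((\<lambda>j. hom (comp.averages (R j)) f gs) \<longlongrightarrow> comp.prim_lim R f gs) ufilter"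
proof -
  obtain B where B: "\<And>gs. set gs \<subseteq> G \<Longrightarrow> length gs = Suc n \<Longrightarrow> \<bar>f gs\<bar> \<le> B"
    using f(1) unfolding bounded_invariant_def by blast
  have left: "\<And>gs. set gs \<subseteq> G \<Longrightarrow> length gs = Suc n \<Longrightarrow> f (map ((\<circ>) h) gs) = f gs" if "h \<in> G" for h
    using f(1) that unfolding bounded_invariant_def by blast
  note * = G_comp R B
  show "bounded_invariant (Suc n) (comp.avg_lim R f)"
    unfolding bounded_invariant_def
    using comp.avg_lim_tendsto(2)[where S = G and f = f and R = R and n = n, OF *]
      comp.avg_lim_left[where S = G and f = f and R = R and n = n, OF * _ left] by blast
  show "bounded_invariant n (comp.prim_lim R f)"
    unfolding bounded_invariant_def
    using comp.prim_lim_tendsto(2)[where S = G and f = f and R = R and n = n, OF *]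
      comp.prim_lim_left[where S = G and f = f and R = R and n = n, OF * _ left] by blast
  show "set gs \<subseteq> G \<Longrightarrow> length gs = Suc n \<Longrightarrow> cbd (comp.prim_lim R f) gs = comp.avg_lim R f gs - f gs"
    by (rule comp.prim_lim_cbd[where S = G and f = f and R = R and n = n, OF *]) (use f(2) in \<open>auto simp: cocycle_def\<close>)
  show "set gs \<subseteq> G \<Longrightarrow> length gs = Suc n \<Longrightarrow>
      ((\<lambda>j. comp.averages (R j) f gs) \<longlongrightarrow> comp.avg_lim R f gs) ufilter"
    by (rule comp.avg_lim_tendsto(1)[where S = G and f = f and R = R and n = n, OF *])
  show "set gs \<subseteq> G \<Longrightarrow> length gs = n \<Longrightarrow>
      ((\<lambda>j. hom (comp.averages (R j)) f gs) \<longlongrightarrow> comp.prim_lim R f gs) ufilter"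
    by (rule comp.prim_lim_tendsto(1)[where S = G and f = f and R = R and n = n, OF *])
qed

lemma act_in_G: "set gs \<subseteq> G \<Longrightarrow> set us \<subseteq> G \<Longrightarrow> set (act gs us) \<subseteq> G"
  by (rule comp.set_act[where S = G and T = G]) (auto intro: G_comp)

lemma length_act: "length gs = n \<Longrightarrow> length us = n \<Longrightarrow> length (act gs us) = n"
  by simp

lemma K_out_subset_G: "K_out m \<subseteq> G"
  by (auto simp: K_out_def)

definition root_stab :: "('v \<Rightarrow> 'v) set" where
  "root_stab = {g \<in> G. g root = root}"

lemma root_stab_list:
  assumes "set us \<subseteq> root_stab"
  shows "\<exists>m. set us \<subseteq> K_out m"
  using assms
proof (induction us)
  case (Cons u us)
  then obtain m k where "set us \<subseteq> K_out m" "u \<in> K_out k"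
    using root_stabilizer_K_out[of u] unfolding root_stab_def by auto
  then have "set (u # us) \<subseteq> K_out (max m k)"
    using K_out_mono[of m "max m k"] K_out_mono[of k "max m k"] by auto
  then show ?case by blast
qed simp

text \<open>Averages over \<open>R m\<close> are exactly right \<open>K_out m\<close>-invariant, and
  a given tuple \<open>us\<close> lies in \<open>K_out m\<close> for all large \<open>m\<close>. The
  primitive is only right \<open>K\<close>-invariant, which still makes it continuous.\<close>

lemma average_root_stab:
  assumes f: "bounded_invariant (Suc n) f" "cocycle (Suc n) f" "right_invariant K (Suc n) f"
  shows "\<exists>f' b. bounded_invariant (Suc n) f' \<and> right_invariant root_stab (Suc n) f' \<and>
    bounded_invariant n b \<and> right_invariant K n b \<and>
    (\<forall>gs. set gs \<subseteq> G \<longrightarrow> length gs = Suc n \<longrightarrow> cbd b gs = f' gs - f gs)"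
proof -
  obtain R where tr: "\<And>m. comp.transversal (R m) (K_out m) K" using ex_transversal_K_out by metis
  have R: "finite (R j)" "R j \<noteq> {}" "R j \<subseteq> G" for j
    using tr[of j] K_out_subset_G unfolding comp.transversal_def by blast+
  note step = averaging_step[where R = R, OF R f(1,2)]
  have inv: "\<bar>f (act gs (act ks ls)) - f (act gs ks)\<bar> \<le> 0"
    if "set gs \<subseteq> G" "length gs = Suc n" "length ks = Suc n" "length ls = Suc n" "set ks \<subseteq> K_out m" "set ls \<subseteq> K"
    for gs ks ls m
  proof -
    have "set (act gs ks) \<subseteq> G" using act_in_G that K_out_subset_G by blast
    then have "f (act (act gs ks) ls) = f (act gs ks)"
      using f(3) length_act[OF that(2,3)] that unfolding right_invariant_def by blast
    then show ?thesis by (simp only: comp.act_assoc)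
  qed
  have "right_invariant root_stab (Suc n) (comp.avg_lim R f)"
    unfolding right_invariant_def
  proof (intro allI impI)
    fix gs us assume gs: "set gs \<subseteq> G" "set us \<subseteq> root_stab" "length gs = Suc n" "length us = Suc n"
    obtain m0 where m0: "set us \<subseteq> K_out m0" using root_stab_list gs by blast
    have "comp.averages (R m) f (act gs us) = comp.averages (R m) f gs" if "m \<ge> m0" for m
    proof -
      have "\<bar>comp.averages (R m) f (act gs us) - comp.averages (R m) f gs\<bar> \<le> 0"
        by (rule comp.averages_close[OF tr]) (use gs m0 K_out_mono[OF that] inv in auto)
      then show ?thesis by simp
    qed
    then have "eventually (\<lambda>m. comp.averages (R m) f (act gs us) = comp.averages (R m) f gs) ufilter"
      by (intro eventually_ufilter) (auto simp: eventually_sequentially)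
    moreover have "set (act gs us) \<subseteq> G"
      by (rule act_in_G[OF gs(1)]) (use gs(2) in \<open>auto simp: root_stab_def\<close>)
    then have "((\<lambda>m. comp.averages (R m) f (act gs us)) \<longlongrightarrow> comp.avg_lim R f (act gs us)) ufilter"
      by (rule step(4)) (rule length_act[OF gs(3,4)])
    ultimately have "((\<lambda>m. comp.averages (R m) f gs) \<longlongrightarrow> comp.avg_lim R f (act gs us)) ufilter"
      by (rule tendsto_cong[THEN iffD1])
    then show "comp.avg_lim R f (act gs us) = comp.avg_lim R f gs"
      using step(4)[OF gs(1,3)] tendsto_unique[OF ufilter_bot] by blast
  qed
  moreover have "right_invariant K n (comp.prim_lim R f)"
    unfolding right_invariant_def
  proof (intro allI impI)
    fix gs us assume gs: "set gs \<subseteq> G" "set us \<subseteq> K" "length gs = n" "length us = n"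
    have "hom (comp.averages (R m)) f (act gs us) = hom (comp.averages (R m)) f gs" for m
    proof -
      have "\<bar>hom (comp.averages (R m)) f (act gs us) - hom (comp.averages (R m)) f gs\<bar> \<le> real (length gs) * 0"
      proof (rule comp.hom_averages_close[OF tr K_subset_K_out])
        fix ds ks ls
        assume "ds \<in> dups gs" "length ks = length ds" "length ls = length ds" "set ks \<subseteq> K_out m" "set ls \<subseteq> K"
        then show "\<bar>f (act ds (act ks ls)) - f (act ds ks)\<bar> \<le> 0"
          using inv[of ds ks ls m] dups_properties[of ds gs] gs by auto
      qed (use gs bij_subgroupD(2)[OF subgroup_K_out] in auto)
      then show ?thesis by simp
    qed
    then show "comp.prim_lim R f (act gs us) = comp.prim_lim R f gs"
      by (simp only: comp.prim_lim_def)
  qed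
  ultimately show ?thesis using step(1-3) by blast
qed

section \<open>Compactness of \<open>K\<close>\<close>

text \<open>Orbits of \<open>K\<close> lie in balls around \<open>root\<close> and are finite, so
  values stabilise along the ultrafilter. Every local property of \<open>l\<close> is inherited from
  some \<open>k j\<close> that agrees with it on a finite set; for surjectivity the inverses are
  stabilised too.\<close>

lemma K_ultralimit:
  assumes k: "\<And>j. k j \<in> K"
  shows "\<exists>l\<in>K. \<forall>v. eventually (\<lambda>j. k j v = l v) ufilter"
proof -
  have aut: "k j \<in> tree_aut adj" "k j root = root" "\<And>v. loc (k j) v \<in> F" for j
    using k K_iff by blast+
  have dst_k: "dst root (k j v) = dst root v" for j v
    using dst_aut[OF aut(1)[of j], of root v] aut(2) by simp
  have "\<exists>w. eventually (\<lambda>j. k j v = w) ufilter" for v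
    using ufilter_finite_range[OF finite_ball[of root "dst root v"], of "\<lambda>j. k j v"] dst_k by auto
  then obtain l where l: "\<And>v. eventually (\<lambda>j. k j v = l v) ufilter" by metis
  have ex: "\<exists>j. \<forall>v\<in>A. k j v = l v" if "finite A" for A
  proof -
    have "eventually (\<lambda>j. \<forall>v\<in>A. k j v = l v) ufilter"
      by (rule eventually_ball_finite[OF that]) (use l in blast)
    then show ?thesis by (rule eventually_happens'[OF ufilter_bot])
  qed
  have "inj l"
  proof (rule injI)
    fix u v assume uv: "l u = l v"
    obtain j where "k j u = l u" "k j v = l v" using ex[of "{u, v}"] by auto
    then show "u = v" using uv aut_bij[OF aut(1)[of j]] by (metis bij_is_inj injD)
  qed
  moreover have "w \<in> range l" for w
  proof -
    have kinv: "k j (inv (k j) w) = w" for j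
      using aut_bij[OF aut(1)] by (simp add: bij_is_surj surj_f_inv_f)
    then have "inv (k j) w \<in> {v. dst root v \<le> dst root w}" for j using dst_k[of j "inv (k j) w"] by simp
    then obtain v where "eventually (\<lambda>j. inv (k j) w = v) ufilter"
      using ufilter_finite_range[OF finite_ball[of root "dst root w"], of "\<lambda>j. inv (k j) w"] by blast
    then have "eventually (\<lambda>j. w = l v) ufilter" using l[of v]
      by eventually_elim (use kinv in metis)
    then show ?thesis using eventually_happens'[OF ufilter_bot] by blast
  qed
  ultimately have "bij l" unfolding bij_def by blast
  moreover have "adj (l u) (l v) \<longleftrightarrow> adj u v" for u v
  proof -
    obtain j where "k j u = l u" "k j v = l v" using ex[of "{u, v}"] by auto
    then show ?thesis using aut_adj[OF aut(1)[of j]] by metis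
  qed
  ultimately have "l \<in> tree_aut adj" by (simp add: tree_aut_def)
  moreover have "loc l v \<in> F" for v
  proof -
    obtain j where j: "\<forall>w\<in>insert v (nb v ` {1..d}). k j w = l w"
      using ex[of "insert v (nb v ` {1..d})"] by auto
    then have "loc l v = loc (k j) v" by (intro loc_cong) auto
    then show ?thesis using aut(3) by (simp only:)
  qed
  moreover have "l root = root"
    using ex[of "{root}"] aut(2) by auto
  ultimately have "l \<in> K" by (simp only: K_iff) simp
  then show ?thesis using l by blast
qed

text \<open>Compactness: the counterexamples \<open>ks j\<close> converge entrywise to
  \<open>?l\<close>. For suitable \<open>j\<close>, both \<open>ks j\<close> and
  \<open>act (ks j) (us j)\<close> differ from \<open>?l\<close> by right factors in
  \<open>U_ball J\<close>, so continuity at \<open>gs'\<close> gives \<open>\<epsilon> / 2\<close>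
  twice.\<close>

lemma K_uniform_continuity:
  assumes f: "cont n f" and gs: "set gs \<subseteq> G" "length gs = n" and "\<epsilon> > 0"
  shows "\<exists>j. \<forall>ks us. set ks \<subseteq> K \<longrightarrow> set us \<subseteq> U_ball j \<longrightarrow> length ks = n \<longrightarrow> length us = n \<longrightarrow>
    \<bar>f (act gs (act ks us)) - f (act gs ks)\<bar> < \<epsilon>"
proof (rule ccontr)
  assume "\<not> ?thesis"
  then have "\<forall>j. \<exists>ks us. set ks \<subseteq> K \<and> set us \<subseteq> U_ball j \<and> length ks = n \<and> length us = n \<and>
    \<not> \<bar>f (act gs (act ks us)) - f (act gs ks)\<bar> < \<epsilon>" by blast
  then obtain ks us where ku: "\<And>j. set (ks j) \<subseteq> K" "\<And>j. set (us j) \<subseteq> U_ball j"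
    "\<And>j. length (ks j) = n" "\<And>j. length (us j) = n"
    and far: "\<And>j. \<not> \<bar>f (act gs (act (ks j) (us j))) - f (act gs (ks j))\<bar> < \<epsilon>" by metis
  have "\<exists>l\<in>K. \<forall>v. eventually (\<lambda>j. (ks j ! i) v = l v) ufilter" if "i < n" for i
    by (rule K_ultralimit, rule subsetD[OF ku(1)], rule nth_mem) (simp add: ku(3) that)
  then obtain l where l: "\<And>i. i < n \<Longrightarrow> l i \<in> K"
    "\<And>i v. i < n \<Longrightarrow> eventually (\<lambda>j. (ks j ! i) v = l i v) ufilter" by metis
  let ?l = "map l [0..<n]"
  have l_K: "set ?l \<subseteq> K" using l(1) by auto
  define gs' where "gs' = act gs ?l"
  have gs': "set gs' \<subseteq> G" "length gs' = n"
    unfolding gs'_def using act_in_G[OF gs(1), of ?l] l_K U_ball_subset_G gs(2) by auto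
  then obtain J where J: "\<And>us. set us \<subseteq> U_ball J \<Longrightarrow> length us = n \<Longrightarrow> \<bar>f (act gs' us) - f gs'\<bar> < \<epsilon> / 2"
    using f[unfolded cont_def, rule_format, OF gs', of "\<epsilon> / 2"] \<open>\<epsilon> > 0\<close> by auto
  have "eventually (\<lambda>j. \<forall>i\<in>{..<n}. \<forall>v\<in>{v. dst root v \<le> J}. (ks j ! i) v = l i v) ufilter"
    by (intro eventually_ball_finite ballI finite_ball finite_lessThan l(2)) auto
  moreover have "eventually (\<lambda>j. j \<ge> J) ufilter"
    by (rule eventually_ufilter) (rule eventually_ge_at_top)
  ultimately have "eventually (\<lambda>j. j \<ge> J \<and> (\<forall>i\<in>{..<n}. \<forall>v\<in>{v. dst root v \<le> J}. (ks j ! i) v = l i v)) ufilter"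
    by eventually_elim blast
  from eventually_happens'[OF ufilter_bot this] obtain j
    where j: "j \<ge> J" and agree: "\<And>i v. i < n \<Longrightarrow> dst root v \<le> J \<Longrightarrow> (ks j ! i) v = l i v"
    by auto
  let ?ms = "map (\<lambda>i. inv (l i) \<circ> ks j ! i) [0..<n]"
  have "inv (l i) \<circ> ks j ! i \<in> U_ball J" if i: "i < n" for i
  proof -
    have kj: "ks j ! i \<in> K" by (rule subsetD[OF ku(1)], rule nth_mem) (simp add: ku(3) i)
    have "inv (l i) \<circ> ks j ! i \<in> K" 
      by (intro bij_subgroupD(3,4)[OF subgroup_U_ball] l(1)[OF i] kj)
    moreover have "(inv (l i) \<circ> ks j ! i) v = v" if "dst root v \<le> J" for v
      using agree[OF i that] bij_subgroupD(1)[OF subgroup_U_ball l(1)[OF i]] by (simp add: bij_is_inj)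
    ultimately show ?thesis by (simp add: U_ball_iff)
  qed
  then have ms: "set ?ms \<subseteq> U_ball J" "length ?ms = n" by auto
  have ks_eq: "act ?l ?ms = ks j"
  proof (rule nth_equalityI)
    fix i assume "i < length (act ?l ?ms)"
    then have i: "i < n" by simp
    have "l i \<circ> (inv (l i) \<circ> ks j ! i) = ks j ! i"
      using bij_inv_comp(2)[OF bij_subgroupD(1)[OF subgroup_U_ball l(1)[OF i]]]
      by (simp only: comp_assoc[symmetric]) simp
    then show "act ?l ?ms ! i = ks j ! i" using i by simp
  qed (simp add: ku)
  have us_J: "set (us j) \<subseteq> U_ball J" using ku(2)[of j] U_ball_antimono[OF j] by blast
  have "set (act ?ms (us j)) \<subseteq> U_ball J"
    by (rule comp.set_act[OF ms(1) us_J]) (rule bij_subgroupD(3)[OF subgroup_U_ball])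
  then have "\<bar>f (act gs' (act ?ms (us j))) - f gs'\<bar> < \<epsilon> / 2" by (rule J) (simp add: ku)
  moreover have "\<bar>f (act gs' ?ms) - f gs'\<bar> < \<epsilon> / 2" by (rule J[OF ms])
  moreover have "act gs' ?ms = act gs (ks j)"
    unfolding gs'_def comp.act_assoc[symmetric] ks_eq ..
  moreover have "act gs' (act ?ms (us j)) = act gs (act (ks j) (us j))"
    using calculation(3) by (simp only: comp.act_assoc)
  ultimately have "\<bar>f (act gs (act (ks j) (us j))) - f (act gs (ks j))\<bar> < \<epsilon>" by (simp only:)
  then show False using far by blast
qed

text \<open>Uniform continuity makes the averages over transversals of \<open>K / U_ball j\<close>
  nearly right \<open>K\<close>-invariant for large \<open>j\<close>, and exactly so in the limit.
  For the primitive the same estimate is needed at the finitely many tuples in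
  \<open>dups gs\<close>.\<close>

lemma average_K:
  assumes f: "bounded_invariant (Suc n) f" "cocycle (Suc n) f" "cont (Suc n) f"
  shows "\<exists>f' b. bounded_invariant (Suc n) f' \<and> right_invariant K (Suc n) f' \<and>
    bounded_invariant n b \<and> cont n b \<and>
    (\<forall>gs. set gs \<subseteq> G \<longrightarrow> length gs = Suc n \<longrightarrow> cbd b gs = f' gs - f gs)"
proof -
  obtain R where tr: "\<And>j. comp.transversal (R j) K (U_ball j)" using ex_transversal_U_ball by metis
  have R: "finite (R j)" "R j \<noteq> {}" "R j \<subseteq> G" for j
    using tr[of j] U_ball_subset_G unfolding comp.transversal_def by blast+
  note step = averaging_step[where R = R, OF R f(1,2)]
  have tr': "comp.transversal (R j) K (U_ball i)" if "i \<le> j" for i j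
    using comp.transversal_mono[OF tr U_ball_antimono[OF that]] .
  have "right_invariant K (Suc n) (comp.avg_lim R f)"
    unfolding right_invariant_def
  proof (intro allI impI)
    fix gs us assume gs: "set gs \<subseteq> G" "set us \<subseteq> K" "length gs = Suc n" "length us = Suc n"
    have gu: "set (act gs us) \<subseteq> G" "length (act gs us) = Suc n"
      using act_in_G gs U_ball_subset_G length_act[OF gs(3,4)] by blast+
    have "\<bar>comp.avg_lim R f (act gs us) - comp.avg_lim R f gs\<bar> \<le> \<epsilon>" if "\<epsilon> > 0" for \<epsilon>
    proof -
      obtain J where J: "\<And>ks ls. set ks \<subseteq> K \<Longrightarrow> set ls \<subseteq> U_ball J \<Longrightarrow> length ks = Suc n \<Longrightarrow> length ls = Suc n \<Longrightarrow>
          \<bar>f (act gs (act ks ls)) - f (act gs ks)\<bar> < \<epsilon>"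
        using K_uniform_continuity[OF f(3) gs(1,3) \<open>\<epsilon> > 0\<close>] by blast
      have "\<bar>comp.averages (R j) f (act gs us) - comp.averages (R j) f gs\<bar> \<le> \<epsilon>" if "j \<ge> J" for j
      proof (rule comp.averages_close[OF tr'[OF that]])
        show "\<bar>f (act gs (act ks ls)) - f (act gs ks)\<bar> \<le> \<epsilon>"
          if "length ks = length gs" "length ls = length gs" "set ks \<subseteq> K" "set ls \<subseteq> U_ball J" for ks ls
          using J[of ks ls] that gs(3) by (simp only: less_imp_le)
      qed (use gs in auto)
      then have "eventually (\<lambda>j. \<bar>comp.averages (R j) f (act gs us) - comp.averages (R j) f gs\<bar> \<le> \<epsilon>) ufilter"
        by (intro eventually_ufilter) (auto simp: eventually_sequentially)
      then show ?thesis
        by (intro tendsto_upperbound[OF tendsto_rabs[OF tendsto_diff[OF step(4)[OF gu] step(4)[OF gs(1,3)]]]])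
          simp_all
    qed
    then show "comp.avg_lim R f (act gs us) = comp.avg_lim R f gs"
      using field_le_epsilon[of "\<bar>comp.avg_lim R f (act gs us) - comp.avg_lim R f gs\<bar>" 0] by simp
  qed
  moreover have "cont n (comp.prim_lim R f)"
    unfolding cont_def
  proof (intro allI impI)
    fix gs and \<epsilon> :: real assume gs: "set gs \<subseteq> G" "length gs = n" and "\<epsilon> > 0"
    \<comment> \<open>The prism has \<open>n\<close> terms; dividing by \<open>Suc n\<close> makes
      the final bound strict and covers \<open>n = 0\<close>.\<close>
    define \<delta> where "\<delta> = \<epsilon> / real (Suc n)"
    have "\<delta> > 0" using \<open>\<epsilon> > 0\<close> by (simp add: \<delta>_def)
    have "\<exists>J. \<forall>ks ls. set ks \<subseteq> K \<longrightarrow> set ls \<subseteq> U_ball J \<longrightarrow> length ks = Suc n \<longrightarrow> length ls = Suc n \<longrightarrow>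
        \<bar>f (act ds (act ks ls)) - f (act ds ks)\<bar> < \<delta>" if "ds \<in> dups gs" for ds
      using K_uniform_continuity[OF f(3) _ _ \<open>\<delta> > 0\<close>, of ds] dups_properties[OF that] gs by auto
    then obtain J where J: "\<And>ds ks ls. ds \<in> dups gs \<Longrightarrow> set ks \<subseteq> K \<Longrightarrow> set ls \<subseteq> U_ball (J ds) \<Longrightarrow>
        length ks = Suc n \<Longrightarrow> length ls = Suc n \<Longrightarrow> \<bar>f (act ds (act ks ls)) - f (act ds ks)\<bar> < \<delta>"
      by metis
    obtain M where M: "\<forall>ds\<in>dups gs. J ds \<le> M"
      by (rule that[of "Max (J ` dups gs)"]) (simp add: finite_dups)
    show "\<exists>j. \<forall>us. set us \<subseteq> U_ball j \<longrightarrow> length us = n \<longrightarrow>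
        \<bar>comp.prim_lim R f (act gs us) - comp.prim_lim R f gs\<bar> < \<epsilon>"
    proof (intro exI[of _ M] allI impI)
      fix us assume us: "set us \<subseteq> U_ball M" "length us = n"
      have gu: "set (act gs us) \<subseteq> G" "length (act gs us) = n"
        using act_in_G gs us U_ball_subset_G length_act[OF gs(2) us(2)] by blast+
      have "\<bar>hom (comp.averages (R j)) f (act gs us) - hom (comp.averages (R j)) f gs\<bar> \<le> real (length gs) * \<delta>"
        if "j \<ge> M" for j
      proof (rule comp.hom_averages_close[OF tr'[OF that] U_ball_antimono])
        fix ds ks ls
        assume a: "ds \<in> dups gs" "length ks = length ds" "length ls = length ds" "set ks \<subseteq> K" "set ls \<subseteq> U_ball M"
        then have "set ls \<subseteq> U_ball (J ds)" using M U_ball_antimono by blast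
        then show "\<bar>f (act ds (act ks ls)) - f (act ds ks)\<bar> \<le> \<delta>"
          using J[OF a(1,4)] a dups_properties[OF a(1)] gs by (simp add: less_imp_le)
      qed (use gs us bij_subgroupD(2)[OF subgroup_U_ball] in auto)
      then have "eventually (\<lambda>j. \<bar>hom (comp.averages (R j)) f (act gs us) - hom (comp.averages (R j)) f gs\<bar> \<le> real n * \<delta>) ufilter"
        using gs by (intro eventually_ufilter) (auto simp: eventually_sequentially)
      then have "\<bar>comp.prim_lim R f (act gs us) - comp.prim_lim R f gs\<bar> \<le> real n * \<delta>"
        by (intro tendsto_upperbound[OF tendsto_rabs[OF tendsto_diff[OF step(5)[OF gu] step(5)[OF gs]]]])
          simp_all
      also have "real n * \<delta> < \<epsilon>" using \<open>\<epsilon> > 0\<close> by (simp add: \<delta>_def field_simps)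
      finally show "\<bar>comp.prim_lim R f (act gs us) - comp.prim_lim R f gs\<bar> < \<epsilon>" .
    qed
  qed
  ultimately show ?thesis using step(1-3) by blast
qed

section \<open>Descent to the tree and assembly of the primitive\<close>

lemma ex_root_to: "\<exists>g\<in>G. g root = v"
  using ex_aut_on_path[of "[]" "[]" root v] by auto

text \<open>Evaluation at \<open>root\<close> identifies \<open>G / root_stab\<close> with the
  vertices, so \<open>f\<close> descends to the tree along the section \<open>s\<close>. The
  primitive found there is pulled back by the same evaluation, hence right
  \<open>K\<close>-invariant.\<close>

lemma root_stab_cocycle_trivial:
  assumes f: "bounded_invariant (Suc n) f" "cocycle (Suc n) f" "right_invariant root_stab (Suc n) f"
  shows "\<exists>b. bounded_invariant n b \<and> right_invariant K n b \<and>
    (\<forall>gs. set gs \<subseteq> G \<longrightarrow> length gs = Suc n \<longrightarrow> cbd b gs = f gs)"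
proof -
  define s where "s v = (SOME g. g \<in> G \<and> g root = v)" for v
  have "\<exists>g. g \<in> G \<and> g root = v" for v using ex_root_to[of v] by blast
  from someI_ex[OF this] have s: "s v \<in> G" "s v root = v" for v unfolding s_def by blast+
  obtain B where B: "\<And>gs. set gs \<subseteq> G \<Longrightarrow> length gs = Suc n \<Longrightarrow> \<bar>f gs\<bar> \<le> B"
    using f(1) unfolding bounded_invariant_def by blast
  \<comment> \<open>The value 0 in other lengths makes \<open>f'\<close> bounded and invariant on
    all tuples, as \<open>tree_cocycle_trivial\<close> demands.\<close>
  define f' where "f' xs = (if length xs = Suc n then f (map s xs) else 0)" for xs
  let ?o = "map (\<lambda>g. g root)"
  have sG: "set (map s xs) \<subseteq> G" for xs using s(1) by auto
  have f_eq: "f gs = f' (?o gs)" if gs: "set gs \<subseteq> G" "length gs = Suc n" for gs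
  proof -
    let ?us = "map (\<lambda>g. inv (s (g root)) \<circ> g) gs"
    have "inv (s (g root)) \<circ> g \<in> root_stab" if "g \<in> G" for g
      using G_comp[OF G_inv[OF s(1)] that, of "g root"] s(2)[of "g root"] G_bij[OF s(1), of "g root"]
      by (simp add: root_stab_def) (metis bij_inv_eq_iff)
    then have us: "set ?us \<subseteq> root_stab" using gs by auto
    have "act (map s (?o gs)) ?us = gs"
    proof (rule nth_equalityI)
      fix i assume "i < length (act (map s (?o gs)) ?us)"
      then have i: "i < length gs" by simp
      have "s v \<circ> (inv (s v) \<circ> g) = g" for v g
        using bij_inv_comp(2)[OF G_bij[OF s(1)]] by (simp only: comp_assoc[symmetric]) simp
      then show "act (map s (?o gs)) ?us ! i = gs ! i" using i by simp
    qed simp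
    moreover have "f (act (map s (?o gs)) ?us) = f (map s (?o gs))"
      by (rule f(3)[unfolded right_invariant_def, rule_format, OF sG us]) (simp_all add: gs(2))
    ultimately show ?thesis using gs by (simp add: f'_def)
  qed
  have "\<bar>f' xs\<bar> \<le> max B 0" for xs
    using B[OF sG, of xs] by (auto simp: f'_def)
  moreover have "f' (map g xs) = f' xs" if g: "g \<in> G" for g xs
  proof (cases "length xs = Suc n")
    case True
    have "set (map ((\<circ>) g) (map s xs)) \<subseteq> G" using s(1) G_comp[OF g] by auto
    from f_eq[OF this] True have "f (map ((\<circ>) g) (map s xs)) = f' (map g xs)" by (simp add: s(2) o_def)
    moreover have "f (map ((\<circ>) g) (map s xs)) = f (map s xs)"
      using f(1)[unfolded bounded_invariant_def, THEN conjunct2, rule_format, OF g sG] True by simp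
    ultimately show ?thesis using True by (simp add: f'_def)
  qed (simp add: f'_def)
  moreover have "cbd f' xs = 0" if xs: "length xs = Suc (Suc n)" for xs
  proof -
    have "cbd f' xs = cbd (\<lambda>ys. f (map s ys)) xs" by (rule cbd_cong) (use xs in \<open>simp add: f'_def\<close>)
    also have "\<dots> = cbd f (map s xs)" by (simp only: cbd_map)
    also have "\<dots> = 0" using f(2) sG xs unfolding cocycle_def by simp
    finally show ?thesis .
  qed
  ultimately obtain b C where b: "\<And>xs. length xs = Suc n \<Longrightarrow> cbd b xs = f' xs"
    "\<And>g xs. g \<in> G \<Longrightarrow> b (map g xs) = b xs" "\<And>xs. length xs = n \<Longrightarrow> \<bar>b xs\<bar> \<le> C"
    using tree_cocycle_trivial[of f' "max B 0" n] by blast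
  let ?b = "\<lambda>gs. b (?o gs)"
  have "cbd ?b gs = f gs" if "set gs \<subseteq> G" "length gs = Suc n" for gs
    using b(1)[of "?o gs"] f_eq[OF that] that by (simp add: cbd_map)
  moreover have "bounded_invariant n ?b"
    unfolding bounded_invariant_def
  proof (intro conjI exI[of _ C] allI ballI impI)
    fix h and gs :: "('v \<Rightarrow> 'v) list" assume h: "h \<in> G"
    show "?b (map ((\<circ>) h) gs) = ?b gs" using b(2)[OF h, of "?o gs"] by (simp add: o_def)
  qed (simp add: b(3))
  moreover have "right_invariant K n ?b"
    unfolding right_invariant_def
  proof (intro allI impI)
    fix gs us :: "('v \<Rightarrow> 'v) list" assume us: "set us \<subseteq> K" "length gs = n" "length us = n"
    have "?o (act gs us) = ?o gs"
    proof (rule nth_equalityI)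
      fix i assume "i < length (?o (act gs us))"
      then have i: "i < length gs" "i < length us" using us by auto
      then have "us ! i \<in> K" using us(1) nth_mem by blast
      then have "(us ! i) root = root" using U_ball_root by blast
      then show "?o (act gs us) ! i = ?o gs ! i" using i by simp
    qed (use us in simp)
    then show "?b (act gs us) = ?b gs" by (simp only:)
  qed
  ultimately show ?thesis by blast
qed

lemma cocycle_diff_cbd:
  assumes "cocycle (Suc n) f" "\<And>gs. set gs \<subseteq> G \<Longrightarrow> length gs = Suc n \<Longrightarrow> cbd b gs = f' gs - f gs"
  shows "cocycle (Suc n) f'"
  unfolding cocycle_def
proof (intro allI impI)
  fix gs assume gs: "set gs \<subseteq> G" "length gs = Suc (Suc n)"
  have "cbd (cbd b) gs = cbd (\<lambda>ys. f' ys - f ys) gs"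
    by (rule cbd_cong, rule assms(2)) (use gs in auto)
  then show "cbd f' gs = 0" using assms(1) gs by (simp add: cbd_cbd cbd_diff cocycle_def)
qed

lemma bounded_invariant_diff:
  assumes "bounded_invariant n f" "bounded_invariant n g"
  shows "bounded_invariant n (\<lambda>gs. f gs - g gs)"
proof -
  obtain B where B: "\<And>gs. set gs \<subseteq> G \<Longrightarrow> length gs = n \<Longrightarrow> \<bar>f gs\<bar> \<le> B"
    using assms(1) unfolding bounded_invariant_def by blast
  obtain C where C: "\<And>gs. set gs \<subseteq> G \<Longrightarrow> length gs = n \<Longrightarrow> \<bar>g gs\<bar> \<le> C"
    using assms(2) unfolding bounded_invariant_def by blast
  have "\<bar>f gs - g gs\<bar> \<le> B + C" if "set gs \<subseteq> G" "length gs = n" for gs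
    using B[OF that] C[OF that] by linarith
  then show ?thesis using assms unfolding bounded_invariant_def by auto
qed

text \<open>From \<open>f1 = f + cbd b1\<close>, \<open>f2 = f1 + cbd b2\<close> and
  \<open>f2 = cbd b3\<close> the primitive \<open>b3 - b2 - b1\<close> results. Continuity is an
  issue for \<open>b1\<close> only, the other two being right \<open>K\<close>-invariant.\<close>

lemma list_cocycle_trivial:
  assumes f: "bounded_invariant (Suc n) f" "cocycle (Suc n) f" "cont (Suc n) f"
  shows "\<exists>b. bounded_invariant n b \<and> cont n b \<and>
    (\<forall>gs. set gs \<subseteq> G \<longrightarrow> length gs = Suc n \<longrightarrow> cbd b gs = f gs)"
proof -
  obtain f1 b1 where 1: "bounded_invariant (Suc n) f1 \<and> right_invariant K (Suc n) f1 \<and>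
    bounded_invariant n b1 \<and> cont n b1 \<and>
    (\<forall>gs. set gs \<subseteq> G \<longrightarrow> length gs = Suc n \<longrightarrow> cbd b1 gs = f1 gs - f gs)"
    using average_K[OF f] by (elim exE)
  have c1: "cocycle (Suc n) f1" by (rule cocycle_diff_cbd[OF f(2), of b1]) (use 1 in simp)
  obtain f2 b2 where 2: "bounded_invariant (Suc n) f2 \<and> right_invariant root_stab (Suc n) f2 \<and>
    bounded_invariant n b2 \<and> right_invariant K n b2 \<and>
    (\<forall>gs. set gs \<subseteq> G \<longrightarrow> length gs = Suc n \<longrightarrow> cbd b2 gs = f2 gs - f1 gs)"
    using average_root_stab[OF _ c1] 1 by (elim exE conjE) metis
  have c2: "cocycle (Suc n) f2" by (rule cocycle_diff_cbd[OF c1, of b2]) (use 2 in simp)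
  obtain b3 where 3: "bounded_invariant n b3 \<and> right_invariant K n b3 \<and>
    (\<forall>gs. set gs \<subseteq> G \<longrightarrow> length gs = Suc n \<longrightarrow> cbd b3 gs = f2 gs)"
    using root_stab_cocycle_trivial[of n f2] c2 2 by (elim exE conjE) metis
  let ?b = "\<lambda>gs. b3 gs - b2 gs - b1 gs"
  have "bounded_invariant n ?b" using 1 2 3 by (intro bounded_invariant_diff) simp_all
  moreover have "cont n ?b" unfolding cont_def
  proof (intro allI impI)
    fix gs and \<epsilon> :: real assume gs: "set gs \<subseteq> G" "length gs = n" "\<epsilon> > 0"
    then obtain j where j: "\<And>us. set us \<subseteq> U_ball j \<Longrightarrow> length us = n \<Longrightarrow> \<bar>b1 (act gs us) - b1 gs\<bar> < \<epsilon>"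
      using conjunct1[OF conjunct2[OF conjunct2[OF conjunct2[OF 1]]]] unfolding cont_def by blast
    show "\<exists>j. \<forall>us. set us \<subseteq> U_ball j \<longrightarrow> length us = n \<longrightarrow> \<bar>?b (act gs us) - ?b gs\<bar> < \<epsilon>"
    proof (intro exI[of _ j] allI impI)
      fix us assume us: "set us \<subseteq> U_ball j" "length us = n"
      then have "set us \<subseteq> K" using U_ball_antimono[of 0 j] by blast
      then have "b2 (act gs us) = b2 gs" "b3 (act gs us) = b3 gs"
        using 2 3 gs us by (simp_all add: right_invariant_def)
      then show "\<bar>?b (act gs us) - ?b gs\<bar> < \<epsilon>" using j[OF us] by simp
    qed
  qed
  moreover have "cbd ?b gs = f gs" if "set gs \<subseteq> G" "length gs = Suc n" for gs
    using 1 2 3 that by (simp add: cbd_diff)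
  ultimately show ?thesis by blast
qed

end

section \<open>Continuous cochains\<close>

context ff_tree
begin

abbreviation "top_G \<equiv> GFF_top d adj c F F'"

text \<open>\<open>topology\<close> can be unfolded only once the family is known to be a topology;
  for intersections, the stabiliser of a union of finite sets lies in both stabilisers.\<close>

lemma openin_top_G:
  "openin top_G A \<longleftrightarrow> A \<subseteq> G \<and> (\<forall>g\<in>A. \<exists>S. finite S \<and> (\<circ>) g ` U_stab d adj c F S \<subseteq> A)"
proof -
  have stab_mono: "U_stab d adj c F (S \<union> T) \<subseteq> U_stab d adj c F S"
    "U_stab d adj c F (S \<union> T) \<subseteq> U_stab d adj c F T" for S T
    by (auto simp: U_stab_def)
  let ?P = "\<lambda>A. A \<subseteq> G \<and> (\<forall>g\<in>A. \<exists>S. finite S \<and> (\<circ>) g ` U_stab d adj c F S \<subseteq> A)"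
  have "istopology ?P"
    unfolding istopology_def
  proof (intro conjI allI impI)
    fix A B assume A: "?P A" and B: "?P B"
    show "A \<inter> B \<subseteq> G" using A by blast
    show "\<forall>g\<in>A \<inter> B. \<exists>S. finite S \<and> (\<circ>) g ` U_stab d adj c F S \<subseteq> A \<inter> B"
    proof
      fix g assume "g \<in> A \<inter> B"
      then obtain S T where "finite S" "(\<circ>) g ` U_stab d adj c F S \<subseteq> A"
        "finite T" "(\<circ>) g ` U_stab d adj c F T \<subseteq> B"
        using A B by blast
      then show "\<exists>S. finite S \<and> (\<circ>) g ` U_stab d adj c F S \<subseteq> A \<inter> B"
        using stab_mono by (intro exI[of _ "S \<union> T"]) blast
    qed
  next
    fix \<A> assume P: "\<forall>A\<in>\<A>. ?P A"
    show "\<Union>\<A> \<subseteq> G" using P by blast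
    show "\<forall>g\<in>\<Union>\<A>. \<exists>S. finite S \<and> (\<circ>) g ` U_stab d adj c F S \<subseteq> \<Union>\<A>"
    proof
      fix g assume "g \<in> \<Union>\<A>"
      then obtain A where "A \<in> \<A>" "g \<in> A" by blast
      moreover from this obtain S where "finite S" "(\<circ>) g ` U_stab d adj c F S \<subseteq> A" using P by blast
      ultimately show "\<exists>S. finite S \<and> (\<circ>) g ` U_stab d adj c F S \<subseteq> \<Union>\<A>" by blast
    qed
  qed
  then show ?thesis unfolding GFF_top_def by (simp add: topology_inverse')
qed

lemma openin_top_G_D:
  assumes "openin top_G A" "g \<in> A"
  shows "\<exists>j. (\<circ>) g ` U_ball j \<subseteq> A"
proof -
  obtain S where S: "finite S" "(\<circ>) g ` U_stab d adj c F S \<subseteq> A"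
    using assms openin_top_G by blast
  obtain j where "S \<subseteq> {v. dst root v \<le> j}" using finite_subset_ball[OF S(1)] by blast
  then have "U_ball j \<subseteq> U_stab d adj c F S" by (auto simp: U_ball_def U_stab_def)
  then show ?thesis using S(2) by blast
qed

lemma openin_coset:
  assumes "g \<in> G"
  shows "openin top_G ((\<circ>) g ` U_ball j)"
  unfolding openin_top_G
proof (intro conjI ballI)
  show "(\<circ>) g ` U_ball j \<subseteq> G" using G_comp[OF assms] U_ball_subset_G by blast
  fix h assume "h \<in> (\<circ>) g ` U_ball j"
  then obtain u where u: "u \<in> U_ball j" "h = g \<circ> u" by blast
  have "(\<circ>) h ` U_ball j \<subseteq> (\<circ>) g ` U_ball j"
    using bij_subgroupD(3)[OF subgroup_U_ball u(1)] u(2) by (auto simp: comp_assoc)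
  then show "\<exists>S. finite S \<and> (\<circ>) h ` U_stab d adj c F S \<subseteq> (\<circ>) g ` U_ball j"
    using finite_ball[of root j] unfolding U_ball_def by blast
qed

lemma topspace_top_G: "topspace top_G = G"
proof -
  have "openin top_G G"
    unfolding openin_top_G using G_comp U_ball_subset_G[of 0] finite_ball[of root 0]
    unfolding U_ball_def by blast
  then show ?thesis using openin_top_G by (simp add: topspace_def) blast
qed

abbreviation tuple :: "nat \<Rightarrow> ('v \<Rightarrow> 'v) list \<Rightarrow> nat \<Rightarrow> 'v \<Rightarrow> 'v" where
  "tuple n gs \<equiv> (\<lambda>i\<in>{..n}. gs ! i)"

lemma tuple_in: "set gs \<subseteq> G \<Longrightarrow> length gs = Suc n \<Longrightarrow> tuple n gs \<in> PiE {..n} (\<lambda>_. G)"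
  by (auto simp: less_Suc_eq_le)

lemma tuple_map: "x \<in> PiE {..n} (\<lambda>_. A) \<Longrightarrow> tuple n (map x [0..<Suc n]) = x"
  by (rule ext) (auto simp: PiE_def extensional_def less_Suc_eq_le simp del: upt_Suc)

lemma map_in: "x \<in> PiE {..n} (\<lambda>_. G) \<Longrightarrow> set (map x [0..<Suc n]) \<subseteq> G"
  by (auto simp: PiE_def Pi_def less_Suc_eq_le simp del: upt_Suc)

lemma cont_of_continuous:
  assumes f: "continuous_map (product_topology (\<lambda>_. top_G) {..n}) euclideanreal f"
  shows "cont (Suc n) (\<lambda>gs. f (tuple n gs))"
  unfolding cont_def
proof (intro allI impI)
  fix gs and \<epsilon> :: real assume gs: "set gs \<subseteq> G" "length gs = Suc n" and "\<epsilon> > 0"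
  let ?x = "tuple n gs" and ?X = "product_topology (\<lambda>_. top_G) {..n}"
  have sp: "topspace ?X = PiE {..n} (\<lambda>_. G)" by (simp add: topspace_top_G)
  have "openin ?X {x \<in> topspace ?X. f x \<in> ball (f ?x) \<epsilon>}"
    by (rule openin_continuous_map_preimage[OF f]) simp
  moreover have "?x \<in> {x \<in> topspace ?X. f x \<in> ball (f ?x) \<epsilon>}"
    using tuple_in[OF gs] \<open>\<epsilon> > 0\<close> unfolding sp by simp
  ultimately obtain V where V: "\<forall>i\<in>{..n}. openin top_G (V i)" "?x \<in> PiE {..n} V"
    "PiE {..n} V \<subseteq> {x \<in> topspace ?X. f x \<in> ball (f ?x) \<epsilon>}"
    unfolding openin_product_topology_alt by meson
  have "\<exists>j. (\<circ>) (gs ! i) ` U_ball j \<subseteq> V i" if "i \<le> n" for i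
  proof -
    have "gs ! i \<in> V i" using V(2) that by (auto simp: PiE_def Pi_def)
    then show ?thesis using openin_top_G_D V(1) that by blast
  qed
  then obtain J where J: "\<And>i. i \<le> n \<Longrightarrow> (\<circ>) (gs ! i) ` U_ball (J i) \<subseteq> V i" by metis
  show "\<exists>j. \<forall>us. set us \<subseteq> U_ball j \<longrightarrow> length us = Suc n \<longrightarrow>
      \<bar>f (tuple n (act gs us)) - f (tuple n gs)\<bar> < \<epsilon>"
  \<comment> \<open>The largest radius gives the smallest of the groups, which fits into every
    factor.\<close>
  proof (intro exI[of _ "Max (J ` {..n})"] allI impI)
    fix us assume us: "set us \<subseteq> U_ball (Max (J ` {..n}))" "length us = Suc n"
    have "act gs us ! i \<in> V i" if i: "i \<le> n" for i
    proof -
      have "us ! i \<in> U_ball (Max (J ` {..n}))" by (rule subsetD[OF us(1)]) (simp add: us(2) i less_Suc_eq_le)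
      then have "us ! i \<in> U_ball (J i)" using U_ball_antimono[of "J i" "Max (J ` {..n})"] i by auto
      then have "gs ! i \<circ> us ! i \<in> V i" using J[OF i] by blast
      then show ?thesis using gs us i by (simp add: less_Suc_eq_le)
    qed
    then have "tuple n (act gs us) \<in> PiE {..n} V" by auto
    then have "f (tuple n (act gs us)) \<in> ball (f ?x) \<epsilon>" using V(3) by blast
    then show "\<bar>f (tuple n (act gs us)) - f (tuple n gs)\<bar> < \<epsilon>"
      by (simp add: dist_real_def abs_minus_commute)
  qed
qed

lemma continuous_of_cont:
  assumes b: "cont (Suc n) b"
  shows "continuous_map (product_topology (\<lambda>_. top_G) {..n}) euclideanreal (\<lambda>x. b (map x [0..<Suc n]))"
    (is "continuous_map ?X _ ?f")
  unfolding continuous_map_def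
proof (intro conjI allI impI)
  have sp: "topspace ?X = PiE {..n} (\<lambda>_. G)" by (simp add: topspace_top_G)
  fix W assume "openin euclideanreal W"
  then have W: "open W" by simp
  show "openin ?X {x \<in> topspace ?X. ?f x \<in> W}"
  proof (subst openin_subopen, intro ballI)
    fix x assume "x \<in> {x \<in> topspace ?X. ?f x \<in> W}"
    then have x: "x \<in> PiE {..n} (\<lambda>_. G)" "?f x \<in> W" using sp by auto
    obtain \<epsilon> where \<epsilon>: "\<epsilon> > 0" "\<And>y. \<bar>y - ?f x\<bar> < \<epsilon> \<Longrightarrow> y \<in> W"
      using W x(2) unfolding open_dist dist_real_def by blast
    obtain j where j: "\<And>us. set us \<subseteq> U_ball j \<Longrightarrow> length us = Suc n \<Longrightarrow>
        \<bar>b (act (map x [0..<Suc n]) us) - ?f x\<bar> < \<epsilon>"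
      using b[unfolded cont_def, rule_format, OF map_in[OF x(1)], of \<epsilon>] \<epsilon>(1) by auto
    let ?T = "PiE {..n} (\<lambda>i. (\<circ>) (x i) ` U_ball j)"
    have xG: "x i \<in> G" if "i \<le> n" for i using x(1) that by (auto simp: PiE_def Pi_def)
    have "openin ?X ?T"
      unfolding openin_PiE_gen using openin_coset xG by simp
    moreover have "x \<in> ?T"
    proof (rule PiE_I)
      show "x i \<in> (\<circ>) (x i) ` U_ball j" for i
        by (rule image_eqI[of _ _ id]) (simp_all add: bij_subgroupD(2)[OF subgroup_U_ball])
    qed (rule PiE_arb[OF x(1)])
    moreover have "y \<in> {x \<in> topspace ?X. ?f x \<in> W}" if y: "y \<in> ?T" for y
    proof -
      have yG: "y \<in> PiE {..n} (\<lambda>_. G)"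
      proof (rule PiE_I)
        fix i assume "i \<in> {..n}"
        then show "y i \<in> G" using PiE_mem[OF y] xG[of i] G_comp U_ball_subset_G[of j] by fastforce
      qed (rule PiE_arb[OF y])
      have "\<exists>u. u \<in> U_ball j \<and> y i = x i \<circ> u" if "i \<le> n" for i
        using PiE_mem[OF y, of i] that by auto
      then obtain u where u: "\<And>i. i \<le> n \<Longrightarrow> u i \<in> U_ball j \<and> y i = x i \<circ> u i" by metis
      have "act (map x [0..<Suc n]) (map u [0..<Suc n]) = map y [0..<Suc n]"
        by (rule nth_equalityI) (simp_all add: u less_Suc_eq_le del: upt_Suc)
      moreover have "set (map u [0..<Suc n]) \<subseteq> U_ball j"
        using u by (auto simp: less_Suc_eq_le simp del: upt_Suc)
      ultimately have "\<bar>?f y - ?f x\<bar> < \<epsilon>" using j[of "map u [0..<Suc n]"] by simp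
      then show ?thesis using \<epsilon>(2) yG sp by blast
    qed
    ultimately show "\<exists>T. openin ?X T \<and> x \<in> T \<and> T \<subseteq> {x \<in> topspace ?X. ?f x \<in> W}" by blast
  qed
qed simp

lemma cbd_eq_cobound:
  assumes "length gs = Suc (Suc n)"
  shows "cbd (\<lambda>gs. f (tuple n gs)) gs = cobound n f (tuple (Suc n) gs)"
proof -
  have "tuple n (take i gs @ drop (Suc i) gs) = restrict (del_idx i (tuple (Suc n) gs)) {..n}"
    if "i \<le> Suc n" for i
    using that assms by (intro restrict_ext) (auto simp: nth_append del_idx_def min_def)
  then show ?thesis
    by (simp add: cbd_conv_sum cobound_def assms lessThan_Suc_atMost)
qed

lemma cobound_eq_cbd:
  "cobound n (\<lambda>x. b (map x [0..<Suc n])) x = cbd b (map x [0..<Suc (Suc n)])"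
proof -
  have "map (restrict (del_idx i x) {..n}) [0..<Suc n] =
      take i (map x [0..<Suc (Suc n)]) @ drop (Suc i) (map x [0..<Suc (Suc n)])" if "i \<le> Suc n" for i
    by (rule nth_equalityI)
      (use that in \<open>auto simp: nth_append del_idx_def min_def less_Suc_eq_le simp del: upt_Suc\<close>)
  then show ?thesis
    by (simp add: cbd_conv_sum cobound_def lessThan_Suc_atMost del: upt_Suc)
qed

text \<open>Cohomological degree \<open>Suc n\<close> means lists of length
  \<open>Suc (Suc n)\<close>. The primitive lives on lists of length \<open>Suc n\<close>, so the
  augmentation in length 0 is never reached.\<close>

lemma Hcb_vanishes_Suc: "Hcb_vanishes (\<circ>) G top_G (Suc n)"
  unfolding Hcb_vanishes_def
proof (intro allI impI)
  fix f assume "cb_cochain (\<circ>) G top_G (Suc n) f \<and> (\<forall>x\<in>PiE {..Suc (Suc n)} (\<lambda>_. G). cobound (Suc n) f x = 0)"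
  then have inv: "\<And>g x. g \<in> G \<Longrightarrow> x \<in> PiE {..Suc n} (\<lambda>_. G) \<Longrightarrow> f (\<lambda>i\<in>{..Suc n}. g \<circ> x i) = f x"
    and cts: "continuous_map (product_topology (\<lambda>_. top_G) {..Suc n}) euclideanreal f"
    and bdd: "\<exists>B. \<forall>x\<in>PiE {..Suc n} (\<lambda>_. G). \<bar>f x\<bar> \<le> B"
    and coc: "\<And>x. x \<in> PiE {..Suc (Suc n)} (\<lambda>_. G) \<Longrightarrow> cobound (Suc n) f x = 0"
    unfolding cb_cochain_def by blast+
  let ?f = "\<lambda>gs. f (tuple (Suc n) gs)"
  have "?f (map ((\<circ>) h) gs) = ?f gs" if "h \<in> G" "set gs \<subseteq> G" "length gs = Suc (Suc n)" for h gs
  proof -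
    have "tuple (Suc n) (map ((\<circ>) h) gs) = (\<lambda>i\<in>{..Suc n}. h \<circ> tuple (Suc n) gs i)"
      using that by (intro restrict_ext) (simp add: less_Suc_eq_le)
    then show ?thesis using inv[OF that(1) tuple_in[OF that(2,3)]] by simp
  qed
  then have "bounded_invariant (Suc (Suc n)) ?f"
    using bdd tuple_in[of _ "Suc n"] unfolding bounded_invariant_def by meson
  moreover have "cocycle (Suc (Suc n)) ?f"
    unfolding cocycle_def using cbd_eq_cobound coc tuple_in by simp
  moreover have "cont (Suc (Suc n)) ?f" by (rule cont_of_continuous[OF cts])
  ultimately obtain b where b: "bounded_invariant (Suc n) b" "cont (Suc n) b"
    "\<And>gs. set gs \<subseteq> G \<Longrightarrow> length gs = Suc (Suc n) \<Longrightarrow> cbd b gs = ?f gs"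
    using list_cocycle_trivial[of "Suc n" ?f] by blast
  let ?b = "\<lambda>x. b (map x [0..<Suc n])"
  have "cb_cochain (\<circ>) G top_G n ?b"
    unfolding cb_cochain_def
  proof (intro conjI ballI)
    fix g x assume gx: "g \<in> G" "x \<in> PiE {..n} (\<lambda>_. G)"
    have "map (\<lambda>i\<in>{..n}. g \<circ> x i) [0..<Suc n] = map ((\<circ>) g) (map x [0..<Suc n])"
      by (auto simp: less_Suc_eq_le simp del: upt_Suc)
    moreover have "b (map ((\<circ>) g) (map x [0..<Suc n])) = ?b x"
      using b(1)[unfolded bounded_invariant_def, THEN conjunct2, rule_format, OF gx(1) map_in[OF gx(2)]]
      by simp
    ultimately show "b (map (\<lambda>i\<in>{..n}. g \<circ> x i) [0..<Suc n]) = ?b x" by (simp only:)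
  next
    show "continuous_map (product_topology (\<lambda>_. top_G) {..n}) euclideanreal ?b"
      by (rule continuous_of_cont[OF b(2)])
  next
    obtain B where "\<And>gs. set gs \<subseteq> G \<Longrightarrow> length gs = Suc n \<Longrightarrow> \<bar>b gs\<bar> \<le> B"
      using b(1) unfolding bounded_invariant_def by blast
    then show "\<exists>B. \<forall>x\<in>PiE {..n} (\<lambda>_. G). \<bar>?b x\<bar> \<le> B"
      using map_in by (intro exI[of _ B] ballI) (simp del: upt_Suc)
  qed
  moreover have "cobound n ?b x = f x" if x: "x \<in> PiE {..Suc n} (\<lambda>_. G)" for x
    using b(3)[OF map_in[OF x]] tuple_map[OF x] by (simp add: cobound_eq_cbd del: upt_Suc)
  ultimately show "\<exists>b. cb_cochain (\<circ>) G top_G (Suc n - 1) b \<and>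
      (\<forall>x\<in>PiE {..Suc n} (\<lambda>_. G). cobound (Suc n - 1) b x = f x)"
    by (intro exI[of _ ?b]) (simp del: upt_Suc)
qed

end

theorem theorem1:
  fixes d :: nat and adj :: "'v \<Rightarrow> 'v \<Rightarrow> bool" and c :: "'v \<Rightarrow> 'v \<Rightarrow> nat"
    and F F' :: "(nat \<Rightarrow> nat) set"
  assumes "d \<ge> 3"
    and "regular_tree d adj" and "legal_coloring d adj c"
    and "perm_group d F" and "perm_group d F'"
    and "F \<subseteq> F'" and "F \<noteq> F'"
    and "preserves_orbits d F F'"
    and "two_transitive d F'"
  shows "boundedly_acyclic (\<circ>) (GFF d adj c F F') (GFF_top d adj c F F')"
proof -
  interpret ff_tree d adj c F F'
    by unfold_locales (use assms in auto)
  show ?thesis unfolding boundedly_acyclic_def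
  proof (intro allI impI)
    fix n :: nat assume "n \<ge> 1"
    then obtain m where "n = Suc m" by (cases n) auto
    then show "Hcb_vanishes (\<circ>) G top_G n" using Hcb_vanishes_Suc by simp
  qed
qed

end
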